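(* Let $\mathcal{X}=(X_1,X_2,\dots)$ be a stationary and ergodic sequence of real random variables, where each $X_i$ has distribution function $F$ and a density, and suppose $\mathbb{P}(X_1=X_2)=0$. Let $\xi_0$ on $\Delta$ and $\tilde\xi_0$ on $\tilde\Delta$ be the almost sure weak limits of $\xi_{0,n}/\xi_{0,n}(\Delta)$ and $\tilde\xi_{0,n}/\tilde\xi_{0,n}(\tilde\Delta)$. Put $f_I(b,d)=d-b$ and $f_e(b,d)=(d-b)\log(d-b)$. Suppose that for each of the two functions $g(x)=x$ and $g(x)=x\log x+1$ on $[0,\infty)$ (with $0\log 0=0$) there is $\epsilon>0$ with $\mathbb{E}[g(2|X_1|)^{1+\epsilon}]<\infty$, and that $\tilde\xi_0(f_I)<\infty$ and $\tilde\xi_0(f_e+1)<\infty$. Then \[ E_n-\log\tilde\xi_{0,n}(\tilde\Delta)\to-\frac{\tilde\xi_0(f_e)}{\tilde\xi_0(f_I)}+\log\tilde\xi_0(f_I)\quad\text{a.s.}, \] and for any $L>0$ with $\xi_0(\Delta_L)>0$, \[ L\log\xi_{0,n}(\Delta)-A_n^L\to-\int_0^L\log\xi_0(\Delta_\ell)\,d\ell\quad\text{a.s.}, \] as $n\to\infty$.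
   Context: Stationary means strictly stationary; ergodic means every a.s. shift-invariant event has probability $0$ or $1$. $\mu(f)=\int f\,d\mu$. $\Delta=\{(x,y)\in[-\infty,\infty]^2:-\infty<x<y\le\infty\}$, $\tilde\Delta=\Delta\cap\mathbb{R}^2$ (subspace topologies), and $\Delta_\ell=\{(x,y)\in\Delta:y-x>\ell\}$ for $\ell\ge0$. Let $K$ be the graph (simplicial complex) with vertices $v_0,v_1,v_2,\dots$ and edges $\{v_i,v_{i+1}\}$, $i\ge 0$. For $n\ge1$ put $X_{k,n}=X_k$ for $1\le k\le n$, and $X_{k,n}=\infty$ for $k=0$ and for $k>n$. For $t\in\mathbb{R}$ let $K_n(t)=\{\sigma\in K:\max_{v_i\in\sigma}X_{i,n}\le t\}$. Homology is with $\mathbb{Z}_2$ coefficients. The persistence module $\big(H_0(K_n(t))\big)_{t\in\mathbb R}$ with maps induced by inclusions is isomorphic to $\bigoplus_{(b,d)\in PD_0}I(b,d)$ for a unique multiset $PD_0$ of points of $\Delta$ (the $0$-th persistence diagram), where $I(b,d)$ equals $\mathbb{Z}_2$ at $t$ when $b\le t<d$ and $0$ otherwise, with identity maps between nonzero spaces. Set $\xi_{0,n}=\sum_{(b,d)\in PD_0}\delta_{(b,d)}$ (with multiplicity) and let $\tilde\xi_{0,n}$ be its restriction to the Borel sets of $\tilde\Delta$. Under the stated assumptions on $\mathcal X$ (stationarity, ergodicity, density, $\mathbb P(X_1=X_2)=0$) there is a non-random probability measure $\xi_0$ on $\Delta$ such that, with $\tilde\xi_0$ the restriction of $\xi_0$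 to $\mathcal{B}(\tilde\Delta)$, almost surely $\xi_{0,n}/\xi_{0,n}(\Delta)\Rightarrow\xi_0$ and $\tilde\xi_{0,n}/\tilde\xi_{0,n}(\tilde\Delta)\Rightarrow\tilde\xi_0$ weakly. Persistent entropy (excluding the longest barcode): with sums over the points $(b,d)$ of $\tilde\xi_{0,n}$ counted with multiplicity, $L_n=\sum_{(b,d)}(d-b)$ and \[ E_n=-\sum_{(b,d)}\frac{d-b}{L_n}\log\Big(\frac{d-b}{L_n}\Big). \] Truncated ALPS statistic: $A_n^L=\int_0^L\log\xi_{0,n}(\Delta_\ell)\,d\ell$. *)

theory Defs
  imports
    "HOL-Probability.Probability"
    "HOL-Algebra.Coset"
    "HOL-Algebra.Product_Groups"
    "HOL-Library.Multiset"
    "HOL-Library.Z2"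
begin

section \<open>Stationary and ergodic sequences\<close>

definition stationary :: "'a measure \<Rightarrow> (nat \<Rightarrow> 'a \<Rightarrow> real) \<Rightarrow> bool" where
  "stationary M Y \<longleftrightarrow>
     (\<forall>h. distr M (\<Pi>\<^sub>M i\<in>UNIV. borel) (\<lambda>\<omega> i. Y (i + h) \<omega>)
        = distr M (\<Pi>\<^sub>M i\<in>UNIV. borel) (\<lambda>\<omega> i. Y i \<omega>))"

definition ergodic :: "'a measure \<Rightarrow> (nat \<Rightarrow> 'a \<Rightarrow> real) \<Rightarrow> bool" where
  "ergodic M Y \<longleftrightarrow>
     (\<forall>A \<in> sets (\<Pi>\<^sub>M i\<in>UNIV. borel).
        (AE \<omega> in M. (\<lambda>i. Y i \<omega>) \<in> A \<longleftrightarrow> (\<lambda>i. Y (Suc i) \<omega>) \<in> A) \<longrightarrow>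
        measure M {\<omega> \<in> space M. (\<lambda>i. Y i \<omega>) \<in> A} \<in> {0, 1})"


section \<open>Simplicial homology with coefficients in the two-element field\<close>

text \<open>
  A simplicial complex is a set of finite nonempty sets. Chains are finitely supported functions
  from simplices to \<^typ>\<open>bit\<close>. Vector spaces over the two-element field are represented by their
  additive groups: scalar multiplication carries no further information, and additive maps are
  the same as linear maps.
\<close>

definition chains :: "nat \<Rightarrow> 'v set set \<Rightarrow> ('v set \<Rightarrow> bit) set" where
  "chains p K = {c. finite {\<sigma>. c \<sigma> \<noteq> 0} \<and> (\<forall>\<sigma>. c \<sigma> \<noteq> 0 \<longrightarrow> \<sigma> \<in> K \<and> card \<sigma> = Suc p)}"

text \<open>
  No signs are needed in characteristic two. The empty face is discarded (homology is not
  reduced), so that the boundary of a 0-chain is zero.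
\<close>

definition boundary :: "('v set \<Rightarrow> bit) \<Rightarrow> 'v set \<Rightarrow> bit" where
  "boundary c \<tau> =
     (if \<tau> = {} then 0
      else (\<Sum>\<sigma> | c \<sigma> \<noteq> 0 \<and> \<tau> \<subseteq> \<sigma> \<and> card \<sigma> = Suc (card \<tau>). c \<sigma>))"

definition cycles :: "nat \<Rightarrow> 'v set set \<Rightarrow> ('v set \<Rightarrow> bit) set" where
  "cycles p K = {c \<in> chains p K. boundary c = (\<lambda>_. 0)}"

definition boundaries :: "nat \<Rightarrow> 'v set set \<Rightarrow> ('v set \<Rightarrow> bit) set" where
  "boundaries p K = boundary ` chains (Suc p) K"

definition cycle_group :: "nat \<Rightarrow> 'v set set \<Rightarrow> ('v set \<Rightarrow> bit) monoid" where
  "cycle_group p K =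
     \<lparr>carrier = cycles p K, monoid.mult = (\<lambda>c c' \<sigma>. c \<sigma> + c' \<sigma>), one = (\<lambda>_. 0)\<rparr>"

definition homology :: "nat \<Rightarrow> 'v set set \<Rightarrow> ('v set \<Rightarrow> bit) set monoid" where
  "homology p K = cycle_group p K Mod boundaries p K"

text \<open>
  For a subcomplex \<open>K\<close> of \<open>K'\<close> the inclusion induces \<open>[z] \<mapsto> [z]\<close>. On cosets this is
  \<open>A \<mapsto> A + B\<^sub>p(K')\<close>, because \<open>B\<^sub>p(K) \<subseteq> B\<^sub>p(K')\<close>.
\<close>

definition homology_inclusion ::
  "nat \<Rightarrow> 'v set set \<Rightarrow> ('v set \<Rightarrow> bit) set \<Rightarrow> ('v set \<Rightarrow> bit) set" where
  "homology_inclusion p K' A = A <#>\<^bsub>cycle_group p K'\<^esub> boundaries p K'"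


section \<open>Persistence modules and persistence diagrams\<close>

record 'g persistence_module =
  pm_space :: "real \<Rightarrow> 'g monoid"
  pm_map :: "real \<Rightarrow> real \<Rightarrow> 'g \<Rightarrow> 'g" \<comment> \<open>from parameter \<open>s\<close> to \<open>t\<close>, relevant for \<open>s \<le> t\<close>\<close>

definition pm_isomorphic :: "'g persistence_module \<Rightarrow> 'h persistence_module \<Rightarrow> bool" where
  "pm_isomorphic V W \<longleftrightarrow>
     (\<exists>\<phi>. (\<forall>t. \<phi> t \<in> iso (pm_space V t) (pm_space W t)) \<and>
          (\<forall>s t. s \<le> t \<longrightarrow>
             (\<forall>x \<in> carrier (pm_space V s). \<phi> t (pm_map V s t x) = pm_map W s t (\<phi> s x))))"

definition pm_homology :: "nat \<Rightarrow> (real \<Rightarrow> 'v set set) \<Rightarrow> ('v set \<Rightarrow> bit) set persistence_module" where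
  "pm_homology p K =
     \<lparr>pm_space = (\<lambda>t. homology p (K t)), pm_map = (\<lambda>s t. homology_inclusion p (K t))\<rparr>"

definition pm_interval :: "ereal \<times> ereal \<Rightarrow> bit persistence_module" where
  "pm_interval = (\<lambda>(b, d).
     \<lparr>pm_space = (\<lambda>t. \<lparr>carrier = (if b \<le> ereal t \<and> ereal t < d then UNIV else {0}),
                       monoid.mult = (+), one = 0\<rparr>),
      pm_map = (\<lambda>s t x. if b \<le> ereal s \<and> ereal t < d then x else 0)\<rparr>)"

definition pm_direct_sum ::
  "'i set \<Rightarrow> ('i \<Rightarrow> 'g persistence_module) \<Rightarrow> ('i \<Rightarrow> 'g) persistence_module" where
  "pm_direct_sum I V =
     \<lparr>pm_space = (\<lambda>t. sum_group I (\<lambda>i. pm_space (V i) t)),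
      pm_map = (\<lambda>s t x. \<lambda>i\<in>I. pm_map (V i) s t (x i))\<rparr>"

definition Delta :: "(ereal \<times> ereal) set" where
  "Delta = {(x, y). - \<infinity> < x \<and> x < y \<and> y \<le> \<infinity>}"

definition Delta_fin :: "(ereal \<times> ereal) set" where
  "Delta_fin = {(x, y) \<in> Delta. \<bar>x\<bar> \<noteq> \<infinity> \<and> \<bar>y\<bar> \<noteq> \<infinity>}"

definition Delta_len :: "real \<Rightarrow> (ereal \<times> ereal) set" where
  "Delta_len l = {(x, y) \<in> Delta. y - x > ereal l}"

text \<open>
  The multiplicity of \<open>(b, d)\<close> is realised by the indices \<open>((b, d), 0), ((b, d), 1), \<dots>\<close>. The type
  of finite multisets suffices: the filtrations below have finitely many vertices at any
  parameter value, and finitely many vertices in total.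
\<close>

definition is_persistence_diagram ::
  "'g persistence_module \<Rightarrow> (ereal \<times> ereal) multiset \<Rightarrow> bool" where
  "is_persistence_diagram V D \<longleftrightarrow>
     set_mset D \<subseteq> Delta \<and>
     pm_isomorphic V (pm_direct_sum {(p, i :: nat). i < count D p} (\<lambda>(p, i). pm_interval p))"

definition persistence_diagram :: "'g persistence_module \<Rightarrow> (ereal \<times> ereal) multiset" where
  "persistence_diagram V = (THE D. is_persistence_diagram V D)"


section \<open>Sublevel filtration of a time series\<close>

text \<open>The vertex \<open>v\<^sub>i\<close> is the natural number \<open>i\<close>.\<close>

definition path_complex :: "nat set set" where
  "path_complex = (\<Union>i. {{i}, {i, Suc i}})"

definition censored :: "(nat \<Rightarrow> real) \<Rightarrow> nat \<Rightarrow> nat \<Rightarrow> ereal" where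
  "censored x n k = (if 1 \<le> k \<and> k \<le> n then ereal (x k) else \<infinity>)"

definition sublevel_complex :: "(nat \<Rightarrow> real) \<Rightarrow> nat \<Rightarrow> real \<Rightarrow> nat set set" where
  "sublevel_complex x n t = {\<sigma> \<in> path_complex. (MAX i\<in>\<sigma>. censored x n i) \<le> ereal t}"

definition PD0 :: "(nat \<Rightarrow> real) \<Rightarrow> nat \<Rightarrow> (ereal \<times> ereal) multiset" where
  "PD0 x n = persistence_diagram (pm_homology 0 (sublevel_complex x n))"


section \<open>Measures on the half-plane\<close>

definition multiset_measure :: "'p::topological_space set \<Rightarrow> 'p multiset \<Rightarrow> 'p measure" where
  "multiset_measure S D =
     measure_of S (sets (restrict_space borel S)) (\<lambda>A. \<Sum>p\<in>#D. indicator A p)"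

lemma space_multiset_measure [simp]: "space (multiset_measure S D) = S"
  and sets_multiset_measure [simp]:
    "sets (multiset_measure S D) = sets (restrict_space borel S)"
proof -
  have "sets (restrict_space borel S) \<subseteq> Pow S"
    using sets.space_closed[of "restrict_space borel S"] by (simp add: space_restrict_space)
  moreover have "sigma_sets S (sets (restrict_space borel S)) = sets (restrict_space borel S)"
    using sets.sigma_sets_eq[of "restrict_space borel S"] by (simp add: space_restrict_space)
  ultimately show "space (multiset_measure S D) = S"
    "sets (multiset_measure S D) = sets (restrict_space borel S)"
    unfolding multiset_measure_def by (auto simp: space_measure_of_conv)
qed

lemma emeasure_multiset_measure:
  assumes "A \<in> sets (restrict_space borel S)"
  shows "emeasure (multiset_measure S D) A = (\<Sum>p\<in>#D. indicator A p)"
  unfolding multiset_measure_def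
proof (rule emeasure_measure_of_sigma)
  show "sigma_algebra S (sets (restrict_space borel S))"
    using sets.sigma_algebra_axioms[of "restrict_space borel S"] by (simp add: space_restrict_space)
  show "positive (sets (restrict_space borel S)) (\<lambda>A. \<Sum>p\<in>#D. indicator A p :: ennreal)"
    by (induction D) (auto simp: positive_def)
  show "countably_additive (sets (restrict_space borel S)) (\<lambda>A. \<Sum>p\<in>#D. indicator A p :: ennreal)"
  proof (rule countably_additiveI)
    fix B :: "nat \<Rightarrow> 'a set"
    assume B: "disjoint_family B"
    show "(\<Sum>i. \<Sum>p\<in>#D. indicator (B i) p :: ennreal) = (\<Sum>p\<in>#D. indicator (\<Union>i. B i) p)"
      by (induction D) (auto simp: suminf_add[symmetric] suminf_indicator[OF B])
  qed
qed (use assms in auto)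

definition xi0n :: "(nat \<Rightarrow> real) \<Rightarrow> nat \<Rightarrow> (ereal \<times> ereal) measure" where
  "xi0n x n = multiset_measure Delta (PD0 x n)"

definition xi0n_fin :: "(nat \<Rightarrow> real) \<Rightarrow> nat \<Rightarrow> (ereal \<times> ereal) measure" where
  "xi0n_fin x n = restrict_space (xi0n x n) Delta_fin"

definition normalize_measure :: "'p measure \<Rightarrow> 'p measure" where
  "normalize_measure N = scale_measure (inverse (emeasure N (space N))) N"

definition weak_conv_on ::
  "'p::topological_space set \<Rightarrow> (nat \<Rightarrow> 'p measure) \<Rightarrow> 'p measure \<Rightarrow> bool" where
  "weak_conv_on S \<mu>n \<mu> \<longleftrightarrow>
     (\<forall>f :: 'p \<Rightarrow> real. continuous_on S f \<and> bounded (f ` S) \<longrightarrow>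
        (\<lambda>n. \<integral>p. f p \<partial>\<mu>n n) \<longlonglongrightarrow> (\<integral>p. f p \<partial>\<mu>))"


section \<open>Persistent entropy and the truncated ALPS statistic\<close>

definition f_I :: "ereal \<times> ereal \<Rightarrow> real" where
  "f_I = (\<lambda>(b, d). real_of_ereal (d - b))"

definition f_e :: "ereal \<times> ereal \<Rightarrow> real" where
  "f_e = (\<lambda>(b, d). real_of_ereal (d - b) * ln (real_of_ereal (d - b)))"

definition finite_bars :: "(nat \<Rightarrow> real) \<Rightarrow> nat \<Rightarrow> (ereal \<times> ereal) multiset" where
  "finite_bars x n = filter_mset (\<lambda>p. p \<in> Delta_fin) (PD0 x n)"

definition total_length :: "(nat \<Rightarrow> real) \<Rightarrow> nat \<Rightarrow> real" where
  "total_length x n = (\<Sum>p\<in>#finite_bars x n. f_I p)"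

definition persistent_entropy :: "(nat \<Rightarrow> real) \<Rightarrow> nat \<Rightarrow> real" where
  "persistent_entropy x n =
     - (\<Sum>p\<in>#finite_bars x n. f_I p / total_length x n * ln (f_I p / total_length x n))"

definition truncated_ALPS :: "real \<Rightarrow> (nat \<Rightarrow> real) \<Rightarrow> nat \<Rightarrow> real" where
  "truncated_ALPS L x n = (LBINT l:{0..L}. ln (measure (xi0n x n) (Delta_len l)))"

end

theory Submission
  imports Defs
begin

text \<open>
  With \<open>N\<close> finite bars, and with \<open>a\<close> and \<open>e\<close> the averages of \<open>f_I\<close> and \<open>f_e\<close> over them, the
  persistent entropy equals \<open>ln N - e / a + ln a\<close> (\<open>persistent_entropy_eq\<close>). So the first claim is
  the convergence of two averages. Both functions are unbounded, hence weak convergence is not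
  enough; it suffices together with a bound, uniform in the number of samples, on the averages of
  a power \<open>1 + \<epsilon>\<close> (\<open>averages_tendsto_integral\<close>).

  This bound comes from a comparison of bars with samples. The diagram of a path is given by the
  elder rule (\<open>PD0_eq_elder_diagram\<close>): a vertex \<open>v\<close> opens a bar at level \<open>x v\<close>, and the bar ends at
  the lowest level at which \<open>v\<close> is connected to an older vertex. That level is the value of the
  sample at a peak which ends at most two bars, one from either side. Therefore a sum over the
  bars is controlled by a sum over the samples (\<open>sum_finite_bars_le\<close>). In the other direction,
  every passage of the samples from below a level \<open>t\<close> to above \<open>t\<close> ends a component of the
  sublevel complex, so that there are almost as many bars as such passages
  (\<open>card_upcrossings_le\<close>). By ergodicity the sums over the samples grow at most linearly, and the
  number of passages through a suitable level grows at least linearly. Both facts follow from a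
  one-sided ergodic theorem (\<open>stationary_ergodic_partial_sums_bounded_above\<close>).

  The persistence diagram is defined as the unique multiset with an isomorphism to the sum of its
  interval modules. Existence is the elder rule. For uniqueness, the rank of the structure map
  from \<open>s\<close> to \<open>t\<close> counts the bars that cover \<open>[s, t]\<close>, and these numbers determine the multiset.

  The second claim is a statement about weak convergence of normalised finite multisets. After
  division by the number of bars it says that the integrals of \<open>ln\<close> of the measures of
  \<open>Delta_len l\<close> converge. These measures converge wherever the monotone limit is continuous in \<open>l\<close>, that is, for
  all but countably many \<open>l\<close>. They are bounded away from zero, since they are smallest
  at \<open>l = L\<close>, where the limit is positive. Dominated convergence applies.
\<close>

section \<open>A one-sided ergodic theorem\<close>

definition shift_seq :: "(nat \<Rightarrow> real) \<Rightarrow> nat \<Rightarrow> real" where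
  "shift_seq y = (\<lambda>i. y (Suc i))"

lemma measurable_shift_seq [measurable]:
  "shift_seq \<in> measurable (\<Pi>\<^sub>M i\<in>UNIV. borel) (\<Pi>\<^sub>M i\<in>UNIV. borel)"
  unfolding shift_seq_def by (rule measurable_PiM_single') (auto simp: space_PiM)

text \<open>
  The maximum of \<open>0\<close> and the first \<open>k\<close> partial sums of \<open>\<phi>\<close> along the orbit of the shift, in the
  recursive form that relates it to the maximum along the shifted orbit.
\<close>

fun orbit_max :: "((nat \<Rightarrow> real) \<Rightarrow> real) \<Rightarrow> nat \<Rightarrow> (nat \<Rightarrow> real) \<Rightarrow> real" where
  "orbit_max \<phi> 0 y = 0"
| "orbit_max \<phi> (Suc k) y = max 0 (\<phi> y + orbit_max \<phi> k (shift_seq y))"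

lemma orbit_max_nonneg: "orbit_max \<phi> k y \<ge> 0"
  by (cases k) auto

lemma orbit_max_mono: "orbit_max \<phi> k y \<le> orbit_max \<phi> (Suc k) y"
proof (induction k arbitrary: y)
  case (Suc k)
  from Suc[of "shift_seq y"] show ?case by (auto simp: max_def)
qed auto

lemma orbit_max_incseq: "incseq (\<lambda>k. orbit_max \<phi> k y)"
  using orbit_max_mono by (rule incseq_SucI)

lemma partial_sum_le_orbit_max:
  "(\<Sum>i<k. \<phi> (\<lambda>j. y (i + j))) \<le> orbit_max \<phi> k y"
proof (induction k arbitrary: y)
  case (Suc k)
  have "(\<Sum>i<Suc k. \<phi> (\<lambda>j. y (i + j))) = \<phi> y + (\<Sum>i<k. \<phi> (\<lambda>j. shift_seq y (i + j)))"
    by (simp only: sum.lessThan_Suc_shift) (simp add: shift_seq_def)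
  also have "\<dots> \<le> \<phi> y + orbit_max \<phi> k (shift_seq y)"
    using Suc[of "shift_seq y"] by simp
  finally show ?case by (simp add: max_def)
qed auto

text \<open>
  Let \<open>M\<^sub>k\<close> be \<open>orbit_max \<phi> k\<close> and \<open>T\<close> the shift. The set \<open>A\<close> on which \<open>M\<^sub>k\<close> tends to infinity is
  invariant, so it has probability \<open>0\<close> or \<open>1\<close>. On \<open>A\<close> the difference \<open>M\<^bsub>k+1\<^esub> - M\<^sub>k \<circ> T\<close> is
  eventually equal to \<open>\<phi>\<close>. Its integral over the whole space is the integral of
  \<open>M\<^bsub>k+1\<^esub> - M\<^sub>k \<ge> 0\<close>, because \<open>T\<close> preserves the measure. If \<open>A\<close> had probability \<open>1\<close>, dominated
  convergence would give a nonnegative integral of \<open>\<phi>\<close>.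
\<close>

lemma AE_partial_sums_bounded_above:
  fixes P :: "(nat \<Rightarrow> real) measure" and \<phi> :: "(nat \<Rightarrow> real) \<Rightarrow> real"
  assumes P: "prob_space P" and sets: "sets P = sets (\<Pi>\<^sub>M i\<in>UNIV. borel)"
    and inv: "distr P (\<Pi>\<^sub>M i\<in>UNIV. borel) shift_seq = P"
    and erg: "\<And>A. A \<in> sets P \<Longrightarrow> (\<And>y. y \<in> A \<longleftrightarrow> shift_seq y \<in> A) \<Longrightarrow> measure P A \<in> {0, 1}"
    and int: "integrable P \<phi>" and neg: "(\<integral>y. \<phi> y \<partial>P) < 0"
  shows "AE y in P. \<exists>B. \<forall>k. (\<Sum>i<k. \<phi> (\<lambda>j. y (i + j))) \<le> B"
proof -
  interpret prob_space P by fact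
  have sp: "space P = UNIV"
    using sets_eq_imp_space_eq[OF sets] by (simp add: space_PiM)
  have sh: "shift_seq \<in> measurable P P"
    using measurable_shift_seq measurable_cong_sets[OF sets sets] by blast
  have inv': "distr P P shift_seq = P"
    using inv by (simp add: distr_cong[OF refl sets])
  note [measurable] = sh
  have [measurable]: "\<phi> \<in> borel_measurable P" using int by auto
  have intT: "integrable P (\<lambda>y. f (shift_seq y))"
    and eqT: "(\<integral>y. f (shift_seq y) \<partial>P) = (\<integral>y. f y \<partial>P)" if f: "integrable P f" for f :: "_ \<Rightarrow> real"
  proof -
    show "integrable P (\<lambda>y. f (shift_seq y))"
      using f integrable_distr[OF sh, of f] inv' by simp
    show "(\<integral>y. f (shift_seq y) \<partial>P) = (\<integral>y. f y \<partial>P)"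
      using integral_distr[OF sh, of f] f inv' by simp
  qed
  let ?m = "orbit_max \<phi>"
  have im: "integrable P (?m k)" for k
  proof (induction k)
    case (Suc k)
    have "?m (Suc k) = (\<lambda>y. max 0 (\<phi> y + ?m k (shift_seq y)))" by (rule ext) simp
    moreover have "integrable P (\<lambda>y. \<phi> y + ?m k (shift_seq y))"
      using int intT[OF Suc] by (rule Bochner_Integration.integrable_add)
    ultimately show ?case by simp
  next
    case 0
    have "?m 0 = (\<lambda>y. 0)" by (rule ext) simp
    then show ?case by simp
  qed
  have [measurable]: "?m k \<in> borel_measurable P" for k using im by auto
  define A where "A = {y. \<forall>b::nat. \<exists>k. ?m k y > real b}"
  have "A = {y \<in> space P. \<forall>b::nat. \<exists>k. ?m k y > real b}" by (simp add: A_def sp)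
  also have "\<dots> \<in> sets P" by measurable
  finally have A [measurable]: "A \<in> sets P" .
  have Ainv: "y \<in> A \<longleftrightarrow> shift_seq y \<in> A" for y
  proof
    assume yA: "y \<in> A"
    show "shift_seq y \<in> A" unfolding A_def
    proof (intro CollectI allI)
      fix b :: nat
      obtain b' :: nat where b': "real b' \<ge> real b + \<bar>\<phi> y\<bar>" using real_arch_simple by blast
      obtain k where k: "?m k y > real b'" using yA by (auto simp: A_def)
      then obtain k' where "k = Suc k'" by (cases k) auto
      with k b' have "?m k' (shift_seq y) > real b" by (auto simp: max_def split: if_splits)
      then show "\<exists>k. ?m k (shift_seq y) > real b" by blast
    qed
  next
    assume yA: "shift_seq y \<in> A"
    show "y \<in> A" unfolding A_def
    proof (intro CollectI allI)
      fix b :: nat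
      obtain b' :: nat where b': "real b' \<ge> real b + \<bar>\<phi> y\<bar>" using real_arch_simple by blast
      obtain k where k: "?m k (shift_seq y) > real b'" using yA by (auto simp: A_def)
      with b' have "?m (Suc k) y > real b" by (auto simp: max_def)
      then show "\<exists>k. ?m k y > real b" by blast
    qed
  qed
  have "measure P A \<noteq> 1"
  proof
    assume "measure P A = 1"
    then have AEA: "AE y in P. y \<in> A" using AE_in_set_eq_1[OF A] by simp
    let ?d = "\<lambda>k y. ?m (Suc k) y - ?m k (shift_seq y)"
    have lim: "(\<lambda>k. \<integral>y. ?d k y \<partial>P) \<longlonglongrightarrow> (\<integral>y. \<phi> y \<partial>P)"
    proof (rule integral_dominated_convergence[where w="\<lambda>y. \<bar>\<phi> y\<bar>"])
      show "AE y in P. (\<lambda>k. ?d k y) \<longlonglongrightarrow> \<phi> y"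
        using AEA
      proof eventually_elim
        case (elim y)
        obtain b :: nat where b: "real b \<ge> \<bar>\<phi> y\<bar>" using real_arch_simple by blast
        from elim have "shift_seq y \<in> A" using Ainv by blast
        then obtain k0 where k0: "?m k0 (shift_seq y) > real b" by (auto simp: A_def)
        have "?d k y = \<phi> y" if "k \<ge> k0" for k
        proof -
          have "?m k (shift_seq y) > real b"
            using k0 incseqD[OF orbit_max_incseq that, of \<phi> "shift_seq y"] by linarith
          then show ?thesis using b by (auto simp: max_def)
        qed
        then have "eventually (\<lambda>k. ?d k y = \<phi> y) sequentially"
          unfolding eventually_sequentially by blast
        then show ?case by (rule tendsto_eventually)
      qed
      show "AE y in P. norm (?d k y) \<le> \<bar>\<phi> y\<bar>" for k
        using orbit_max_nonneg[of \<phi> k] by (intro AE_I2) (auto simp: max_def)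
    qed (use int in auto)
    have nn: "(\<integral>y. ?d k y \<partial>P) \<ge> 0" for k
    proof -
      have "(\<integral>y. ?d k y \<partial>P) = (\<integral>y. ?m (Suc k) y \<partial>P) - (\<integral>y. ?m k y \<partial>P)"
        using im intT[OF im] eqT[OF im]
        by (subst Bochner_Integration.integral_diff) auto
      moreover have "(\<integral>y. ?m k y \<partial>P) \<le> (\<integral>y. ?m (Suc k) y \<partial>P)"
        by (intro integral_mono im orbit_max_mono)
      ultimately show ?thesis by linarith
    qed
    have "(\<integral>y. \<phi> y \<partial>P) \<ge> 0" using nn by (intro LIMSEQ_le_const[OF lim]) blast
    with neg show False by simp
  qed
  then have "measure P A = 0" using erg[OF A Ainv] by auto
  then have "AE y in P. y \<notin> A"
    using A by (simp add: AE_iff_measurable[OF A] emeasure_eq_measure sp)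
  then show ?thesis
  proof eventually_elim
    case (elim y)
    then obtain b :: nat where b: "?m k y \<le> real b" for k by (auto simp: A_def not_less)
    show ?case
      using order_trans[OF partial_sum_le_orbit_max b] by blast
  qed
qed

text \<open>
  Used twice: with \<open>\<phi>\<close> a function of one sample minus more than its mean, for upper bounds on sums
  over samples, and with \<open>\<phi>\<close> a constant minus an indicator, for lower bounds on frequencies.
\<close>

lemma stationary_ergodic_partial_sums_bounded_above:
  fixes Y :: "nat \<Rightarrow> 'a \<Rightarrow> real" and \<phi> :: "(nat \<Rightarrow> real) \<Rightarrow> real"
  assumes M: "prob_space M" and Y: "\<And>i. Y i \<in> borel_measurable M"
    and st: "stationary M Y" and er: "ergodic M Y"
    and \<phi>: "\<phi> \<in> borel_measurable (\<Pi>\<^sub>M i\<in>UNIV. borel)"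
    and int: "integrable M (\<lambda>\<omega>. \<phi> (\<lambda>i. Y i \<omega>))" and neg: "(\<integral>\<omega>. \<phi> (\<lambda>i. Y i \<omega>) \<partial>M) < 0"
  shows "AE \<omega> in M. \<exists>B. \<forall>k. (\<Sum>i<k. \<phi> (\<lambda>j. Y (i + j) \<omega>)) \<le> B"
proof -
  interpret prob_space M by fact
  let ?S = "(\<Pi>\<^sub>M i\<in>UNIV. borel) :: (nat \<Rightarrow> real) measure"
  let ?Y = "\<lambda>\<omega> i. Y i \<omega>"
  have Ym [measurable]: "?Y \<in> measurable M ?S"
    by (rule measurable_PiM_single') (use Y in \<open>auto simp: space_PiM\<close>)
  let ?P = "distr M ?S ?Y"
  have "AE y in ?P. \<exists>B. \<forall>k. (\<Sum>i<k. \<phi> (\<lambda>j. y (i + j))) \<le> B"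
  proof (rule AE_partial_sums_bounded_above[where \<phi>=\<phi>])
    show "prob_space ?P" by (rule prob_space_distr) simp
    have "distr ?P ?S shift_seq = distr M ?S (\<lambda>\<omega> i. Y (i + 1) \<omega>)"
      by (subst distr_distr) (auto simp: shift_seq_def o_def)
    then show "distr ?P ?S shift_seq = ?P"
      using st[unfolded stationary_def, rule_format, of 1] by simp
    show "measure ?P A \<in> {0, 1}" if A: "A \<in> sets ?P" and i: "\<And>y. y \<in> A \<longleftrightarrow> shift_seq y \<in> A" for A
    proof -
      have "AE \<omega> in M. ?Y \<omega> \<in> A \<longleftrightarrow> (\<lambda>i. Y (Suc i) \<omega>) \<in> A"
        using i[of "\<lambda>j. Y j _"] by (intro AE_I2) (simp add: shift_seq_def)
      then have "measure M {\<omega> \<in> space M. ?Y \<omega> \<in> A} \<in> {0, 1}"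
        using er A unfolding ergodic_def by simp
      moreover have "measure ?P A = measure M {\<omega> \<in> space M. ?Y \<omega> \<in> A}"
        using A by (subst measure_distr) (auto intro!: arg_cong[where f="measure M"])
      ultimately show ?thesis by simp
    qed
    show "integrable ?P \<phi>" using int \<phi> by (simp add: integrable_distr_eq)
    show "(\<integral>y. \<phi> y \<partial>?P) < 0" using neg \<phi> by (simp add: integral_distr)
  qed simp
  from AE_distrD[OF Ym this] show ?thesis by simp
qed

section \<open>Zeroth homology with coefficients in the two-element field\<close>

text \<open>
  These default rules replace addition and multiplication of bits by bitwise operations, and
  inequalities by equations; the arguments below use the ring laws instead.
\<close>

declare add_bit_eq_xor [simp del] mult_bit_eq_and [simp del]
  bit_not_zero_iff [simp del] bit_not_one_iff [simp del]

lemma bit_add_self [simp]: "(a :: bit) + a = 0"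
  by (cases a) (auto simp: add_bit_eq_xor)

lemma bit_add_eq_0_iff: "(a :: bit) + b = 0 \<longleftrightarrow> a = b"
  by (cases a; cases b) (auto simp: add_bit_eq_xor)

definition chain_add :: "('v set \<Rightarrow> bit) \<Rightarrow> ('v set \<Rightarrow> bit) \<Rightarrow> 'v set \<Rightarrow> bit" (infixl "\<boxplus>" 65) where
  "c \<boxplus> c' = (\<lambda>\<sigma>. c \<sigma> + c' \<sigma>)"

text \<open>
  The index set may be any finite set that contains the support. With a common index set,
  boundaries of different chains add up term by term.
\<close>

lemma boundary_eq_sum:
  assumes c: "c \<in> chains (Suc 0) K" and F: "finite F" "{\<sigma>. c \<sigma> \<noteq> 0} \<subseteq> F"
  shows "boundary c \<tau> = (if card \<tau> = 1 then (\<Sum>\<sigma> | \<sigma> \<in> F \<and> \<tau> \<subseteq> \<sigma>. c \<sigma>) else 0)"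
proof -
  have card2: "card \<sigma> = 2" if "c \<sigma> \<noteq> 0" for \<sigma>
    using c that by (auto simp: chains_def)
  show ?thesis
  proof (cases "card \<tau> = 1")
    case True
    then have "\<tau> \<noteq> {}" by auto
    moreover have "(\<Sum>\<sigma> | c \<sigma> \<noteq> 0 \<and> \<tau> \<subseteq> \<sigma> \<and> card \<sigma> = Suc (card \<tau>). c \<sigma>) = (\<Sum>\<sigma> | \<sigma> \<in> F \<and> \<tau> \<subseteq> \<sigma>. c \<sigma>)"
      using F card2 True by (intro sum.mono_neutral_left) auto
    ultimately show ?thesis using True by (simp add: boundary_def)
  next
    case False
    have "{\<sigma>. c \<sigma> \<noteq> 0 \<and> \<tau> \<subseteq> \<sigma> \<and> card \<sigma> = Suc (card \<tau>)} = {}"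
      using card2 False by force
    then have "(\<Sum>\<sigma> | c \<sigma> \<noteq> 0 \<and> \<tau> \<subseteq> \<sigma> \<and> card \<sigma> = Suc (card \<tau>). c \<sigma>) = 0" by (simp only: sum.empty)
    then show ?thesis using False by (simp add: boundary_def)
  qed
qed

lemma boundary_chain0:
  assumes c: "c \<in> chains 0 K"
  shows "boundary c = (\<lambda>_. 0)"
proof
  fix \<tau>
  have card1: "card \<sigma> = 1" if "c \<sigma> \<noteq> 0" for \<sigma>
    using c that by (auto simp: chains_def)
  have "{\<sigma>. c \<sigma> \<noteq> 0 \<and> \<tau> \<subseteq> \<sigma> \<and> card \<sigma> = Suc (card \<tau>)} = {}" if "\<tau> \<noteq> {}"
  proof (rule ccontr)
    assume "\<not> ?thesis"
    then obtain \<sigma> where "c \<sigma> \<noteq> 0" "\<tau> \<subseteq> \<sigma>" "card \<sigma> = Suc (card \<tau>)" by blast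
    with card1[of \<sigma>] that show False
      by (metis One_nat_def card.infinite card_eq_0_iff finite_subset nat.inject old.nat.distinct(1))
  qed
  then have "\<tau> \<noteq> {} \<Longrightarrow> (\<Sum>\<sigma> | c \<sigma> \<noteq> 0 \<and> \<tau> \<subseteq> \<sigma> \<and> card \<sigma> = Suc (card \<tau>). c \<sigma>) = 0"
    by (metis sum.empty)
  then show "boundary c \<tau> = 0" by (simp add: boundary_def)
qed

lemma cycles_0: "cycles 0 K = chains 0 K"
  using boundary_chain0 by (auto simp: cycles_def)

lemma zero_chains [simp]: "(\<lambda>_. 0) \<in> chains p K"
  by (simp add: chains_def)

lemma chain_add_chains:
  assumes "c \<in> chains p K" "c' \<in> chains p K"
  shows "c \<boxplus> c' \<in> chains p K"
proof -
  have "{\<sigma>. (c \<boxplus> c') \<sigma> \<noteq> 0} \<subseteq> {\<sigma>. c \<sigma> \<noteq> 0} \<union> {\<sigma>. c' \<sigma> \<noteq> 0}"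
    by (auto simp: chain_add_def)
  with assms show ?thesis
    unfolding chains_def by (auto intro: finite_subset)
qed

lemma boundary_chain_add:
  assumes c: "c \<in> chains (Suc 0) K" and c': "c' \<in> chains (Suc 0) K"
  shows "boundary (c \<boxplus> c') = boundary c \<boxplus> boundary c'"
proof
  fix \<tau>
  let ?F = "{\<sigma>. c \<sigma> \<noteq> 0} \<union> {\<sigma>. c' \<sigma> \<noteq> 0}"
  have F: "finite ?F" using c c' by (simp add: chains_def)
  show "boundary (c \<boxplus> c') \<tau> = (boundary c \<boxplus> boundary c') \<tau>"
    unfolding chain_add_def[of "boundary c"]
    by (subst (1 2 3) boundary_eq_sum[OF _ F])
       (use c c' chain_add_chains[OF c c'] in \<open>auto simp: chain_add_def sum.distrib\<close>)
qed

lemma zero_boundaries [simp]: "(\<lambda>_. 0) \<in> boundaries p K"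
proof -
  have "boundary (\<lambda>_. 0) = (\<lambda>_. 0)" by (auto simp: boundary_def)
  then show ?thesis unfolding boundaries_def by (rule image_eqI[OF sym zero_chains])
qed

lemma chain_add_boundaries:
  assumes "b \<in> boundaries 0 K" "b' \<in> boundaries 0 K"
  shows "b \<boxplus> b' \<in> boundaries 0 K"
proof -
  obtain c c' where c: "c \<in> chains (Suc 0) K" "b = boundary c" "c' \<in> chains (Suc 0) K" "b' = boundary c'"
    using assms unfolding boundaries_def by blast
  then have "b \<boxplus> b' = boundary (c \<boxplus> c')" by (simp add: boundary_chain_add)
  with c show ?thesis unfolding boundaries_def
    by (intro image_eqI[of _ _ "c \<boxplus> c'"] chain_add_chains)
qed

lemma chain_add_self [simp]: "c \<boxplus> c = (\<lambda>_. 0)"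
  by (simp add: chain_add_def)

lemma chain_add_zero [simp]: "c \<boxplus> (\<lambda>_. 0) = c" "(\<lambda>_. 0) \<boxplus> c = c"
  by (simp_all add: chain_add_def)

lemma chain_add_assoc: "(a \<boxplus> b) \<boxplus> c = a \<boxplus> (b \<boxplus> c)"
  by (simp add: chain_add_def add.assoc)

lemma chain_add_commute: "a \<boxplus> b = b \<boxplus> a"
  by (simp add: chain_add_def add.commute)

lemma chain_add_left_commute: "a \<boxplus> (b \<boxplus> c) = b \<boxplus> (a \<boxplus> c)"
  by (simp add: chain_add_def add.left_commute)

lemmas chain_add_ac = chain_add_assoc chain_add_commute chain_add_left_commute

lemma chain_add_cancel [simp]: "a \<boxplus> (a \<boxplus> b) = b"
  by (simp flip: chain_add_assoc)

lemma boundaries_mono: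
  assumes "K \<subseteq> K'"
  shows "boundaries p K \<subseteq> boundaries p K'"
  using assms unfolding boundaries_def chains_def by blast

definition homology_class :: "'v set set \<Rightarrow> ('v set \<Rightarrow> bit) \<Rightarrow> ('v set \<Rightarrow> bit) set" where
  "homology_class K z = {b \<boxplus> z | b. b \<in> boundaries 0 K}"

lemma mult_cycle_group: "a \<otimes>\<^bsub>cycle_group p K\<^esub> b = a \<boxplus> b"
  by (simp add: cycle_group_def chain_add_def)

lemma carrier_homology_0: "carrier (homology 0 K) = homology_class K ` chains 0 K"
proof -
  have "boundaries 0 K #>\<^bsub>cycle_group 0 K\<^esub> z = homology_class K z" for z
    unfolding r_coset_def homology_class_def mult_cycle_group by blast
  moreover have "carrier (cycle_group 0 K) = chains 0 K"
    by (simp add: cycle_group_def cycles_0)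
  ultimately show ?thesis
    by (simp add: homology_def FactGroup_def RCOSETS_def UNION_singleton_eq_range)
qed

lemma mem_homology_class: "y \<in> homology_class K z \<longleftrightarrow> y \<boxplus> z \<in> boundaries 0 K"
proof
  assume "y \<boxplus> z \<in> boundaries 0 K"
  moreover have "y = (y \<boxplus> z) \<boxplus> z" by (simp add: chain_add_assoc)
  ultimately show "y \<in> homology_class K z" unfolding homology_class_def by blast
qed (auto simp: homology_class_def chain_add_assoc)

lemma homology_class_eq_iff:
  "homology_class K y = homology_class K z \<longleftrightarrow> y \<boxplus> z \<in> boundaries 0 K"
proof
  assume "homology_class K y = homology_class K z"
  moreover have "y \<in> homology_class K y" by (simp add: mem_homology_class)
  ultimately show "y \<boxplus> z \<in> boundaries 0 K" by (simp add: mem_homology_class)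
next
  assume yz: "y \<boxplus> z \<in> boundaries 0 K"
  have "w \<boxplus> y \<in> boundaries 0 K \<longleftrightarrow> w \<boxplus> z \<in> boundaries 0 K" for w
  proof
    assume "w \<boxplus> y \<in> boundaries 0 K"
    from chain_add_boundaries[OF yz this] show "w \<boxplus> z \<in> boundaries 0 K"
      by (simp add: chain_add_ac)
  next
    assume "w \<boxplus> z \<in> boundaries 0 K"
    from chain_add_boundaries[OF yz this] show "w \<boxplus> y \<in> boundaries 0 K"
      by (simp add: chain_add_ac)
  qed
  then show "homology_class K y = homology_class K z"
    unfolding set_eq_iff mem_homology_class by blast
qed

text \<open>
  The case \<open>K = K'\<close> is addition in homology; the case \<open>z = 0\<close> is the map induced by an inclusion.
\<close>

lemma set_mult_homology_class:
  assumes "boundaries 0 K \<subseteq> boundaries 0 K'"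
  shows "homology_class K y <#>\<^bsub>cycle_group 0 K''\<^esub> homology_class K' z = homology_class K' (y \<boxplus> z)"
proof (intro equalityI subsetI)
  fix w assume "w \<in> homology_class K y <#>\<^bsub>cycle_group 0 K''\<^esub> homology_class K' z"
  then obtain u v where uv: "u \<in> homology_class K y" "v \<in> homology_class K' z" "w = u \<boxplus> v"
    unfolding set_mult_def mult_cycle_group by blast
  have "(u \<boxplus> y) \<boxplus> (v \<boxplus> z) \<in> boundaries 0 K'"
    using uv(1,2) assms unfolding mem_homology_class by (intro chain_add_boundaries[of "u \<boxplus> y" _ "v \<boxplus> z"]) auto
  then show "w \<in> homology_class K' (y \<boxplus> z)"
    unfolding mem_homology_class uv(3) by (simp only: chain_add_ac)
next
  fix w assume "w \<in> homology_class K' (y \<boxplus> z)"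
  then have "y \<boxplus> w \<in> homology_class K' z"
    unfolding mem_homology_class by (simp only: chain_add_ac)
  moreover have "y \<in> homology_class K y" by (simp add: mem_homology_class)
  moreover have "w = y \<otimes>\<^bsub>cycle_group 0 K''\<^esub> (y \<boxplus> w)"
    by (simp add: mult_cycle_group)
  ultimately show "w \<in> homology_class K y <#>\<^bsub>cycle_group 0 K''\<^esub> homology_class K' z"
    unfolding set_mult_def by blast
qed

lemma mult_homology_0:
  "homology_class K y \<otimes>\<^bsub>homology 0 K\<^esub> homology_class K z = homology_class K (y \<boxplus> z)"
  by (simp add: homology_def FactGroup_def set_mult_homology_class)

lemma homology_inclusion_class:
  assumes "K \<subseteq> K'"
  shows "homology_inclusion 0 K' (homology_class K z) = homology_class K' z"
proof -
  have "homology_class K' (\<lambda>_. 0) = boundaries 0 K'"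
    by (auto simp: homology_class_def)
  then show ?thesis
    using set_mult_homology_class[OF boundaries_mono[OF assms], where y = z and z = "\<lambda>_. 0"]
    by (simp add: homology_inclusion_def)
qed

definition point_chain :: "'v \<Rightarrow> 'v set \<Rightarrow> bit" where
  "point_chain v = (\<lambda>\<sigma>. if \<sigma> = {v} then 1 else 0)"

lemma edge_boundary:
  assumes "{v, w} \<in> K" "v \<noteq> w"
  shows "point_chain v \<boxplus> point_chain w \<in> boundaries 0 K"
proof -
  let ?c = "\<lambda>\<sigma>. if \<sigma> = {v, w} then 1 else 0 :: bit"
  have supp: "{\<sigma>. ?c \<sigma> \<noteq> 0} = {{v, w}}" by auto
  have c: "?c \<in> chains (Suc 0) K"
    unfolding chains_def mem_Collect_eq supp using assms by simp
  have "boundary ?c = point_chain v \<boxplus> point_chain w"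
  proof
    fix \<tau>
    have "{\<sigma> \<in> {{v, w}}. \<tau> \<subseteq> \<sigma>} = (if \<tau> \<subseteq> {v, w} then {{v, w}} else {})" by auto
    then have "boundary ?c \<tau> = (if card \<tau> = 1 \<and> \<tau> \<subseteq> {v, w} then 1 else 0)"
      using boundary_eq_sum[OF c, of "{{v, w}}" \<tau>] by auto
    also have "card \<tau> = 1 \<and> \<tau> \<subseteq> {v, w} \<longleftrightarrow> \<tau> = {v} \<or> \<tau> = {w}"
      by (auto simp: card_1_singleton_iff)
    finally show "boundary ?c \<tau> = (point_chain v \<boxplus> point_chain w) \<tau>"
      using assms(2) by (auto simp: point_chain_def chain_add_def)
  qed
  then show ?thesis unfolding boundaries_def by (rule image_eqI[OF sym c])
qed

text \<open>
  Each edge has none or both of its ends in \<open>S\<close>, and \<open>1 + 1 = 0\<close>.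
\<close>

lemma sum_boundary_over_component:
  assumes b: "b \<in> boundaries 0 K" and S: "finite S"
    and closed: "\<And>\<sigma>. \<sigma> \<in> K \<Longrightarrow> card \<sigma> = 2 \<Longrightarrow> \<sigma> \<inter> S = {} \<or> \<sigma> \<subseteq> S"
  shows "(\<Sum>v\<in>S. b {v}) = 0"
proof -
  obtain c where c: "c \<in> chains (Suc 0) K" "b = boundary c"
    using b by (auto simp: boundaries_def)
  let ?F = "{\<sigma>. c \<sigma> \<noteq> 0}"
  have F: "finite ?F" using c by (simp add: chains_def)
  have "(\<Sum>v\<in>S. b {v}) = (\<Sum>v\<in>S. \<Sum>\<sigma>\<in>?F. if v \<in> \<sigma> then c \<sigma> else 0)"
    unfolding c(2) boundary_eq_sum[OF c(1) F order_refl]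
    by (intro sum.cong refl) (use sum.inter_filter[OF F, of c] in simp)
  also have "\<dots> = (\<Sum>\<sigma>\<in>?F. \<Sum>v\<in>S. if v \<in> \<sigma> then c \<sigma> else 0)"
    by (rule sum.swap)
  also have "\<dots> = (\<Sum>\<sigma>\<in>?F. 0)"
  proof (rule sum.cong[OF refl])
    fix \<sigma> assume "\<sigma> \<in> ?F"
    then have \<sigma>: "\<sigma> \<in> K" "card \<sigma> = 2" using c(1) by (auto simp: chains_def)
    have "(\<Sum>v\<in>S. if v \<in> \<sigma> then c \<sigma> else 0) = of_nat (card (S \<inter> \<sigma>)) * c \<sigma>"
      using S by (simp add: sum.If_cases)
    also have "\<dots> = 0"
      using closed[OF \<sigma>] \<sigma>(2) by (auto simp: Int_commute Int_absorb1 Int_absorb2)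
    finally show "(\<Sum>v\<in>S. if v \<in> \<sigma> then c \<sigma> else 0) = 0" .
  qed
  finally show ?thesis by simp
qed

section \<open>Uniqueness of the persistence diagram\<close>

definition bars_across :: "(ereal \<times> ereal) multiset \<Rightarrow> real \<Rightarrow> real \<Rightarrow> nat" where
  "bars_across D s t = size {#p \<in># D. fst p \<le> ereal s \<and> ereal t < snd p#}"

lemma ereal_finite_gap:
  assumes "finite A" "\<And>a. a \<in> A \<Longrightarrow> a < b" "b \<noteq> - \<infinity>"
  shows "\<exists>s. (\<forall>a\<in>A. a \<le> ereal s) \<and> ereal s < b"
proof -
  have "Max (insert (- \<infinity>) A) < b"
    using assms by (subst Max_less_iff) (auto simp: less_le)
  then obtain s where s: "Max (insert (- \<infinity>) A) < ereal s" "ereal s < b"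
    using ereal_dense2 by blast
  have "a \<le> ereal s" if "a \<in> A" for a
  proof -
    have "a \<le> Max (insert (- \<infinity>) A)" using assms(1) that by simp
    with s(1) show ?thesis by simp
  qed
  with s(2) show ?thesis by blast
qed

lemma size_filter_split:
  "size (filter_mset P D) = size {#p \<in># D. P p \<and> Q p#} + size {#p \<in># D. P p \<and> \<not> Q p#}"
  by (induction D) auto

text \<open>
  The multiplicity of \<open>(\<beta>, d)\<close> is a combination of these numbers. If \<open>t < d\<close> is so large that no death
  lies strictly between \<open>t\<close> and \<open>d\<close>, the bars that cover \<open>[u, t]\<close> but do not reach beyond \<open>d\<close> are those
  with death \<open>d\<close> and birth at most \<open>u\<close>. Comparing \<open>u = \<beta>\<close> with a value \<open>s < \<beta>\<close> above all earlier births
  isolates the birth.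
\<close>

lemma bars_across_inject:
  assumes D: "set_mset D \<subseteq> Delta" "set_mset D' \<subseteq> Delta"
    and eq: "\<And>s t. s \<le> t \<Longrightarrow> bars_across D s t = bars_across D' s t"
  shows "D = D'"
proof (rule multiset_eqI)
  fix p
  let ?S = "set_mset D \<union> set_mset D'"
  show "count D p = count D' p"
  proof (cases "p \<in> Delta")
    case False
    then have "p \<notin># D" "p \<notin># D'" using D by auto
    then show ?thesis by (simp add: not_in_iff)
  next
    case True
    then obtain \<beta> d where p: "p = (ereal \<beta>, d)" and \<beta>d: "ereal \<beta> < d"
      by (cases p; cases "fst p") (auto simp: Delta_def)
    have "\<exists>t. (\<forall>a\<in>insert (ereal \<beta>) (snd ` {q \<in> ?S. snd q < d}). a \<le> ereal t) \<and> ereal t < d"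
      using \<beta>d by (intro ereal_finite_gap) auto
    then obtain t where t0: "\<forall>a\<in>insert (ereal \<beta>) (snd ` {q \<in> ?S. snd q < d}). a \<le> ereal t" "ereal t < d"
      by blast
    have t: "snd q \<le> ereal t" if "q \<in> ?S" "snd q < d" for q
      using bspec[OF t0(1), of "snd q"] that by blast
    have \<beta>t: "\<beta> \<le> t" using t0(1) by simp
    have "\<exists>s. (\<forall>a\<in>fst ` {q \<in> ?S. fst q < ereal \<beta>}. a \<le> ereal s) \<and> ereal s < ereal \<beta>"
      by (intro ereal_finite_gap) auto
    then obtain s where s0: "\<forall>a\<in>fst ` {q \<in> ?S. fst q < ereal \<beta>}. a \<le> ereal s" "ereal s < ereal \<beta>"
      by blast
    have s: "fst q \<le> ereal s" if "q \<in> ?S" "fst q < ereal \<beta>" for q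
      using bspec[OF s0(1), of "fst q"] that by blast
    define m where "m E u = size {#q \<in># E. fst q \<le> ereal u \<and> snd q = d#}" for E :: "(ereal \<times> ereal) multiset" and u
    have m: "m E u = bars_across E u t - (if d = \<infinity> then 0 else bars_across E u (real_of_ereal d))"
      if E: "set_mset E \<subseteq> ?S" for E u
    proof -
      have "bars_across E u t = size {#q \<in># E. (fst q \<le> ereal u \<and> ereal t < snd q) \<and> snd q = d#}
          + size {#q \<in># E. (fst q \<le> ereal u \<and> ereal t < snd q) \<and> snd q \<noteq> d#}"
        unfolding bars_across_def by (rule size_filter_split)
      also have "{#q \<in># E. (fst q \<le> ereal u \<and> ereal t < snd q) \<and> snd q = d#}
          = {#q \<in># E. fst q \<le> ereal u \<and> snd q = d#}"
        using t0(2) by (intro filter_mset_cong) auto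
      also have "{#q \<in># E. (fst q \<le> ereal u \<and> ereal t < snd q) \<and> snd q \<noteq> d#}
          = {#q \<in># E. fst q \<le> ereal u \<and> d < snd q#}"
      proof (intro filter_mset_cong refl)
        fix q assume "q \<in># E"
        then have "snd q < d \<Longrightarrow> snd q \<le> ereal t" using E t[of q] by blast
        then show "(fst q \<le> ereal u \<and> ereal t < snd q) \<and> snd q \<noteq> d \<longleftrightarrow> fst q \<le> ereal u \<and> d < snd q"
          using t0(2) by (cases rule: linorder_cases[of "snd q" d]) (auto intro: less_trans)
      qed
      also have "size \<dots> = (if d = \<infinity> then 0 else bars_across E u (real_of_ereal d))"
        using \<beta>d by (cases d) (auto simp: bars_across_def)
      finally show ?thesis by (simp add: m_def)
    qed
    have cnt: "count E p = m E \<beta> - m E s" if E: "set_mset E \<subseteq> ?S" for E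
    proof -
      have "m E \<beta> = size {#q \<in># E. (fst q \<le> ereal \<beta> \<and> snd q = d) \<and> fst q = ereal \<beta>#}
          + size {#q \<in># E. (fst q \<le> ereal \<beta> \<and> snd q = d) \<and> fst q \<noteq> ereal \<beta>#}"
        unfolding m_def by (rule size_filter_split)
      also have "{#q \<in># E. (fst q \<le> ereal \<beta> \<and> snd q = d) \<and> fst q = ereal \<beta>#} = {#q \<in># E. q = p#}"
        by (intro filter_mset_cong) (auto simp: p prod_eq_iff)
      also have "{#q \<in># E. (fst q \<le> ereal \<beta> \<and> snd q = d) \<and> fst q \<noteq> ereal \<beta>#}
          = {#q \<in># E. fst q \<le> ereal s \<and> snd q = d#}"
      proof (intro filter_mset_cong refl)
        fix q assume "q \<in># E"
        then have "fst q < ereal \<beta> \<Longrightarrow> fst q \<le> ereal s" using E s[of q] by blast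
        then show "(fst q \<le> ereal \<beta> \<and> snd q = d) \<and> fst q \<noteq> ereal \<beta> \<longleftrightarrow> fst q \<le> ereal s \<and> snd q = d"
          using s0(2) by (auto simp: less_le intro: order_trans[of "fst q" "ereal s"])
      qed
      also have "size {#q \<in># E. q = p#} = count E p" by (induction E) auto
      finally show ?thesis by (simp add: m_def)
    qed
    have "s \<le> t" using s0(2) \<beta>t by simp
    moreover have "\<beta> \<le> real_of_ereal d" if "d \<noteq> \<infinity>" using that \<beta>d by (cases d) auto
    moreover have "s \<le> real_of_ereal d" if "d \<noteq> \<infinity>" using that \<beta>d s0(2) by (cases d) auto
    ultimately have "m D \<beta> = m D' \<beta>" "m D s = m D' s"
      using \<beta>t m[of D] m[of D'] eq by auto
    then show ?thesis using cnt[of D] cnt[of D'] by simp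
  qed
qed

definition bar_index :: "(ereal \<times> ereal) multiset \<Rightarrow> ((ereal \<times> ereal) \<times> nat) set" where
  "bar_index D = {(p, i :: nat). i < count D p}"

abbreviation bar_module :: "(ereal \<times> ereal) multiset \<Rightarrow> ((ereal \<times> ereal) \<times> nat \<Rightarrow> bit) persistence_module" where
  "bar_module D \<equiv> pm_direct_sum (bar_index D) (\<lambda>(p, i). pm_interval p)"

lemma bar_index_eq_Sigma: "bar_index D = Sigma (set_mset D) (\<lambda>p. {..<count D p})"
  by (auto intro: ccontr simp: bar_index_def not_in_iff)

lemma finite_bar_index [simp]: "finite (bar_index D)"
  unfolding bar_index_eq_Sigma by simp

lemma card_bar_index_filter: "card {k \<in> bar_index D. P (fst k)} = size (filter_mset P D)"
proof -
  have "{k \<in> bar_index D. P (fst k)} = Sigma (set_mset (filter_mset P D)) (\<lambda>p. {..<count (filter_mset P D) p})"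
    by (auto intro: ccontr simp: bar_index_def not_in_iff)
  then show ?thesis by (simp add: size_multiset_overloaded_eq)
qed

lemma carrier_pm_interval:
  "carrier (pm_space (pm_interval p) t) = (if fst p \<le> ereal t \<and> ereal t < snd p then UNIV else {0})"
  by (simp add: pm_interval_def split: prod.split)

lemma one_pm_interval: "\<one>\<^bsub>pm_space (pm_interval p) t\<^esub> = 0"
  by (simp add: pm_interval_def split: prod.split)

lemma mult_pm_interval: "a \<otimes>\<^bsub>pm_space (pm_interval p) t\<^esub> b = a + b"
  by (simp add: pm_interval_def split: prod.split)

lemma group_pm_interval: "group (pm_space (pm_interval p) t)"
proof (rule groupI)
  fix a assume "a \<in> carrier (pm_space (pm_interval p) t)"
  then show "\<exists>b\<in>carrier (pm_space (pm_interval p) t). b \<otimes>\<^bsub>pm_space (pm_interval p) t\<^esub> a = \<one>\<^bsub>pm_space (pm_interval p) t\<^esub>"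
    by (intro bexI[of _ a]) (simp_all add: mult_pm_interval one_pm_interval)
qed (auto simp: carrier_pm_interval mult_pm_interval one_pm_interval add.assoc)

lemma map_pm_interval:
  "pm_map (pm_interval p) s t a = (if fst p \<le> ereal s \<and> ereal t < snd p then a else 0)"
  by (simp add: pm_interval_def split: prod.split)

lemma carrier_bar_module:
  "carrier (pm_space (bar_module D) t) =
    (\<Pi>\<^sub>E k\<in>bar_index D. if fst (fst k) \<le> ereal t \<and> ereal t < snd (fst k) then UNIV else {0})"
proof -
  have "finite {k \<in> bar_index D. P k}" for P by (rule finite_subset[OF _ finite_bar_index]) auto
  then show ?thesis
    by (simp add: pm_direct_sum_def case_prod_beta carrier_sum_group group_pm_interval carrier_pm_interval)
qed

lemma mult_bar_module:
  "a \<otimes>\<^bsub>pm_space (bar_module D) t\<^esub> b = (\<lambda>k\<in>bar_index D. a k + b k)"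
  by (simp add: pm_direct_sum_def case_prod_beta mult_pm_interval)

lemma map_bar_module:
  "pm_map (bar_module D) s t a =
    (\<lambda>k\<in>bar_index D. if fst (fst k) \<le> ereal s \<and> ereal t < snd (fst k) then a k else 0)"
  by (simp add: pm_direct_sum_def case_prod_beta map_pm_interval)

lemma map_bar_module_closed:
  assumes "s \<le> t" "a \<in> carrier (pm_space (bar_module D) s)"
  shows "pm_map (bar_module D) s t a \<in> carrier (pm_space (bar_module D) t)"
proof -
  have "b \<le> ereal s \<Longrightarrow> b \<le> ereal t" for b using assms(1) by (meson ereal_less_eq(3) order_trans)
  then show ?thesis unfolding map_bar_module carrier_bar_module restrict_PiE_iff by auto
qed

text \<open>
  The image consists of the families supported on the bars that cover \<open>[s, t]\<close>. Counting elements
  avoids a notion of dimension, since the coefficient field is finite.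
\<close>

lemma card_image_map_bar_module:
  assumes "s \<le> t"
  shows "card (pm_map (bar_module D) s t ` carrier (pm_space (bar_module D) s)) = 2 ^ bars_across D s t"
proof -
  let ?P = "\<lambda>p. fst p \<le> ereal s \<and> ereal t < snd p"
  let ?C = "\<Pi>\<^sub>E k\<in>bar_index D. if ?P (fst k) then UNIV else {0 :: bit}"
  have "pm_map (bar_module D) s t ` carrier (pm_space (bar_module D) s) = ?C"
  proof (intro equalityI subsetI)
    fix f assume "f \<in> pm_map (bar_module D) s t ` carrier (pm_space (bar_module D) s)"
    then obtain a where "f = pm_map (bar_module D) s t a" by blast
    then show "f \<in> ?C" unfolding map_bar_module by (simp add: restrict_PiE_iff)
  next
    fix f assume f: "f \<in> ?C"
    have f0: "f k = 0" if "k \<in> bar_index D" "\<not> ?P (fst k)" for k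
      using PiE_mem[OF f that(1)] that(2) by simp
    have "f = pm_map (bar_module D) s t f"
    proof
      fix k show "f k = pm_map (bar_module D) s t f k"
        using f0[of k] PiE_arb[OF f, of k] unfolding map_bar_module restrict_def by (auto simp del: mem_Collect_eq)
    qed
    moreover have "ereal s < snd p" if "?P p" for p
      using that assms by (auto intro: le_less_trans[of _ "ereal t"])
    then have "f \<in> carrier (pm_space (bar_module D) s)"
      unfolding carrier_bar_module using f by (auto simp: PiE_iff split: if_splits)
    ultimately show "f \<in> pm_map (bar_module D) s t ` carrier (pm_space (bar_module D) s)"
      by (rule image_eqI)
  qed
  then have "card (pm_map (bar_module D) s t ` carrier (pm_space (bar_module D) s))
      = (\<Prod>k\<in>bar_index D. card (if ?P (fst k) then UNIV else {0 :: bit}))"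
    by (simp add: card_PiE)
  also have "\<dots> = (\<Prod>k\<in>bar_index D. if ?P (fst k) then 2 else 1)"
  proof (rule prod.cong[OF refl])
    have "UNIV = {0, 1 :: bit}" by (auto intro: bit.exhaust)
    then have "card (UNIV :: bit set) = card {0, 1 :: bit}" by (rule arg_cong)
    then have "card (UNIV :: bit set) = 2" by simp
    then show "card (if ?P (fst k) then UNIV else {0 :: bit}) = (if ?P (fst k) then 2 else 1)" for k :: "(ereal \<times> ereal) \<times> nat"
      by simp
  qed
  also have "\<dots> = (\<Prod>k\<in>{k \<in> bar_index D. ?P (fst k)}. 2)"
    by (subst prod.inter_filter) auto
  also have "\<dots> = 2 ^ bars_across D s t"
    using card_bar_index_filter[of D ?P] by (simp add: bars_across_def)
  finally show ?thesis .
qed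

text \<open>
  An isomorphism carries the image of a structure map onto the image of the corresponding structure
  map, so the ranks agree.
\<close>

lemma persistence_diagram_unique:
  assumes D: "is_persistence_diagram V D" and D': "is_persistence_diagram V D'"
    and cl: "\<And>s t a. s \<le> t \<Longrightarrow> a \<in> carrier (pm_space V s) \<Longrightarrow> pm_map V s t a \<in> carrier (pm_space V t)"
  shows "D = D'"
proof (rule bars_across_inject)
  show "set_mset D \<subseteq> Delta" "set_mset D' \<subseteq> Delta"
    using D D' by (auto simp: is_persistence_diagram_def)
  fix s t :: real assume st: "s \<le> t"
  have rank: "card (pm_map V s t ` carrier (pm_space V s)) = 2 ^ bars_across E s t"
    if E: "is_persistence_diagram V E" for E
  proof -
    obtain \<phi> where iso: "\<And>t. \<phi> t \<in> iso (pm_space V t) (pm_space (bar_module E) t)"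
      and comm: "\<And>s t x. s \<le> t \<Longrightarrow> x \<in> carrier (pm_space V s) \<Longrightarrow>
        \<phi> t (pm_map V s t x) = pm_map (bar_module E) s t (\<phi> s x)"
      using E unfolding is_persistence_diagram_def pm_isomorphic_def bar_index_def[symmetric] by blast
    have bij: "bij_betw (\<phi> t) (carrier (pm_space V t)) (carrier (pm_space (bar_module E) t))" for t
      using iso[of t] by (simp add: iso_def)
    have "inj_on (\<phi> t) (pm_map V s t ` carrier (pm_space V s))"
      using bij_betw_imp_inj_on[OF bij[of t]] cl[OF st] by (auto intro: inj_on_subset)
    then have "card (pm_map V s t ` carrier (pm_space V s))
        = card (\<phi> t ` pm_map V s t ` carrier (pm_space V s))"
      by (simp add: card_image)
    also have "\<phi> t ` pm_map V s t ` carrier (pm_space V s)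
        = pm_map (bar_module E) s t ` \<phi> s ` carrier (pm_space V s)"
      unfolding image_image using comm[OF st] by (rule image_cong[OF refl])
    also have "\<phi> s ` carrier (pm_space V s) = carrier (pm_space (bar_module E) s)"
      using bij by (simp add: bij_betw_def)
    finally show ?thesis by (simp add: card_image_map_bar_module[OF st])
  qed
  show "bars_across D s t = bars_across D' s t"
    using rank[OF D] rank[OF D'] by simp
qed

text \<open>
  It is easier to describe the isomorphism from the bars to homology than its inverse, since a bar
  has a natural representing cycle. The second conclusion is what uniqueness of the diagram
  requires of the module.
\<close>

lemma is_persistence_diagram_from_bar_module:
  assumes D: "set_mset D \<subseteq> Delta"
    and bij: "\<And>t. bij_betw (\<psi> t) (carrier (pm_space (bar_module D) t)) (carrier (pm_space V t))"
    and hom: "\<And>t a b. a \<in> carrier (pm_space (bar_module D) t) \<Longrightarrow> b \<in> carrier (pm_space (bar_module D) t) \<Longrightarrow>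
      \<psi> t (\<lambda>k\<in>bar_index D. a k + b k) = \<psi> t a \<otimes>\<^bsub>pm_space V t\<^esub> \<psi> t b"
    and comm: "\<And>s t a. s \<le> t \<Longrightarrow> a \<in> carrier (pm_space (bar_module D) s) \<Longrightarrow>
      \<psi> t (pm_map (bar_module D) s t a) = pm_map V s t (\<psi> s a)"
  shows "is_persistence_diagram V D"
    and "s \<le> t \<Longrightarrow> x \<in> carrier (pm_space V s) \<Longrightarrow> pm_map V s t x \<in> carrier (pm_space V t)"
proof -
  let ?W = "bar_module D"
  let ?\<phi> = "\<lambda>t. inv_into (carrier (pm_space ?W t)) (\<psi> t)"
  have inv: "?\<phi> t (\<psi> t a) = a" if "a \<in> carrier (pm_space ?W t)" for t a
    using bij_betw_imp_inj_on[OF bij] that by (rule inv_into_f_f)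
  have ex: "\<exists>a\<in>carrier (pm_space ?W t). \<psi> t a = x" if "x \<in> carrier (pm_space V t)" for t x
    using that unfolding bij_betw_imp_surj_on[OF bij[of t], symmetric] by blast
  have add: "(\<lambda>k\<in>bar_index D. a k + b k) \<in> carrier (pm_space ?W t)"
    if "a \<in> carrier (pm_space ?W t)" "b \<in> carrier (pm_space ?W t)" for a b t
    unfolding carrier_bar_module restrict_PiE_iff
  proof
    fix k assume "k \<in> bar_index D"
    then show "a k + b k \<in> (if fst (fst k) \<le> ereal t \<and> ereal t < snd (fst k) then UNIV else {0})"
      using PiE_mem[OF that(1)[unfolded carrier_bar_module], of k]
        PiE_mem[OF that(2)[unfolded carrier_bar_module], of k] by (auto split: if_splits)
  qed
  show "pm_map V s t x \<in> carrier (pm_space V t)" if st: "s \<le> t" and x: "x \<in> carrier (pm_space V s)" for s t x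
  proof -
    obtain a where a: "a \<in> carrier (pm_space ?W s)" "\<psi> s a = x" using ex[OF x] by blast
    have "pm_map V s t x = \<psi> t (pm_map ?W s t a)" using comm[OF st a(1)] a(2) by simp
    then show ?thesis using bij_betwE[OF bij[of t]] map_bar_module_closed[OF st a(1)] by auto
  qed
  have "?\<phi> t \<in> iso (pm_space V t) (pm_space ?W t)" for t
  proof -
    have "?\<phi> t \<in> carrier (pm_space V t) \<rightarrow> carrier (pm_space ?W t)"
      using bij_betwE[OF bij_betw_inv_into[OF bij[of t]]] by auto
    moreover have "?\<phi> t (x \<otimes>\<^bsub>pm_space V t\<^esub> y) = ?\<phi> t x \<otimes>\<^bsub>pm_space ?W t\<^esub> ?\<phi> t y"
      if xy: "x \<in> carrier (pm_space V t)" "y \<in> carrier (pm_space V t)" for x y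
    proof -
      obtain a b where ab: "a \<in> carrier (pm_space ?W t)" "\<psi> t a = x" "b \<in> carrier (pm_space ?W t)" "\<psi> t b = y"
        using ex xy by blast
      have "x \<otimes>\<^bsub>pm_space V t\<^esub> y = \<psi> t (\<lambda>k\<in>bar_index D. a k + b k)"
        using hom[OF ab(1,3)] ab by simp
      then show ?thesis
        unfolding mult_bar_module using inv[OF add[OF ab(1,3)]] inv[OF ab(1)] inv[OF ab(3)] ab(2,4) by simp
    qed
    ultimately show ?thesis
      unfolding iso_def hom_def using bij_betw_inv_into[OF bij[of t]] by blast
  qed
  moreover have "?\<phi> t (pm_map V s t x) = pm_map ?W s t (?\<phi> s x)"
    if st: "s \<le> t" and x: "x \<in> carrier (pm_space V s)" for s t x
  proof -
    obtain a where a: "a \<in> carrier (pm_space ?W s)" "\<psi> s a = x" using ex[OF x] by blast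
    then have "pm_map V s t x = \<psi> t (pm_map ?W s t a)" using comm[OF st] by simp
    then show ?thesis using inv[OF map_bar_module_closed[OF st a(1)]] inv[OF a(1)] a(2) by simp
  qed
  ultimately show "is_persistence_diagram V D"
    unfolding is_persistence_diagram_def pm_isomorphic_def bar_index_def[symmetric] using D
    by (intro conjI exI[of _ ?\<phi>]) auto
qed

section \<open>The elder rule on a path\<close>

text \<open>
  Equal values are ordered by position, so that every nonempty finite set of vertices has exactly one
  oldest element.
\<close>

definition older :: "(nat \<Rightarrow> real) \<Rightarrow> nat \<Rightarrow> nat \<Rightarrow> bool" where
  "older x w v \<longleftrightarrow> x w < x v \<or> x w = x v \<and> w < v"

text \<open>
  The lowest level at which \<open>v\<close> and \<open>w\<close> lie in one component of the sublevel complex.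
\<close>

definition peak :: "(nat \<Rightarrow> real) \<Rightarrow> nat \<Rightarrow> nat \<Rightarrow> real" where
  "peak x v w = Max (x ` {min v w..max v w})"

definition elders :: "(nat \<Rightarrow> real) \<Rightarrow> nat \<Rightarrow> nat \<Rightarrow> nat set" where
  "elders x n v = {w \<in> {1..n}. older x w v}"

definition parent :: "(nat \<Rightarrow> real) \<Rightarrow> nat \<Rightarrow> nat \<Rightarrow> nat" where
  "parent x n v = arg_min_on (peak x v) (elders x n v)"

definition death :: "(nat \<Rightarrow> real) \<Rightarrow> nat \<Rightarrow> nat \<Rightarrow> ereal" where
  "death x n v = (if elders x n v = {} then \<infinity> else ereal (peak x v (parent x n v)))"

text \<open>
  Vertices that die at birth are discarded, because intervals of length zero are not bars.
\<close>

definition elder_bars :: "(nat \<Rightarrow> real) \<Rightarrow> nat \<Rightarrow> nat set" where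
  "elder_bars x n = {v \<in> {1..n}. ereal (x v) < death x n v}"

definition elder_diagram :: "(nat \<Rightarrow> real) \<Rightarrow> nat \<Rightarrow> (ereal \<times> ereal) multiset" where
  "elder_diagram x n = image_mset (\<lambda>v. (ereal (x v), death x n v)) (mset_set (elder_bars x n))"

lemma older_irrefl [simp]: "\<not> older x v v"
  by (simp add: older_def)

lemma older_trans: "older x u v \<Longrightarrow> older x v w \<Longrightarrow> older x u w"
  by (auto simp: older_def)

lemma older_linear: "v \<noteq> w \<Longrightarrow> older x v w \<or> older x w v"
  by (auto simp: older_def)

lemma older_imp_le: "older x v w \<Longrightarrow> x v \<le> x w"
  by (auto simp: older_def)

lemma peak_le_iff: "peak x v w \<le> t \<longleftrightarrow> (\<forall>k\<in>{min v w..max v w}. x k \<le> t)"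
  unfolding peak_def by (subst Max_le_iff) auto

lemma le_peak: "x v \<le> peak x v w"
  unfolding peak_def by (rule Max_ge) auto

lemma le_peak_between: "k \<in> {min v w..max v w} \<Longrightarrow> x k \<le> peak x v w"
  unfolding peak_def by (rule Max_ge) auto

lemma finite_elders [simp]: "finite (elders x n v)"
  by (simp add: elders_def)

lemma parent_elders: "elders x n v \<noteq> {} \<Longrightarrow> parent x n v \<in> elders x n v"
  unfolding parent_def by (rule arg_min_if_finite) auto

lemma peak_parent_le:
  assumes "w \<in> elders x n v"
  shows "peak x v (parent x n v) \<le> peak x v w"
  using arg_min_least[OF finite_elders _ assms] assms unfolding parent_def by fastforce

lemma death_le_peak:
  assumes "w \<in> elders x n v"
  shows "death x n v \<le> ereal (peak x v w)"
  using peak_parent_le[OF assms] assms by (auto simp: death_def)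

lemma finite_total_order_least:
  assumes "finite A" "A \<noteq> {}"
    and tr: "\<And>u v w. R u v \<Longrightarrow> R v w \<Longrightarrow> R u w" and tot: "\<And>v w. v \<noteq> w \<Longrightarrow> R v w \<or> R w v"
  shows "\<exists>v\<in>A. \<forall>w\<in>A. w \<noteq> v \<longrightarrow> R v w"
  using assms(1,2)
proof (induction rule: finite_ne_induct)
  case (insert a A)
  then obtain v where v: "v \<in> A" "\<And>w. w \<in> A \<Longrightarrow> w \<noteq> v \<Longrightarrow> R v w" by blast
  show ?case
  proof (cases "R a v")
    case True
    have "R a w" if "w \<in> A" for w
      using v(2)[OF that] tr[OF True] True by (cases "w = v") auto
    then show ?thesis by auto
  next
    case False
    then have "R v a" using insert.hyps v(1) tot[of v a] by auto
    then show ?thesis using v by auto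
  qed
qed auto

lemma exists_oldest:
  assumes "finite A" "A \<noteq> {}"
  shows "\<exists>v\<in>A. \<forall>w\<in>A. w \<noteq> v \<longrightarrow> older x v w"
  using assms by (rule finite_total_order_least) (rule older_trans older_linear; assumption)+

lemma exists_youngest:
  assumes "finite A" "A \<noteq> {}"
  shows "\<exists>v\<in>A. \<forall>w\<in>A. w \<noteq> v \<longrightarrow> older x w v"
  using assms by (rule finite_total_order_least) (auto dest: older_linear intro: older_trans)

lemma Max_censored_le_iff:
  assumes "finite \<sigma>" "\<sigma> \<noteq> {}"
  shows "(MAX i\<in>\<sigma>. censored x n i) \<le> ereal t \<longleftrightarrow> \<sigma> \<subseteq> {1..n} \<and> (\<forall>i\<in>\<sigma>. x i \<le> t)"
proof -
  have "censored x n i \<le> ereal t \<longleftrightarrow> i \<in> {1..n} \<and> x i \<le> t" for i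
    by (auto simp: censored_def)
  then show ?thesis using assms by (subst Max_le_iff) auto
qed

lemma vertex_sublevel_complex: "{v} \<in> sublevel_complex x n t \<longleftrightarrow> v \<in> {1..n} \<and> x v \<le> t"
proof -
  have "{v} \<in> path_complex" by (auto simp: path_complex_def)
  then show ?thesis
    using Max_censored_le_iff[of "{v}" x n t] by (simp add: sublevel_complex_def)
qed

lemma edge_sublevel_complex:
  "{v, Suc v} \<in> sublevel_complex x n t \<longleftrightarrow> {v, Suc v} \<subseteq> {1..n} \<and> x v \<le> t \<and> x (Suc v) \<le> t"
proof -
  have "{v, Suc v} \<in> path_complex" by (auto simp: path_complex_def)
  then show ?thesis
    using Max_censored_le_iff[of "{v, Suc v}" x n t] by (auto simp: sublevel_complex_def)
qed

lemma sublevel_complex_cases: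
  assumes "\<sigma> \<in> sublevel_complex x n t"
  obtains v where "\<sigma> = {v}" | v where "\<sigma> = {v, Suc v}"
  using assms by (auto simp: sublevel_complex_def path_complex_def)

lemma sublevel_complex_mono: "s \<le> t \<Longrightarrow> sublevel_complex x n s \<subseteq> sublevel_complex x n t"
  by (auto simp: sublevel_complex_def intro: order_trans[of _ "ereal s"])

lemma chains_0_sublevel_complex:
  "c \<in> chains 0 (sublevel_complex x n t) \<longleftrightarrow> (\<forall>\<sigma>. c \<sigma> \<noteq> 0 \<longrightarrow> (\<exists>v\<in>{1..n}. x v \<le> t \<and> \<sigma> = {v}))"
    (is "?L \<longleftrightarrow> ?R")
proof
  assume ?L
  then show ?R
    unfolding chains_def by (fastforce simp: card_1_singleton_iff vertex_sublevel_complex)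
next
  assume R: ?R
  then have "{\<sigma>. c \<sigma> \<noteq> 0} \<subseteq> (\<lambda>v. {v}) ` {1..n}" by blast
  then have "finite {\<sigma>. c \<sigma> \<noteq> 0}" by (rule finite_subset) simp
  then show ?L unfolding chains_def using R by (fastforce simp: vertex_sublevel_complex)
qed

lemma point_chain_sublevel_complex:
  "v \<in> {1..n} \<Longrightarrow> x v \<le> t \<Longrightarrow> point_chain v \<in> chains 0 (sublevel_complex x n t)"
  unfolding chains_0_sublevel_complex point_chain_def by auto

text \<open>
  The sum of the edges between \<open>v\<close> and \<open>w\<close> has this boundary; all of them are present at level \<open>t\<close>.
\<close>

lemma connected_point_chains:
  assumes "v \<in> {1..n}" "w \<in> {1..n}" "peak x v w \<le> t"
  shows "point_chain v \<boxplus> point_chain w \<in> boundaries 0 (sublevel_complex x n t)"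
proof -
  have *: "point_chain v \<boxplus> point_chain w \<in> boundaries 0 (sublevel_complex x n t)"
    if "v \<le> w" "1 \<le> v" "w \<le> n" "\<forall>k\<in>{v..w}. x k \<le> t" for v w
    using that
  proof (induction w rule: dec_induct)
    case (step w)
    have "{w, Suc w} \<in> sublevel_complex x n t"
      using step by (auto simp: edge_sublevel_complex)
    then have "point_chain w \<boxplus> point_chain (Suc w) \<in> boundaries 0 (sublevel_complex x n t)"
      by (rule edge_boundary) simp
    moreover have "point_chain v \<boxplus> point_chain w \<in> boundaries 0 (sublevel_complex x n t)"
      using step by auto
    ultimately have "(point_chain v \<boxplus> point_chain w) \<boxplus> (point_chain w \<boxplus> point_chain (Suc w))
        \<in> boundaries 0 (sublevel_complex x n t)"
      by (intro chain_add_boundaries[of "point_chain v \<boxplus> point_chain w" _ "point_chain w \<boxplus> point_chain (Suc w)"])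
    then show ?case by (simp add: chain_add_assoc)
  qed simp
  show ?thesis
  proof (cases "v \<le> w")
    case True
    then show ?thesis using *[of v w] assms by (auto simp: peak_le_iff)
  next
    case False
    then have "point_chain w \<boxplus> point_chain v \<in> boundaries 0 (sublevel_complex x n t)"
      using *[of w v] assms by (auto simp: peak_le_iff)
    then show ?thesis by (simp only: chain_add_commute)
  qed
qed

text \<open>
  The cycle that represents the bar of \<open>v\<close>: it exists from the birth of \<open>v\<close> and is a boundary from
  the death of \<open>v\<close> onwards.
\<close>

definition elder_chain :: "(nat \<Rightarrow> real) \<Rightarrow> nat \<Rightarrow> nat \<Rightarrow> nat set \<Rightarrow> bit" where
  "elder_chain x n v = (if elders x n v = {} then point_chain v
     else point_chain v \<boxplus> point_chain (parent x n v))"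

lemma elder_chain_chains:
  assumes "v \<in> {1..n}" "x v \<le> t"
  shows "elder_chain x n v \<in> chains 0 (sublevel_complex x n t)"
proof (cases "elders x n v = {}")
  case False
  then have "parent x n v \<in> {1..n}" "x (parent x n v) \<le> x v"
    using parent_elders[OF False] older_imp_le by (auto simp: elders_def)
  then show ?thesis
    using False assms by (auto simp: elder_chain_def intro!: chain_add_chains point_chain_sublevel_complex)
qed (use assms in \<open>simp add: elder_chain_def point_chain_sublevel_complex\<close>)

lemma elder_chain_boundary:
  assumes "v \<in> {1..n}" "death x n v \<le> ereal t"
  shows "elder_chain x n v \<in> boundaries 0 (sublevel_complex x n t)"
proof -
  have ne: "elders x n v \<noteq> {}" "peak x v (parent x n v) \<le> t"
    using assms(2) by (auto simp: death_def split: if_splits)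
  then have "parent x n v \<in> {1..n}" using parent_elders[OF ne(1)] by (auto simp: elders_def)
  then show ?thesis using connected_point_chains[OF assms(1) _ ne(2)] ne(1) by (simp add: elder_chain_def)
qed

lemma finite_elder_bars [simp]: "finite (elder_bars x n)"
  by (simp add: elder_bars_def)

text \<open>
  The direct sum over a diagram is indexed by numbered copies of bars, whereas the elder rule
  produces bars indexed by vertices.
\<close>

lemma exists_bar_vertex_bijection:
  "\<exists>\<beta>. bij_betw \<beta> (bar_index (elder_diagram x n)) (elder_bars x n) \<and>
    (\<forall>k\<in>bar_index (elder_diagram x n). fst k = (ereal (x (\<beta> k)), death x n (\<beta> k)))"
proof -
  let ?f = "\<lambda>v. (ereal (x v), death x n v)"
  let ?E = "elder_bars x n" and ?I = "bar_index (elder_diagram x n)"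
  have "\<exists>b. bij_betw b {i. i < count (elder_diagram x n) p} {v \<in> ?E. ?f v = p}" for p
  proof -
    have "card {v \<in> ?E. ?f v = p} = count (elder_diagram x n) p"
      unfolding elder_diagram_def count_image_mset
      by (auto simp: vimage_def Int_def conj_commute count_mset_set' intro!: arg_cong[where f = card])
    then have "card {i. i < count (elder_diagram x n) p} = card {v \<in> ?E. ?f v = p}" by simp
    then show ?thesis by (intro finite_same_card_bij) auto
  qed
  then obtain b where b: "\<And>p. bij_betw (b p) {i. i < count (elder_diagram x n) p} {v \<in> ?E. ?f v = p}"
    by metis
  have b_img: "b p i \<in> ?E \<and> ?f (b p i) = p" if "i < count (elder_diagram x n) p" for p i
    using bij_betwE[OF b[of p]] that by auto
  have "bij_betw (\<lambda>(p, i). b p i) ?I ?E"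
    unfolding bij_betw_def
  proof (intro conjI inj_onI equalityI subsetI)
    fix k l assume kl: "k \<in> ?I" "l \<in> ?I" "(\<lambda>(p, i). b p i) k = (\<lambda>(p, i). b p i) l"
    obtain p i q j where k: "k = (p, i)" and l: "l = (q, j)" by (metis surj_pair)
    have i: "i < count (elder_diagram x n) p" and j: "j < count (elder_diagram x n) q"
      using kl k l by (auto simp: bar_index_def)
    have "b p i = b q j" using kl(3) k l by simp
    then have "p = q" using b_img[OF i] b_img[OF j] by metis
    moreover have "i = j"
      using bij_betw_imp_inj_on[OF b[of p]] i j \<open>b p i = b q j\<close> \<open>p = q\<close> by (auto simp: inj_on_def)
    ultimately show "k = l" using k l by simp
  next
    fix v assume "v \<in> (\<lambda>(p, i). b p i) ` ?I"
    then show "v \<in> ?E" using b_img by (auto simp: bar_index_def)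
  next
    fix v assume "v \<in> ?E"
    then have "v \<in> {w \<in> ?E. ?f w = ?f v}" by simp
    then obtain i where "i < count (elder_diagram x n) (?f v)" "v = b (?f v) i"
      using bij_betw_imp_surj_on[OF b[of "?f v"]] by blast
    then show "v \<in> (\<lambda>(p, i). b p i) ` ?I"
      by (intro image_eqI[of _ _ "(?f v, i)"]) (auto simp: bar_index_def)
  qed
  moreover have "fst k = ?f ((\<lambda>(p, i). b p i) k)" if "k \<in> ?I" for k
    using b_img[of "snd k" "fst k"] that by (auto simp: bar_index_def split: prod.split)
  ultimately show ?thesis by blast
qed

lemma sum_mult_closed:
  fixes G :: "('v set \<Rightarrow> bit) set"
  assumes "finite A" and G: "(\<lambda>_. 0) \<in> G" "\<And>a b. a \<in> G \<Longrightarrow> b \<in> G \<Longrightarrow> a \<boxplus> b \<in> G"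
    and f: "\<And>k. k \<in> A \<Longrightarrow> c k \<noteq> 0 \<Longrightarrow> f k \<in> G"
  shows "(\<lambda>\<sigma>. \<Sum>k\<in>A. c k * f k \<sigma>) \<in> G"
  using assms(1) f
proof (induction rule: finite_induct)
  case (insert a A)
  let ?r = "\<lambda>\<sigma>. \<Sum>k\<in>A. c k * f k \<sigma>"
  have r: "?r \<in> G" using insert by auto
  show ?case
  proof (cases "c a = 0")
    case True
    then show ?thesis using r insert by simp
  next
    case False
    then have "c a = 1" by (cases "c a") auto
    then have "(\<lambda>\<sigma>. \<Sum>k\<in>insert a A. c k * f k \<sigma>) = f a \<boxplus> ?r"
      using insert by (simp add: chain_add_def)
    moreover have "f a \<in> G" using insert False by auto
    ultimately show ?thesis using G(2) r by simp
  qed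
qed (use G in simp)

lemma sum_point_chain:
  "finite S \<Longrightarrow> (\<Sum>w\<in>S. point_chain v {w}) = (if v \<in> S then 1 else 0)"
  by (simp add: point_chain_def eq_commute[of _ v] cong: if_cong)

lemma sublevel_component_closed:
  assumes \<sigma>: "\<sigma> \<in> sublevel_complex x n t" "card \<sigma> = 2"
    and S: "S = {w \<in> {1..n}. peak x u w \<le> t}"
  shows "\<sigma> \<inter> S = {} \<or> \<sigma> \<subseteq> S"
proof -
  obtain v where v: "\<sigma> = {v, Suc v}"
    using \<sigma>(1) by (rule sublevel_complex_cases) (use \<sigma>(2) in auto)
  then have vx: "v \<in> {1..n}" "Suc v \<in> {1..n}" "x v \<le> t" "x (Suc v) \<le> t"
    using \<sigma>(1) by (auto simp: edge_sublevel_complex)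
  have "peak x u (Suc v) \<le> t" if "peak x u v \<le> t"
    unfolding peak_le_iff
  proof
    fix k assume k: "k \<in> {min u (Suc v)..max u (Suc v)}"
    then have "k = Suc v \<or> k \<in> {min u v..max u v}" by (auto simp: min_def max_def split: if_splits)
    then show "x k \<le> t" using that vx unfolding peak_le_iff by blast
  qed
  moreover have "peak x u v \<le> t" if "peak x u (Suc v) \<le> t"
    unfolding peak_le_iff
  proof
    fix k assume k: "k \<in> {min u v..max u v}"
    then have "k = v \<or> k \<in> {min u (Suc v)..max u (Suc v)}" by (auto simp: min_def max_def split: if_splits)
    then show "x k \<le> t" using that vx unfolding peak_le_iff by blast
  qed
  ultimately show ?thesis using v vx S by auto
qed

lemma sum_elder_chain:
  assumes "finite S"
  shows "(\<Sum>w\<in>S. elder_chain x n v {w}) =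
    (if v \<in> S then 1 else 0) + (if elders x n v \<noteq> {} \<and> parent x n v \<in> S then 1 else 0)"
  using assms by (simp add: elder_chain_def chain_add_def sum.distrib sum_point_chain)

text \<open>
  The classes of the elder chains of those \<open>v\<close> with \<open>x v \<le> t < death x n v\<close> form a basis of the
  homology at level \<open>t\<close>, and the structure maps fix each of them until it dies.

  They generate: by induction on the number of elders of \<open>v\<close>, the class of \<open>v\<close> is the class of its
  elder chain plus that of its parent. They are independent: suppose that a nontrivial combination
  is a boundary, let \<open>v\<close> be the youngest vertex involved, and sum the coefficients over the component
  of \<open>v\<close>. No vertex older than \<open>v\<close> lies in this component, because \<open>v\<close> has not died. All other vertices
  in the combination, and all parents, are older than \<open>v\<close>. So the sum is \<open>1\<close>, whereas boundaries have
  sum \<open>0\<close> over every component.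
\<close>

theorem
  shows elder_diagram_is_persistence_diagram:
      "is_persistence_diagram (pm_homology 0 (sublevel_complex x n)) (elder_diagram x n)" (is ?A)
    and PD0_eq_elder_diagram: "PD0 x n = elder_diagram x n"
proof -
  let ?D = "elder_diagram x n"
  let ?I = "bar_index ?D"
  let ?K = "sublevel_complex x n"
  let ?V = "pm_homology 0 ?K"
  let ?B = "\<lambda>t. boundaries 0 (?K t)"
  let ?C = "\<lambda>t. carrier (pm_space (bar_module ?D) t)"
  let ?e = "elder_chain x n"
  obtain \<beta> where \<beta>: "bij_betw \<beta> ?I (elder_bars x n)"
    and fst0: "\<forall>k\<in>?I. fst k = (ereal (x (\<beta> k)), death x n (\<beta> k))"
    using exists_bar_vertex_bijection[of x n] by blast
  have fst: "fst k = (ereal (x (\<beta> k)), death x n (\<beta> k))" if "k \<in> ?I" for k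
    using fst0 that by blast
  have \<beta>V: "\<beta> k \<in> {1..n}" if "k \<in> ?I" for k
    using bij_betwE[OF \<beta>] that by (auto simp: elder_bars_def)
  define E where "E c = (\<lambda>\<sigma>. \<Sum>k\<in>?I. c k * ?e (\<beta> k) \<sigma>)" for c
  let ?\<psi> = "\<lambda>t c. homology_class (?K t) (E c)"
  have alive: "x (\<beta> k) \<le> t \<and> ereal t < death x n (\<beta> k)" if c: "c \<in> ?C t" and k: "k \<in> ?I" "c k \<noteq> 0" for c t k
    using PiE_mem[OF c[unfolded carrier_bar_module] k(1)] k fst[OF k(1)] by (auto split: if_splits)
  have CI: "(\<lambda>k\<in>?I. c k) \<in> ?C t"
    if "\<And>k. k \<in> ?I \<Longrightarrow> c k \<noteq> 0 \<Longrightarrow> x (\<beta> k) \<le> t \<and> ereal t < death x n (\<beta> k)" for c t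
    unfolding carrier_bar_module restrict_PiE_iff using that fst by auto
  have E_add: "E (\<lambda>k\<in>?I. a k + b k) = E a \<boxplus> E b" for a b
    unfolding E_def chain_add_def by (simp add: sum.distrib distrib_right flip: sum.distrib)
  have Bsum: "(\<lambda>\<sigma>. \<Sum>k\<in>?I. c k * ?e (\<beta> k) \<sigma>) \<in> ?B t"
    if "\<And>k. k \<in> ?I \<Longrightarrow> c k \<noteq> 0 \<Longrightarrow> ?e (\<beta> k) \<in> ?B t" for c t
    by (rule sum_mult_closed[OF finite_bar_index]) (use that chain_add_boundaries in auto)
  have E_chains: "E c \<in> chains 0 (?K t)" if "c \<in> ?C t" for c t
    unfolding E_def
    by (rule sum_mult_closed[OF finite_bar_index])
       (use alive[OF that] \<beta>V in \<open>auto intro: chain_add_chains elder_chain_chains\<close>)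
  have comm: "?\<psi> t (pm_map (bar_module ?D) s t a) = pm_map ?V s t (?\<psi> s a)"
    if st: "s \<le> t" and a: "a \<in> ?C s" for s t a
  proof -
    let ?m = "pm_map (bar_module ?D) s t a"
    have "E ?m \<boxplus> E a = E (\<lambda>k\<in>?I. ?m k + a k)" by (simp add: E_add)
    also have "\<dots> = (\<lambda>\<sigma>. \<Sum>k\<in>?I. (?m k + a k) * ?e (\<beta> k) \<sigma>)"
      unfolding E_def by (intro ext sum.cong) auto
    also have "\<dots> \<in> ?B t"
    proof (rule Bsum)
      fix k assume k: "k \<in> ?I" "?m k + a k \<noteq> 0"
      then have "a k \<noteq> 0" "\<not> (x (\<beta> k) \<le> s \<and> ereal t < death x n (\<beta> k))"
        using fst[OF k(1)] unfolding map_bar_module by (auto split: if_splits)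
      then have "death x n (\<beta> k) \<le> ereal t" using alive[OF a k(1)] by auto
      then show "?e (\<beta> k) \<in> ?B t" by (rule elder_chain_boundary[OF \<beta>V[OF k(1)]])
    qed
    finally have "?\<psi> t ?m = ?\<psi> t a" unfolding homology_class_eq_iff .
    then show ?thesis
      using homology_inclusion_class[OF sublevel_complex_mono[OF st]] by (simp add: pm_homology_def)
  qed
  have inj: "a = b" if ab: "a \<in> ?C t" "b \<in> ?C t" "?\<psi> t a = ?\<psi> t b" for a b t
  proof (rule ccontr)
    assume "a \<noteq> b"
    let ?J = "{k \<in> ?I. a k \<noteq> b k}"
    have "?J \<noteq> {}"
    proof
      assume J: "?J = {}"
      have "a = b"
        using J ab(1,2) unfolding carrier_bar_module by (intro PiE_ext) auto
      with \<open>a \<noteq> b\<close> show False ..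
    qed
    moreover have "finite ?J" by (rule finite_subset[OF _ finite_bar_index]) auto
    ultimately have "finite (\<beta> ` ?J)" "\<beta> ` ?J \<noteq> {}" by auto
    from exists_youngest[OF this, of x]
    obtain v where v: "v \<in> \<beta> ` ?J" "\<forall>w\<in>\<beta> ` ?J. w \<noteq> v \<longrightarrow> older x w v" by blast
    from v(1) obtain k0 where k0: "k0 \<in> ?I" "a k0 \<noteq> b k0" "\<beta> k0 = v" by auto
    have v_alive: "x v \<le> t" "ereal t < death x n v"
      using alive[OF ab(1) k0(1)] alive[OF ab(2) k0(1)] k0(2,3) by (cases "a k0 = 0"; auto)+
    define S where "S = {w \<in> {1..n}. peak x v w \<le> t}"
    have finS: "finite S" by (simp add: S_def)
    have "v \<in> S" using \<beta>V[OF k0(1)] k0(3) v_alive by (simp add: S_def peak_le_iff)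
    have no_older: "w \<notin> S" if "older x w v" for w
    proof
      assume "w \<in> S"
      then have "w \<in> elders x n v" "peak x v w \<le> t" using that by (auto simp: S_def elders_def)
      then have "death x n v \<le> ereal t" using death_le_peak order_trans ereal_less_eq(3) by blast
      with v_alive show False by simp
    qed
    have e_sum: "(\<Sum>w\<in>S. ?e (\<beta> k) {w}) = (if k = k0 then 1 else 0)" if k: "k \<in> ?J" for k
    proof -
      \<comment> \<open>Parents and vertices other than \<open>v\<close> are older than \<open>v\<close>, hence outside its component.\<close>
      have par: "parent x n (\<beta> k) \<notin> S" if ne: "elders x n (\<beta> k) \<noteq> {}"
      proof (rule no_older)
        have p: "older x (parent x n (\<beta> k)) (\<beta> k)" using parent_elders[OF ne] by (simp add: elders_def)
        show "older x (parent x n (\<beta> k)) v"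
        proof (cases "\<beta> k = v")
          case False
          then have "older x (\<beta> k) v" using v(2) k by blast
          with p show ?thesis by (rule older_trans)
        qed (use p in simp)
      qed
      have "\<beta> k \<in> S \<longleftrightarrow> k = k0"
      proof (cases "k = k0")
        case False
        then have "\<beta> k \<noteq> v"
          using bij_betw_imp_inj_on[OF \<beta>] k k0 by (auto simp: inj_on_def)
        then have "older x (\<beta> k) v" using v(2) k by blast
        then show ?thesis using no_older False by simp
      qed (use \<open>v \<in> S\<close> k0 in simp)
      then show ?thesis using par by (auto simp: sum_elder_chain[OF finS])
    qed
    have "(\<Sum>w\<in>S. (E a \<boxplus> E b) {w}) = (\<Sum>w\<in>S. \<Sum>k\<in>?I. (a k + b k) * ?e (\<beta> k) {w})"
      by (simp add: chain_add_def E_def sum.distrib distrib_right)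
    also have "\<dots> = (\<Sum>k\<in>?I. \<Sum>w\<in>S. (a k + b k) * ?e (\<beta> k) {w})"
      by (rule sum.swap)
    also have "\<dots> = (\<Sum>k\<in>?I. (a k + b k) * (\<Sum>w\<in>S. ?e (\<beta> k) {w}))"
      by (simp add: sum_distrib_left)
    also have "\<dots> = (\<Sum>k\<in>?I. if k = k0 then a k + b k else 0)"
    proof (rule sum.cong[OF refl])
      fix k assume "k \<in> ?I"
      then show "(a k + b k) * (\<Sum>w\<in>S. ?e (\<beta> k) {w}) = (if k = k0 then a k + b k else 0)"
        using e_sum[of k] by (cases "a k = b k") auto
    qed
    also have "\<dots> = a k0 + b k0" using k0(1) by simp
    finally have "(\<Sum>w\<in>S. (E a \<boxplus> E b) {w}) \<noteq> 0" using k0(2) by (simp add: bit_add_eq_0_iff)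
    moreover have "(\<Sum>w\<in>S. (E a \<boxplus> E b) {w}) = 0"
      using ab(3) sublevel_component_closed[OF _ _ S_def] unfolding homology_class_eq_iff
      by (intro sum_boundary_over_component[OF _ finS]) auto
    ultimately show False by simp
  qed
  have surj: "\<exists>c\<in>?C t. ?\<psi> t c = homology_class (?K t) z" if z: "z \<in> chains 0 (?K t)" for z t
  proof -
    \<comment> \<open>The chains whose class is in the image; a set closed under addition.\<close>
    define G where "G = {z. \<exists>c\<in>?C t. E c \<boxplus> z \<in> ?B t}"
    have G_B: "z \<in> G" if "z \<in> ?B t" for z
    proof -
      have "(\<lambda>k\<in>?I. 0) \<in> ?C t" by (rule CI) simp
      moreover have "E (\<lambda>k\<in>?I. 0) = (\<lambda>_. 0)" by (simp add: E_def)
      ultimately show ?thesis using that unfolding G_def by (intro CollectI bexI[of _ "\<lambda>k\<in>?I. 0"]) auto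
    qed
    have G_add: "y \<boxplus> z \<in> G" if yz: "y \<in> G" "z \<in> G" for y z
    proof -
      obtain a b where a: "a \<in> ?C t" "E a \<boxplus> y \<in> ?B t" and b: "b \<in> ?C t" "E b \<boxplus> z \<in> ?B t"
        using yz unfolding G_def by blast
      have "(\<lambda>k\<in>?I. a k + b k) \<in> ?C t"
      proof (rule CI)
        fix k assume k: "k \<in> ?I" "a k + b k \<noteq> 0"
        then have "a k \<noteq> 0 \<or> b k \<noteq> 0" by auto
        then show "x (\<beta> k) \<le> t \<and> ereal t < death x n (\<beta> k)"
          using alive[OF a(1) k(1)] alive[OF b(1) k(1)] by blast
      qed
      moreover have "E (\<lambda>k\<in>?I. a k + b k) \<boxplus> (y \<boxplus> z) = (E a \<boxplus> y) \<boxplus> (E b \<boxplus> z)"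
        unfolding E_add by (simp only: chain_add_ac)
      then have "E (\<lambda>k\<in>?I. a k + b k) \<boxplus> (y \<boxplus> z) \<in> ?B t"
        using chain_add_boundaries[OF a(2) b(2)] by simp
      ultimately show ?thesis unfolding G_def by blast
    qed
    have G_e: "?e v \<in> G" if v: "v \<in> {1..n}" "x v \<le> t" for v
    proof (cases "death x n v \<le> ereal t")
      case True
      then show ?thesis using elder_chain_boundary[OF v(1)] G_B by blast
    next
      case False
      then have "ereal (x v) < death x n v"
        using v(2) by (intro le_less_trans[of "ereal (x v)" "ereal t"]) auto
      then have "v \<in> elder_bars x n"
        using v by (simp add: elder_bars_def)
      then have "v \<in> \<beta> ` ?I" by (simp only: bij_betw_imp_surj_on[OF \<beta>])
      then obtain k where k: "k \<in> ?I" "\<beta> k = v" by blast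
      let ?c = "\<lambda>l\<in>?I. if l = k then 1 else 0 :: bit"
      have "?c \<in> ?C t"
        by (rule CI) (use k False v(2) in \<open>simp add: not_le split: if_splits\<close>)
      moreover have "E ?c = ?e v"
      proof
        fix \<sigma>
        have "E ?c \<sigma> = (\<Sum>l\<in>?I. if l = k then ?e v \<sigma> else 0)"
          unfolding E_def using k by (intro sum.cong) auto
        then show "E ?c \<sigma> = ?e v \<sigma>" using k by simp
      qed
      ultimately show ?thesis unfolding G_def by (intro CollectI bexI[of _ ?c]) auto
    qed
    have G_pt: "point_chain v \<in> G" if "v \<in> {1..n}" "x v \<le> t" for v
      using that
    proof (induction "card (elders x n v)" arbitrary: v rule: less_induct)
      case less
      show ?case
      proof (cases "elders x n v = {}")
        case True
        then show ?thesis using G_e[OF less.prems] by (simp add: elder_chain_def)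
      next
        case False
        let ?p = "parent x n v"
        have p: "?p \<in> {1..n}" "older x ?p v" using parent_elders[OF False] by (auto simp: elders_def)
        have "elders x n ?p \<subseteq> elders x n v"
          using p(2) by (auto simp: elders_def intro: older_trans)
        moreover have "?p \<in> elders x n v" "?p \<notin> elders x n ?p"
          using p by (auto simp: elders_def)
        ultimately have "elders x n ?p \<subset> elders x n v" by blast
        then have "point_chain ?p \<in> G"
          using p less.prems older_imp_le[OF p(2)] by (intro less.hyps psubset_card_mono) auto
        then have "?e v \<boxplus> point_chain ?p \<in> G" using G_add G_e[OF less.prems] by blast
        then show ?thesis using False by (simp add: elder_chain_def chain_add_assoc)
      qed
    qed
    have "z \<sigma> = (\<Sum>v\<in>{1..n}. z {v} * point_chain v \<sigma>)" for \<sigma>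
    proof (cases "\<exists>w\<in>{1..n}. \<sigma> = {w}")
      case True
      then obtain w where w: "w \<in> {1..n}" "\<sigma> = {w}" by blast
      have "(\<Sum>v\<in>{1..n}. z {v} * point_chain v {w}) = (\<Sum>v\<in>{1..n}. if w = v then z {v} else 0)"
        by (intro sum.cong) (auto simp: point_chain_def)
      then show ?thesis using w by simp
    next
      case False
      then have "z \<sigma> = 0" using z unfolding chains_0_sublevel_complex by blast
      moreover have "(\<Sum>v\<in>{1..n}. z {v} * point_chain v \<sigma>) = 0"
        using False by (intro sum.neutral) (auto simp: point_chain_def)
      ultimately show ?thesis by simp
    qed
    then have "z = (\<lambda>\<sigma>. \<Sum>v\<in>{1..n}. z {v} * point_chain v \<sigma>)" by (rule ext)
    also have "\<dots> \<in> G"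
    proof (rule sum_mult_closed)
      fix v assume v: "v \<in> {1..n}" "z {v} \<noteq> 0"
      then have "x v \<le> t" using z unfolding chains_0_sublevel_complex by auto
      then show "point_chain v \<in> G" using G_pt v by blast
    qed (use G_B G_add in auto)
    finally obtain c where "c \<in> ?C t" "E c \<boxplus> z \<in> ?B t" unfolding G_def by blast
    then show ?thesis unfolding homology_class_eq_iff by blast
  qed
  have bij: "bij_betw (?\<psi> t) (?C t) (carrier (pm_space ?V t))" for t
    unfolding bij_betw_def
  proof
    show "inj_on (?\<psi> t) (?C t)" using inj by (intro inj_onI)
    show "?\<psi> t ` ?C t = carrier (pm_space ?V t)"
    proof (intro equalityI subsetI)
      fix y assume "y \<in> ?\<psi> t ` ?C t"
      then obtain c where "c \<in> ?C t" "y = ?\<psi> t c" by blast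
      then show "y \<in> carrier (pm_space ?V t)"
        using E_chains[of c t] by (simp add: pm_homology_def carrier_homology_0)
    next
      fix y assume "y \<in> carrier (pm_space ?V t)"
      then obtain z where "z \<in> chains 0 (?K t)" "y = homology_class (?K t) z"
        by (auto simp: pm_homology_def carrier_homology_0)
      then show "y \<in> ?\<psi> t ` ?C t" using surj by blast
    qed
  qed
  have DD: "set_mset ?D \<subseteq> Delta"
    by (auto simp: elder_diagram_def Delta_def elder_bars_def)
  have hom: "?\<psi> t (\<lambda>k\<in>?I. a k + b k) = ?\<psi> t a \<otimes>\<^bsub>pm_space ?V t\<^esub> ?\<psi> t b" for a b t
    by (simp add: E_add pm_homology_def mult_homology_0)
  show A: ?A
    by (rule is_persistence_diagram_from_bar_module(1)[OF DD bij hom comm])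
  have closed: "pm_map ?V s t y \<in> carrier (pm_space ?V t)" if "s \<le> t" "y \<in> carrier (pm_space ?V s)" for s t y
    using is_persistence_diagram_from_bar_module(2)[OF DD bij hom comm that] .
  show "PD0 x n = elder_diagram x n"
    unfolding PD0_def persistence_diagram_def
    using A persistence_diagram_unique[OF _ A closed] by (rule the_equality)
qed

section \<open>Bars compared with samples\<close>

definition finite_elder_bars :: "(nat \<Rightarrow> real) \<Rightarrow> nat \<Rightarrow> nat set" where
  "finite_elder_bars x n = {v \<in> elder_bars x n. elders x n v \<noteq> {}}"

lemma finite_finite_elder_bars [simp]: "finite (finite_elder_bars x n)"
  by (simp add: finite_elder_bars_def)

lemma finite_bars_eq:
  "finite_bars x n =
     image_mset (\<lambda>v. (ereal (x v), ereal (peak x v (parent x n v)))) (mset_set (finite_elder_bars x n))"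
proof -
  have "{v \<in> elder_bars x n. (ereal (x v), death x n v) \<in> Delta_fin} = finite_elder_bars x n"
    by (auto simp: finite_elder_bars_def Delta_fin_def Delta_def death_def elder_bars_def)
  then have "finite_bars x n = image_mset (\<lambda>v. (ereal (x v), death x n v)) (mset_set (finite_elder_bars x n))"
    by (simp add: finite_bars_def PD0_eq_elder_diagram elder_diagram_def filter_mset_image_mset filter_mset_mset_set)
  also have "\<dots> = image_mset (\<lambda>v. (ereal (x v), ereal (peak x v (parent x n v)))) (mset_set (finite_elder_bars x n))"
    by (intro image_mset_cong) (auto simp: finite_elder_bars_def death_def)
  finally show ?thesis .
qed

lemma size_finite_bars: "size (finite_bars x n) = card (finite_elder_bars x n)"
  by (simp add: finite_bars_eq)

text \<open>
  The younger of two such vertices would reach the older one below the level at which it dies.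
\<close>

lemma peak_determines_vertex:
  assumes v: "v \<in> {1..n}" "elders x n v \<noteq> {}" "peak x v (parent x n v) = h"
    and w: "w \<in> {1..n}" "elders x n w \<noteq> {}" "peak x w (parent x n w) = h"
    and below: "\<And>k. k \<in> {min v w..max v w} \<Longrightarrow> x k < h"
  shows "v = w"
proof (rule ccontr)
  assume "v \<noteq> w"
  have lt: "peak x v w < h" "peak x w v < h"
    unfolding peak_def using below by (simp_all add: min.commute max.commute)
  from \<open>v \<noteq> w\<close> consider "older x v w" | "older x w v" using older_linear by blast
  then show False
  proof cases
    case 1
    then have "v \<in> elders x n w" using v by (simp add: elders_def)
    from peak_parent_le[OF this] w(3) lt show False by simp
  next
    case 2
    then have "w \<in> elders x n v" using w by (simp add: elders_def)
    from peak_parent_le[OF this] v(3) lt show False by simp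
  qed
qed

lemma first_peak_right:
  fixes x :: "nat \<Rightarrow> real"
  assumes "v \<le> w" "peak x v w = h"
  shows "\<exists>j\<in>{v..w}. x j = h \<and> (\<forall>k\<in>{v..<j}. x k < h)"
proof -
  have le: "x k \<le> h" if "k \<in> {v..w}" for k
    using le_peak_between[of k v w x] assms that by simp
  have "h \<in> x ` {v..w}"
    using assms Max_in[of "x ` {v..w}"] unfolding peak_def by (simp add: min_absorb1 max_absorb2)
  then obtain i where "i \<in> {v..w} \<and> x i = h" by blast
  then have ex: "\<exists>i. i \<in> {v..w} \<and> x i = h" by blast
  define j where "j = (LEAST i. i \<in> {v..w} \<and> x i = h)"
  have j: "j \<in> {v..w}" "x j = h" using LeastI_ex[OF ex] by (simp_all add: j_def)
  have "x k < h" if k: "k \<in> {v..<j}" for k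
  proof -
    have "\<not> (k \<in> {v..w} \<and> x k = h)" using not_less_Least[of k] k unfolding j_def by auto
    then show ?thesis using le[of k] k j(1) by auto
  qed
  with j show ?thesis by blast
qed

lemma first_peak_left:
  fixes x :: "nat \<Rightarrow> real"
  assumes "w \<le> v" "peak x v w = h"
  shows "\<exists>j\<in>{w..v}. x j = h \<and> (\<forall>k\<in>{j<..v}. x k < h)"
proof -
  have le: "x k \<le> h" if "k \<in> {w..v}" for k
    using le_peak_between[of k v w x] assms that by simp
  have "h \<in> x ` {w..v}"
    using assms Max_in[of "x ` {w..v}"] unfolding peak_def by (simp add: min_absorb2 max_absorb1)
  then have ne: "{i \<in> {w..v}. x i = h} \<noteq> {}" by blast
  define j where "j = Max {i \<in> {w..v}. x i = h}"
  have "j \<in> {i \<in> {w..v}. x i = h}"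
    unfolding j_def by (rule Max_in[OF _ ne]) simp
  then have j: "j \<in> {w..v}" "x j = h" by simp_all
  have "x k < h" if k: "k \<in> {j<..v}" for k
  proof -
    have "k \<notin> {i \<in> {w..v}. x i = h}"
      using Max_ge[of "{i \<in> {w..v}. x i = h}" k] k unfolding j_def[symmetric] by auto
    then show ?thesis using le[of k] k j(1) by auto
  qed
  with j show ?thesis by blast
qed

text \<open>
  A bar has length at most \<open>\<bar>x v\<bar> + \<bar>x j\<bar>\<close>, where \<open>v\<close> is its vertex and \<open>j\<close> the first position, on the
  way from \<open>v\<close> to its parent, at which the level of death is attained. Distinct bars have distinct \<open>v\<close>,
  and \<open>peak_determines_vertex\<close> shows that \<open>j\<close> is attained by at most one bar from each side. This gives
  three sums over the samples. The summand \<open>1\<close> in the condition on \<open>H\<close> accommodates \<open>y ln y + 1\<close>, which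
  decreases near \<open>0\<close>.
\<close>

lemma sum_finite_bars_le:
  fixes H :: "real \<Rightarrow> real"
  assumes H0: "\<And>y. 0 \<le> y \<Longrightarrow> 0 \<le> H y" and H: "\<And>y m. 0 \<le> y \<Longrightarrow> y \<le> m \<Longrightarrow> H y \<le> 1 + H m"
  shows "(\<Sum>p\<in>#finite_bars x n. H (f_I p)) \<le> size (finite_bars x n) + 3 * (\<Sum>i=1..n. H (2 * \<bar>x i\<bar>))"
proof -
  let ?F = "finite_elder_bars x n"
  let ?h = "\<lambda>v. peak x v (parent x n v)"
  let ?G = "\<lambda>i. H (2 * \<bar>x i\<bar>)"
  let ?R = "{v \<in> ?F. v \<le> parent x n v}" and ?L = "{v \<in> ?F. parent x n v < v}"
  have F: "v \<in> {1..n}" "elders x n v \<noteq> {}" "x v < ?h v" "parent x n v \<in> {1..n}" if "v \<in> ?F" for v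
  proof -
    show ne: "elders x n v \<noteq> {}" and "v \<in> {1..n}" and "x v < ?h v"
      using that by (auto simp: finite_elder_bars_def elder_bars_def death_def split: if_splits)
    show "parent x n v \<in> {1..n}" using parent_elders[OF ne] by (simp add: elders_def)
  qed
  have G0: "0 \<le> ?G i" for i by (rule H0) simp
  have "\<forall>v\<in>?R. \<exists>j. j \<in> {1..n} \<and> x j = ?h v \<and> v < j \<and> (\<forall>k\<in>{v..<j}. x k < ?h v)"
  proof
    fix v assume that: "v \<in> ?R"
    have "v \<le> parent x n v" using that by simp
    from first_peak_right[OF this refl]
    obtain j where j: "j \<in> {v..parent x n v}" "x j = ?h v" "\<forall>k\<in>{v..<j}. x k < ?h v" by blast
    have "j \<noteq> v" using j(2) F(3)[of v] that by auto
    moreover have "j \<in> {1..n}" using j(1) F[of v] that by auto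
    ultimately show "\<exists>j. j \<in> {1..n} \<and> x j = ?h v \<and> v < j \<and> (\<forall>k\<in>{v..<j}. x k < ?h v)"
      using j by (intro exI[of _ j]) auto
  qed
  from bchoice[OF this] obtain r where
    "\<forall>v\<in>?R. r v \<in> {1..n} \<and> x (r v) = ?h v \<and> v < r v \<and> (\<forall>k\<in>{v..<r v}. x k < ?h v)" ..
  then have r: "r v \<in> {1..n} \<and> x (r v) = ?h v \<and> v < r v \<and> (\<forall>k\<in>{v..<r v}. x k < ?h v)" if "v \<in> ?R" for v
    using that by (rule bspec)
  have "\<forall>v\<in>?L. \<exists>j. j \<in> {1..n} \<and> x j = ?h v \<and> j < v \<and> (\<forall>k\<in>{j<..v}. x k < ?h v)"
  proof
    fix v assume that: "v \<in> ?L"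
    have "parent x n v \<le> v" using that by simp
    from first_peak_left[OF this refl]
    obtain j where j: "j \<in> {parent x n v..v}" "x j = ?h v" "\<forall>k\<in>{j<..v}. x k < ?h v" by blast
    have "j \<noteq> v" using j(2) F(3)[of v] that by auto
    moreover have "j \<in> {1..n}" using j(1) F[of v] that by auto
    ultimately show "\<exists>j. j \<in> {1..n} \<and> x j = ?h v \<and> j < v \<and> (\<forall>k\<in>{j<..v}. x k < ?h v)"
      using j by (intro exI[of _ j]) auto
  qed
  from bchoice[OF this] obtain l where
    "\<forall>v\<in>?L. l v \<in> {1..n} \<and> x (l v) = ?h v \<and> l v < v \<and> (\<forall>k\<in>{l v<..v}. x k < ?h v)" ..
  then have l: "l v \<in> {1..n} \<and> x (l v) = ?h v \<and> l v < v \<and> (\<forall>k\<in>{l v<..v}. x k < ?h v)" if "v \<in> ?L" for v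
    using that by (rule bspec)
  have "inj_on r ?R"
  proof (rule inj_onI)
    fix v w assume vw: "v \<in> ?R" "w \<in> ?R" "r v = r w"
    then have "?h w = ?h v" using r[OF vw(1)] r[OF vw(2)] by metis
    moreover have "x k < ?h v" if "k \<in> {min v w..max v w}" for k
      using that r[OF vw(1)] r[OF vw(2)] vw(3) \<open>?h w = ?h v\<close> by (cases "v \<le> k") (auto simp: min_def max_def split: if_splits)
    ultimately show "v = w"
      using F[of v] F[of w] vw by (intro peak_determines_vertex[of v n x "?h v" w]) auto
  qed
  have "inj_on l ?L"
  proof (rule inj_onI)
    fix v w assume vw: "v \<in> ?L" "w \<in> ?L" "l v = l w"
    then have "?h w = ?h v" using l[OF vw(1)] l[OF vw(2)] by metis
    moreover have "x k < ?h v" if "k \<in> {min v w..max v w}" for k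
      using that l[OF vw(1)] l[OF vw(2)] vw(3) \<open>?h w = ?h v\<close> by (cases "k \<le> v") (auto simp: min_def max_def split: if_splits)
    ultimately show "v = w"
      using F[of v] F[of w] vw by (intro peak_determines_vertex[of v n x "?h v" w]) auto
  qed
  have len: "H (?h v - x v) \<le> 1 + ?G v + ?G j" if "x j = ?h v" "v \<in> ?F" for v j
  proof -
    have "0 \<le> ?h v - x v" using F(3)[OF that(2)] by simp
    moreover have "?h v - x v \<le> 2 * \<bar>x v\<bar> \<or> ?h v - x v \<le> 2 * \<bar>x j\<bar>" using that(1) by linarith
    ultimately show ?thesis using H[of "?h v - x v" "2 * \<bar>x v\<bar>"] H[of "?h v - x v" "2 * \<bar>x j\<bar>"] G0[of v] G0[of j] by linarith
  qed
  have "(\<Sum>p\<in>#finite_bars x n. H (f_I p)) = (\<Sum>v\<in>?F. H (?h v - x v))"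
    by (simp add: finite_bars_eq f_I_def sum_unfold_sum_mset image_mset.compositionality o_def)
  also have "?F = ?R \<union> ?L" by auto
  also have "(\<Sum>v\<in>?R \<union> ?L. H (?h v - x v)) = (\<Sum>v\<in>?R. H (?h v - x v)) + (\<Sum>v\<in>?L. H (?h v - x v))"
    by (intro sum.union_disjoint) auto
  also have "\<dots> \<le> (\<Sum>v\<in>?R. (1 + ?G v) + ?G (r v)) + (\<Sum>v\<in>?L. (1 + ?G v) + ?G (l v))"
  proof (intro add_mono sum_mono)
    fix v assume "v \<in> ?R"
    then show "H (?h v - x v) \<le> (1 + ?G v) + ?G (r v)" using r[of v] by (intro len) auto
  next
    fix v assume "v \<in> ?L"
    then show "H (?h v - x v) \<le> (1 + ?G v) + ?G (l v)" using l[of v] by (intro len) auto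
  qed
  also have "\<dots> = ((\<Sum>v\<in>?R. 1 + ?G v) + (\<Sum>v\<in>?L. 1 + ?G v)) + ((\<Sum>v\<in>?R. ?G (r v)) + (\<Sum>v\<in>?L. ?G (l v)))"
    by (simp add: sum.distrib)
  also have "(\<Sum>v\<in>?R. 1 + ?G v) + (\<Sum>v\<in>?L. 1 + ?G v) = (\<Sum>v\<in>?R \<union> ?L. 1 + ?G v)"
    by (intro sum.union_disjoint[symmetric]) auto
  also have "?R \<union> ?L = ?F" by auto
  also have "(\<Sum>v\<in>?F. 1 + ?G v) = card ?F + (\<Sum>v\<in>?F. ?G v)" by (simp add: sum.distrib)
  also have "(\<Sum>v\<in>?F. ?G v) \<le> (\<Sum>i=1..n. ?G i)"
    by (intro sum_mono2 G0) (auto simp: finite_elder_bars_def elder_bars_def)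
  also have "(\<Sum>v\<in>?R. ?G (r v)) = (\<Sum>i\<in>r ` ?R. ?G i)"
    by (simp add: sum.reindex[OF \<open>inj_on r ?R\<close>])
  also have "\<dots> \<le> (\<Sum>i=1..n. ?G i)"
    by (intro sum_mono2 G0) (use r in auto)
  also have "(\<Sum>v\<in>?L. ?G (l v)) = (\<Sum>i\<in>l ` ?L. ?G i)"
    by (simp add: sum.reindex[OF \<open>inj_on l ?L\<close>])
  also have "\<dots> \<le> (\<Sum>i=1..n. ?G i)"
    by (intro sum_mono2 G0) (use l in auto)
  finally show ?thesis by (simp add: size_finite_bars)
qed

text \<open>
  An upcrossing at \<open>i\<close> is the right end of a component at level \<open>t\<close>. The oldest vertex of that component
  has not died at level \<open>t\<close>, and different components have different oldest vertices. Only one bar is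
  infinite, namely that of the oldest vertex of all.
\<close>

lemma card_upcrossings_le:
  "card {i \<in> {1..<n}. x i \<le> t \<and> t < x (Suc i)} \<le> size (finite_bars x n) + 1"
proof -
  let ?A = "{i \<in> {1..<n}. x i \<le> t \<and> t < x (Suc i)}"
  \<comment> \<open>The component at level \<open>t\<close> with right end \<open>i\<close>.\<close>
  let ?R = "\<lambda>i. {w \<in> {1..n}. w \<le> i \<and> peak x w i \<le> t}"
  have "\<forall>i\<in>?A. \<exists>v. v \<in> ?R i \<and> (\<forall>w\<in>?R i. w \<noteq> v \<longrightarrow> older x v w)"
  proof
    fix i assume "i \<in> ?A"
    then have "finite (?R i)" "?R i \<noteq> {}" by (auto simp: peak_le_iff)
    from exists_oldest[OF this, of x]
    show "\<exists>v. v \<in> ?R i \<and> (\<forall>w\<in>?R i. w \<noteq> v \<longrightarrow> older x v w)" by blast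
  qed
  from bchoice[OF this] obtain m where
    "\<forall>i\<in>?A. m i \<in> ?R i \<and> (\<forall>w\<in>?R i. w \<noteq> m i \<longrightarrow> older x (m i) w)" ..
  then have m: "m i \<in> ?R i \<and> (\<forall>w\<in>?R i. w \<noteq> m i \<longrightarrow> older x (m i) w)" if "i \<in> ?A" for i
    using that by (rule bspec)
  have "m i \<in> elder_bars x n" if i: "i \<in> ?A" for i
  proof -
    have mi: "m i \<in> {1..n}" "m i \<le> i" "peak x (m i) i \<le> t" using m[OF i] by auto
    have xm: "x (m i) \<le> t" using le_peak[of x "m i" i] mi by linarith
    have "t < peak x (m i) w" if w: "w \<in> elders x n (m i)" for w
    proof (rule ccontr)
      assume "\<not> t < peak x (m i) w"
      then have pw: "\<forall>k\<in>{min (m i) w..max (m i) w}. x k \<le> t" by (simp add: not_less peak_le_iff)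
      have "w \<le> i"
      proof (rule ccontr)
        assume "\<not> w \<le> i"
        then have "x (Suc i) \<le> t" using pw mi by auto
        with i show False by simp
      qed
      moreover have "peak x w i \<le> t"
        unfolding peak_le_iff
      proof
        fix k assume "k \<in> {min w i..max w i}"
        then have "k \<in> {min (m i) w..max (m i) w} \<or> k \<in> {min (m i) i..max (m i) i}"
          using \<open>w \<le> i\<close> mi by (auto simp: min_def max_def)
        then show "x k \<le> t" using pw mi(3) unfolding peak_le_iff by blast
      qed
      ultimately have "w \<in> ?R i" using w by (simp add: elders_def)
      moreover have "older x w (m i)" using w by (simp add: elders_def)
      ultimately show False using m[OF i] older_trans[of x w "m i" w] by (cases "w = m i") auto
    qed
    then have "ereal (x (m i)) < death x n (m i)"
    proof (cases "elders x n (m i) = {}")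
      case False
      from \<open>\<And>w. w \<in> elders x n (m i) \<Longrightarrow> t < peak x (m i) w\<close>[OF parent_elders[OF False]]
      show ?thesis using xm False by (simp add: death_def)
    qed (simp add: death_def)
    then show ?thesis using mi by (simp add: elder_bars_def)
  qed
  moreover have "inj_on m ?A"
  proof (rule linorder_inj_onI)
    fix i j assume ij: "i < j" "i \<in> ?A" "j \<in> ?A"
    show "m i \<noteq> m j"
    proof
      assume eq: "m i = m j"
      then have "Suc i \<in> {min (m j) j..max (m j) j}" "peak x (m j) j \<le> t"
        using m[OF ij(2)] m[OF ij(3)] ij(1) by auto
      then have "x (Suc i) \<le> t" unfolding peak_le_iff by blast
      with ij(2) show False by simp
    qed
  qed auto
  ultimately have "card ?A \<le> card (elder_bars x n)"
    by (intro card_inj_on_le[of m]) auto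
  also have "elder_bars x n = finite_elder_bars x n \<union> {v \<in> elder_bars x n. elders x n v = {}}"
    by (auto simp: finite_elder_bars_def)
  also have "card \<dots> \<le> card (finite_elder_bars x n) + card {v \<in> elder_bars x n. elders x n v = {}}"
    by (rule card_Un_le)
  also have "card {v \<in> elder_bars x n. elders x n v = {}} \<le> 1"
  proof (subst card_le_Suc0_iff_eq[folded One_nat_def])
    show "\<forall>v\<in>{v \<in> elder_bars x n. elders x n v = {}}. \<forall>w\<in>{v \<in> elder_bars x n. elders x n v = {}}. v = w"
    proof (intro ballI)
      fix v w assume vw: "v \<in> {v \<in> elder_bars x n. elders x n v = {}}" "w \<in> {v \<in> elder_bars x n. elders x n v = {}}"
      then have "v \<notin> elders x n w" "w \<notin> elders x n v" by auto
      then show "v = w" using vw older_linear[of v w x] by (auto simp: elders_def elder_bars_def)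
    qed
  qed simp
  finally show ?thesis by (simp add: size_finite_bars)
qed

section \<open>Averages over diagrams of unbounded functions\<close>

lemma sum_mset_indicator_singleton:
  "(\<Sum>p\<in>#B. indicator {q} p :: ennreal) = of_nat (count B q)"
  by (induction B) (auto simp: indicator_def)

lemma sum_mset_conv_sum_count:
  fixes f :: "'p \<Rightarrow> real"
  shows "(\<Sum>p\<in>#B. f p) = (\<Sum>q\<in>set_mset B. f q * real (count B q))"
proof (induction B)
  case (add x B)
  show ?case
  proof (cases "x \<in># B")
    case True
    then have "set_mset (add_mset x B) = set_mset B" by auto
    then show ?thesis
      using True add
      by (auto simp: sum.remove[of "set_mset B" x] algebra_simps intro!: sum.cong split: if_splits)
  next
    case False
    then have "(\<Sum>q\<in>set_mset B. f q * real (count (add_mset x B) q)) = (\<Sum>q\<in>set_mset B. f q * real (count B q))"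
      by (intro sum.cong) auto
    then show ?thesis using False add by (simp add: count_eq_zero_iff[THEN iffD2])
  qed
qed auto

text \<open>
  For the empty multiset the normalised measure is \<open>\<infinity> \<cdot> 0 = 0\<close>, in agreement with division by zero
  on the right-hand sides.
\<close>

lemma
  fixes N :: "'p measure" and f :: "'p \<Rightarrow> real"
  assumes em: "\<And>A. A \<in> sets N \<Longrightarrow> emeasure N A = (\<Sum>p\<in>#B. indicator A p)"
    and B: "set_mset B \<subseteq> space N"
  shows emeasure_space_counting: "emeasure N (space N) = of_nat (size B)"
    and finite_measure_normalize_counting: "finite_measure (normalize_measure N)"
    and measure_normalize_counting:
      "A \<in> sets N \<Longrightarrow> measure (normalize_measure N) A = measure N A / size B"
    and integral_normalize_counting:
      "\<lbrakk>\<And>p. p \<in> space N \<Longrightarrow> {p} \<in> sets N; f \<in> borel_measurable N\<rbrakk> \<Longrightarrow>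
       (\<integral>p. f p \<partial>normalize_measure N) = (\<Sum>p\<in>#B. f p) / size B"
proof -
  let ?N = "normalize_measure N"
  have "(\<Sum>p\<in>#B. indicator (space N) p :: ennreal) = (\<Sum>p\<in>#B. 1)"
    using B by (intro arg_cong[where f = sum_mset] image_mset_cong) (auto simp: indicator_def)
  then show tot: "emeasure N (space N) = of_nat (size B)"
    by (simp add: em)
  have "inverse (of_nat m) * of_nat m = (1 :: ennreal)" if "m > 0" for m :: nat
    using that ennreal_divide_self[of "of_nat m"]
    by (simp add: divide_ennreal_def mult.commute of_nat_less_top)
  then have tot': "emeasure ?N (space ?N) \<le> 1"
    unfolding normalize_measure_def tot
    by (cases "size B = 0") (auto simp: space_scale_measure tot nonempty_has_size)
  then show fin: "finite_measure ?N"
    by (intro finite_measureI) (auto simp: top_unique)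
  show m: "measure ?N A = measure N A / size B" if "A \<in> sets N" for A
  proof (cases "size B = 0")
    case False
    then have s: "real (size B) > 0" by (simp add: nonempty_has_size)
    then show ?thesis
      unfolding normalize_measure_def tot
      by (simp add: ennreal_of_nat_eq_real_of_nat inverse_ennreal[OF s] measure_def enn2real_mult divide_simps)
  next
    case True
    then show ?thesis using that
      by (simp add: normalize_measure_def measure_def em)
  qed
  assume pts: "\<And>p. p \<in> space N \<Longrightarrow> {p} \<in> sets N" and f [measurable]: "f \<in> borel_measurable N"
  have sB: "set_mset B \<in> sets N"
    using sets.countable[of "set_mset B" N] pts B by (auto simp: countable_finite)
  have "emeasure N (space N - set_mset B) = 0"
    using sB by (subst em) (auto simp: indicator_def sum_mset_0_iff)
  then have "emeasure ?N (space N - set_mset B) = 0"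
    by (simp add: normalize_measure_def)
  then have "AE p in ?N. p \<in> set_mset B"
    using sB by (subst AE_iff_measurable[where N = "space N - set_mset B"])
      (auto simp: normalize_measure_def space_scale_measure)
  then have "AE p in ?N. f p = (\<Sum>q\<in>set_mset B. indicator {q} p * f q)"
  proof eventually_elim
    case (elim p)
    then show ?case by (simp add: indicator_def sum.delta' if_distrib cong: if_cong)
  qed
  moreover have "f \<in> borel_measurable ?N"
    by (simp add: normalize_measure_def)
  moreover have "(\<lambda>p. \<Sum>q\<in>set_mset B. indicator {q} p * f q) \<in> borel_measurable ?N"
    using pts B
    by (intro borel_measurable_sum borel_measurable_times borel_measurable_indicator)
       (auto simp: normalize_measure_def)
  ultimately have "(\<integral>p. f p \<partial>?N) = (\<integral>p. (\<Sum>q\<in>set_mset B. indicator {q} p * f q) \<partial>?N)"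
    by (intro integral_cong_AE)
  also have "\<dots> = (\<Sum>q\<in>set_mset B. measure ?N {q} * f q)"
  proof (subst Bochner_Integration.integral_sum)
    interpret finite_measure ?N by (rule fin)
    have q: "{q} \<in> sets ?N" if "q \<in># B" for q
      using pts B that by (auto simp: normalize_measure_def)
    show "integrable ?N (\<lambda>p. indicator {q} p * f q)" if "q \<in># B" for q
      using q[OF that] by (intro integrable_mult_left integrable_real_indicator) (auto simp: emeasure_eq_measure)
    show "(\<Sum>i\<in>set_mset B. \<integral>x. indicator {i} x * f i \<partial>?N) = (\<Sum>q\<in>set_mset B. measure ?N {q} * f q)"
      using q by (intro sum.cong) auto
  qed
  also have "\<dots> = (\<Sum>q\<in>set_mset B. f q * real (count B q)) / size B"
    unfolding sum_divide_distrib
  proof (intro sum.cong refl)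
    fix q assume "q \<in># B"
    then have "{q} \<in> sets N" using pts B by auto
    then show "measure ?N {q} * f q = f q * real (count B q) / real (size B)"
      using m[of "{q}"] by (simp add: measure_def em sum_mset_indicator_singleton)
  qed
  finally show "(\<integral>p. f p \<partial>?N) = (\<Sum>p\<in>#B. f p) / size B"
    by (simp add: sum_mset_conv_sum_count)
qed

text \<open>
  Truncating \<open>f\<close> at height \<open>K\<close> yields a bounded continuous function, to which the assumed convergence
  applies. The truncation changes the averages by at most \<open>C / K powr \<epsilon>\<close> and the integral by an amount
  that tends to \<open>0\<close> as \<open>K\<close> grows.
\<close>

lemma averages_tendsto_integral:
  fixes f :: "'p::topological_space \<Rightarrow> real" and B :: "nat \<Rightarrow> 'p multiset"
  assumes \<mu>: "space \<mu> = S" "sets \<mu> = sets (restrict_space borel S)" "finite_measure \<mu>"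
    and conv: "\<And>h :: 'p \<Rightarrow> real. continuous_on S h \<Longrightarrow> bounded (h ` S) \<Longrightarrow>
        (\<lambda>n. (\<Sum>p\<in>#B n. h p) / size (B n)) \<longlonglongrightarrow> (\<integral>p. h p \<partial>\<mu>)"
    and BS: "\<And>n. set_mset (B n) \<subseteq> S"
    and f: "continuous_on S f" "\<And>p. p \<in> S \<Longrightarrow> f p \<ge> 0" "integrable \<mu> f"
    and \<epsilon>: "\<epsilon> > 0"
    and bd: "eventually (\<lambda>n. (\<Sum>p\<in>#B n. f p powr (1 + \<epsilon>)) / size (B n) \<le> C) sequentially"
  shows "(\<lambda>n. (\<Sum>p\<in>#B n. f p) / size (B n)) \<longlonglongrightarrow> (\<integral>p. f p \<partial>\<mu>)"
proof (rule tendstoI)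
  fix r :: real assume r: "r > 0"
  let ?avg = "\<lambda>n h. (\<Sum>p\<in>#B n. h p) / real (size (B n)) :: real"
  let ?t = "\<lambda>K p. min (f p) (real K)"
  have meas: "?t K \<in> borel_measurable \<mu>" for K using f(3) by auto
  have lim: "(\<lambda>K. \<integral>p. ?t K p \<partial>\<mu>) \<longlonglongrightarrow> (\<integral>p. f p \<partial>\<mu>)"
  proof (rule integral_dominated_convergence[where w = f])
    have "(\<lambda>K. ?t K p) \<longlonglongrightarrow> f p" for p
    proof -
      obtain K0 :: nat where K0: "f p \<le> real K0" using real_arch_simple by blast
      have "?t K p = f p" if "K \<ge> K0" for K
        using K0 that by (simp add: min_def)
      then show ?thesis
        by (intro tendsto_eventually) (auto simp: eventually_sequentially)
    qed
    then show "AE p in \<mu>. (\<lambda>K. ?t K p) \<longlonglongrightarrow> f p" by simp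
    show "AE p in \<mu>. norm (?t K p) \<le> f p" for K
      using f(2) by (intro AE_I2) (auto simp: \<mu>(1) min_def)
  qed (use f meas in auto)
  have "(\<lambda>K. \<bar>C\<bar> / real K powr \<epsilon>) \<longlonglongrightarrow> 0"
    using \<epsilon> by real_asymp
  then have "eventually (\<lambda>K. \<bar>C\<bar> / real K powr \<epsilon> < r / 3) sequentially"
    using r by (intro order_tendstoD) auto
  moreover have "eventually (\<lambda>K. dist (\<integral>p. ?t K p \<partial>\<mu>) (\<integral>p. f p \<partial>\<mu>) < r / 3) sequentially"
    using lim r by (intro tendstoD) auto
  ultimately have "eventually (\<lambda>K. \<bar>C\<bar> / real K powr \<epsilon> < r / 3 \<and>
      dist (\<integral>p. ?t K p \<partial>\<mu>) (\<integral>p. f p \<partial>\<mu>) < r / 3 \<and> K > 0) sequentially"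
    by (intro eventually_conj eventually_gt_at_top)
  then obtain K where K: "\<bar>C\<bar> / real K powr \<epsilon> < r / 3"
      "dist (\<integral>p. ?t K p \<partial>\<mu>) (\<integral>p. f p \<partial>\<mu>) < r / 3" "K > 0"
    by (metis (mono_tags, lifting) eventually_sequentially order_refl)
  have "continuous_on S (?t K)" using f(1) by (intro continuous_intros)
  moreover have "bounded (?t K ` S)"
    by (rule boundedI[where B = "real K"]) (use f(2) in \<open>auto simp: min_def\<close>)
  ultimately have "(\<lambda>n. ?avg n (?t K)) \<longlonglongrightarrow> (\<integral>p. ?t K p \<partial>\<mu>)" by (rule conv)
  then have "eventually (\<lambda>n. dist (?avg n (?t K)) (\<integral>p. ?t K p \<partial>\<mu>) < r / 3) sequentially"
    using r by (intro tendstoD) auto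
  with bd show "eventually (\<lambda>n. dist (?avg n f) (\<integral>p. f p \<partial>\<mu>) < r) sequentially"
  proof eventually_elim
    case (elim n)
    \<comment> \<open>Where \<open>f > K\<close>, the excess \<open>f - K\<close> is at most \<open>f (f / K) powr \<epsilon>\<close>.\<close>
    have tail: "f p - ?t K p \<le> f p powr (1 + \<epsilon>) / real K powr \<epsilon>" if "p \<in> S" for p
    proof (cases "f p \<le> real K")
      case True
      then show ?thesis by simp
    next
      case False
      then have "1 \<le> (f p / real K) powr \<epsilon>"
        using K \<epsilon> by (intro ge_one_powr_ge_zero) auto
      then have "f p * 1 \<le> f p * (f p / real K) powr \<epsilon>"
        using False by (intro mult_left_mono) auto
      also have "\<dots> = f p powr (1 + \<epsilon>) / real K powr \<epsilon>"
        using False K by (simp add: powr_add powr_divide)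
      finally show ?thesis using False by simp
    qed
    have low: "0 \<le> (\<Sum>p\<in>#B n. f p - ?t K p)"
      using sum_mset_mono[of "B n" "\<lambda>_. 0" "\<lambda>p. f p - ?t K p"] by simp
    have "(\<Sum>p\<in>#B n. f p - ?t K p) \<le> (\<Sum>p\<in>#B n. f p powr (1 + \<epsilon>) / real K powr \<epsilon>)"
      by (intro sum_mset_mono tail) (use BS in auto)
    also have "\<dots> = (\<Sum>p\<in>#B n. f p powr (1 + \<epsilon>)) / real K powr \<epsilon>"
      by (simp add: divide_inverse sum_mset_distrib_right)
    finally have "(\<Sum>p\<in>#B n. f p - ?t K p) / size (B n) \<le>
        ((\<Sum>p\<in>#B n. f p powr (1 + \<epsilon>)) / real K powr \<epsilon>) / size (B n)"
      by (intro divide_right_mono) auto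
    also have "\<dots> = ((\<Sum>p\<in>#B n. f p powr (1 + \<epsilon>)) / size (B n)) / real K powr \<epsilon>"
      by simp
    also have "\<dots> \<le> \<bar>C\<bar> / real K powr \<epsilon>"
      using elim by (intro divide_right_mono) auto
    also have "\<dots> < r / 3" by (rule K)
    finally have up: "(\<Sum>p\<in>#B n. f p - ?t K p) / size (B n) < r / 3" .
    have "(\<Sum>p\<in>#B n. f p) = (\<Sum>p\<in>#B n. (f p - ?t K p) + ?t K p)" by simp
    also have "\<dots> = (\<Sum>p\<in>#B n. f p - ?t K p) + (\<Sum>p\<in>#B n. ?t K p)"
      by (rule sum_mset.distrib)
    finally have "?avg n f = (\<Sum>p\<in>#B n. f p - ?t K p) / size (B n) + ?avg n (?t K)"
      by (simp add: add_divide_distrib)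
    moreover have "0 \<le> (\<Sum>p\<in>#B n. f p - ?t K p) / size (B n)" using low by simp
    ultimately show ?case using up elim K(2) unfolding dist_real_def by linarith
  qed
qed

section \<open>The truncated ALPS statistic\<close>

lemma continuous_on_bar_length: "continuous_on Delta (\<lambda>p. snd p - fst p :: ereal)"
  unfolding continuous_on_def
proof
  fix p assume p: "p \<in> Delta"
  have 1: "(snd \<longlongrightarrow> snd p) (at p within Delta)" "(fst \<longlongrightarrow> fst p) (at p within Delta)"
    by (auto intro!: tendsto_eq_intros)
  show "((\<lambda>q. snd q - fst q) \<longlongrightarrow> snd p - fst p) (at p within Delta)"
    using p by (intro tendsto_diff_ereal_general 1) (auto simp: Delta_def)
qed

lemma Delta_len_eq: "Delta_len l = {p \<in> Delta. ereal l < snd p - fst p}"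
  by (auto simp: Delta_len_def)

lemma borel_measurable_bar_length:
  "(\<lambda>p. snd p - fst p :: ereal) \<in> borel_measurable (restrict_space borel Delta)"
  by (rule borel_measurable_continuous_on_restrict[OF continuous_on_bar_length])

lemma Delta_len_sets: "Delta_len l \<in> sets (restrict_space borel Delta)"
proof -
  have "{p \<in> space (restrict_space borel Delta). ereal l < snd p - fst p} \<in> sets (restrict_space borel Delta)"
    using borel_measurable_bar_length by measurable
  then show ?thesis by (simp add: Delta_len_eq space_restrict_space)
qed

lemma Delta_sets: "Delta \<in> sets (restrict_space borel Delta)"
  using sets.top[of "restrict_space borel Delta"] by (simp add: space_restrict_space)

text \<open>
  A continuous function between the indicators of \<open>Delta_len (l + \<delta>)\<close> and \<open>Delta_len l\<close>. The length is
  first clipped to \<open>[0, \<bar>l\<bar> + \<delta>]\<close>, because infinite bars have infinite length.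
\<close>

definition length_bump :: "real \<Rightarrow> real \<Rightarrow> ereal \<times> ereal \<Rightarrow> real" where
  "length_bump l \<delta> p =
     max 0 (min 1 ((real_of_ereal (min (max (snd p - fst p) 0) (ereal (\<bar>l\<bar> + \<delta>))) - l) / \<delta>))"

lemma continuous_on_length_bump: "continuous_on Delta (length_bump l \<delta>)"
proof -
  have c: "continuous_on Delta (\<lambda>p. min (max (snd p - fst p) 0) (ereal (\<bar>l\<bar> + \<delta>)))"
    by (intro continuous_intros continuous_on_bar_length)
  have "continuous_on Delta (\<lambda>p. real_of_ereal (min (max (snd p - fst p) 0) (ereal (\<bar>l\<bar> + \<delta>))))"
    by (rule continuous_on_compose2[OF continuous_on_real c])
       (auto simp: min_def max_def)
  then show ?thesis unfolding length_bump_def divide_inverse by (intro continuous_intros)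
qed

lemma length_bump_bounds: "0 \<le> length_bump l \<delta> p" "length_bump l \<delta> p \<le> 1"
  by (auto simp: length_bump_def)

lemma length_bump_indicator:
  assumes p: "p \<in> Delta" and \<delta>: "\<delta> > 0"
  shows "indicator (Delta_len (l + \<delta>)) p \<le> length_bump l \<delta> p"
    and "length_bump l \<delta> p \<le> indicator (Delta_len l) p"
proof -
  have "0 < snd p - fst p" using p by (auto simp: Delta_def ereal_less_minus_iff)
  then consider "snd p - fst p = \<infinity>" | d where "snd p - fst p = ereal d" "d > 0"
    by (cases "snd p - fst p") auto
  then have "(p \<in> Delta_len (l + \<delta>) \<longrightarrow> length_bump l \<delta> p = 1) \<and> (p \<notin> Delta_len l \<longrightarrow> length_bump l \<delta> p = 0)"
  proof cases
    case 1
    then have "length_bump l \<delta> p = max 0 (min 1 ((\<bar>l\<bar> + \<delta> - l) / \<delta>))"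
      by (simp add: length_bump_def)
    moreover have "(\<bar>l\<bar> + \<delta> - l) / \<delta> \<ge> 1" using \<delta> by (simp add: field_simps)
    ultimately show ?thesis using 1 p by (simp add: Delta_len_eq)
  next
    case (2 d)
    then have "length_bump l \<delta> p = max 0 (min 1 ((min d (\<bar>l\<bar> + \<delta>) - l) / \<delta>))"
      by (simp add: length_bump_def max_absorb1) (simp add: min_def)
    moreover have "(min d (\<bar>l\<bar> + \<delta>) - l) / \<delta> \<ge> 1" if "d > l + \<delta>"
      using \<delta> that abs_ge_self[of l] by (simp add: min_def)
    moreover have "(min d (\<bar>l\<bar> + \<delta>) - l) / \<delta> \<le> 0" if "d \<le> l"
      using \<delta> that by (simp add: divide_le_0_iff min_le_iff_disj)
    ultimately show ?thesis using 2 p by (auto simp: Delta_len_eq)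
  qed
  then show "indicator (Delta_len (l + \<delta>)) p \<le> length_bump l \<delta> p"
    and "length_bump l \<delta> p \<le> indicator (Delta_len l) p"
    using length_bump_bounds[of l \<delta> p] by (auto simp: indicator_def)
qed

lemma
  assumes N: "finite_measure N" "sets N = sets (restrict_space borel Delta)" and \<delta>: "\<delta> > 0"
  shows measure_le_integral_length_bump: "measure N (Delta_len (l + \<delta>)) \<le> (\<integral>p. length_bump l \<delta> p \<partial>N)"
    and integral_length_bump_le_measure: "(\<integral>p. length_bump l \<delta> p \<partial>N) \<le> measure N (Delta_len l)"
proof -
  interpret finite_measure N by fact
  have sp: "space N = Delta"
    using sets_eq_imp_space_eq[OF N(2)] by (simp add: space_restrict_space)
  have m: "length_bump l \<delta> \<in> borel_measurable N"
    using borel_measurable_continuous_on_restrict[OF continuous_on_length_bump] measurable_cong_sets[OF N(2) refl] by blast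
  have ib: "integrable N (length_bump l \<delta>)"
    using length_bump_bounds by (intro integrable_const_bound[where B = 1] m) (auto simp: abs_le_iff intro: order_trans[of _ 0])
  have D: "Delta_len l \<in> sets N" for l using Delta_len_sets N(2) by simp
  have ii: "integrable N (indicator (Delta_len l) :: _ \<Rightarrow> real)" for l
    using D by (intro integrable_real_indicator) (auto simp: emeasure_eq_measure)
  have "Delta_len l \<inter> space N = Delta_len l" for l by (auto simp: sp Delta_len_eq)
  then have me: "measure N (Delta_len l) = (\<integral>p. indicator (Delta_len l) p \<partial>N)" for l by simp
  show "measure N (Delta_len (l + \<delta>)) \<le> (\<integral>p. length_bump l \<delta> p \<partial>N)"
    "(\<integral>p. length_bump l \<delta> p \<partial>N) \<le> measure N (Delta_len l)"
    unfolding me using length_bump_indicator[OF _ \<delta>] sp by (intro integral_mono ib ii; simp)+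
qed

lemma Delta_len_antimono: "l \<le> l' \<Longrightarrow> Delta_len l' \<subseteq> Delta_len l"
  unfolding Delta_len_eq using le_less_trans[of "ereal l" "ereal l'"] by auto

lemma measure_Delta_len_antimono:
  assumes "finite_measure N" "sets N = sets (restrict_space borel Delta)" "l \<le> l'"
  shows "measure N (Delta_len l') \<le> measure N (Delta_len l)"
  using assms Delta_len_sets Delta_len_antimono by (intro finite_measure.finite_measure_mono) auto

lemma borel_measurable_measure_Delta_len:
  assumes "finite_measure N" "sets N = sets (restrict_space borel Delta)"
  shows "(\<lambda>l. measure N (Delta_len l)) \<in> borel_measurable borel"
proof -
  have "mono (\<lambda>l. - measure N (Delta_len l))"
    using measure_Delta_len_antimono[OF assms] by (intro monoI) simp
  from borel_measurable_uminus[OF borel_measurable_mono[OF this]] show ?thesis by simp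
qed

text \<open>
  The measure of \<open>Delta_len l\<close> lies between the integrals of the cut-offs at \<open>l\<close> and at \<open>l - \<delta>\<close>. In the
  limit these lie between the values at \<open>l + \<delta>\<close> and \<open>l - \<delta>\<close>, which are close at a continuity point.
\<close>

lemma weak_conv_imp_tendsto_measure_Delta_len:
  assumes N: "\<And>n. finite_measure (N n)" "\<And>n. sets (N n) = sets (restrict_space borel Delta)"
    and \<mu>: "finite_measure \<mu>" "sets \<mu> = sets (restrict_space borel Delta)"
    and conv: "weak_conv_on Delta N \<mu>"
    and cont: "isCont (\<lambda>l. measure \<mu> (Delta_len l)) l"
  shows "(\<lambda>n. measure (N n) (Delta_len l)) \<longlonglongrightarrow> measure \<mu> (Delta_len l)"
proof (rule order_tendstoI)
  let ?r = "\<lambda>l. measure \<mu> (Delta_len l)"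
  have bump: "(\<lambda>n. \<integral>p. length_bump l \<delta> p \<partial>N n) \<longlonglongrightarrow> (\<integral>p. length_bump l \<delta> p \<partial>\<mu>)" for l \<delta>
  proof -
    have "bounded (length_bump l \<delta> ` Delta)"
      by (rule boundedI[where B = 1]) (use length_bump_bounds in auto)
    then show ?thesis
      using conv continuous_on_length_bump unfolding weak_conv_on_def by blast
  qed
  have near: "\<exists>\<delta>>0. dist (?r (l + \<delta>)) (?r l) < e \<and> dist (?r (l - \<delta>)) (?r l) < e" if e: "e > 0" for e
  proof -
    obtain d where d: "d > 0" "\<And>x. dist x l < d \<Longrightarrow> dist (?r x) (?r l) < e"
      using cont e unfolding continuous_at_eps_delta by metis
    then show ?thesis by (intro exI[of _ "d / 2"]) (auto simp: dist_real_def)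
  qed
  fix a
  show "eventually (\<lambda>n. a < measure (N n) (Delta_len l)) sequentially" if a: "a < ?r l"
  proof -
    obtain \<delta> where \<delta>: "\<delta> > 0" "dist (?r (l + \<delta>)) (?r l) < ?r l - a" using near[of "?r l - a"] a by auto
    then have "a < (\<integral>p. length_bump l \<delta> p \<partial>\<mu>)"
      using measure_le_integral_length_bump[OF \<mu> \<delta>(1), of l] by (simp add: dist_real_def)
    from order_tendstoD(1)[OF bump this] show ?thesis
    proof eventually_elim
      case (elim n)
      then show ?case using integral_length_bump_le_measure[OF N \<delta>(1), of n l] by simp
    qed
  qed
  show "eventually (\<lambda>n. measure (N n) (Delta_len l) < a) sequentially" if a: "?r l < a"
  proof -
    obtain \<delta> where \<delta>: "\<delta> > 0" "dist (?r (l - \<delta>)) (?r l) < a - ?r l" using near[of "a - ?r l"] a by auto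
    then have "(\<integral>p. length_bump (l - \<delta>) \<delta> p \<partial>\<mu>) < a"
      using integral_length_bump_le_measure[OF \<mu> \<delta>(1), of "l - \<delta>"] by (simp add: dist_real_def)
    from order_tendstoD(2)[OF bump this] show ?thesis
    proof eventually_elim
      case (elim n)
      then show ?case using measure_le_integral_length_bump[OF N \<delta>(1), of n "l - \<delta>"] by simp
    qed
  qed
qed

text \<open>
  The point \<open>L\<close> need not be a continuity point. But the limit is continuous from the right, so it is
  still positive at some \<open>L + \<delta>\<close>, and the cut-off at \<open>L\<close> transfers this to the measures \<open>N n\<close>.
\<close>

lemma weak_conv_imp_eventually_measure_Delta_len_bounded_below:
  assumes N: "\<And>n. finite_measure (N n)" "\<And>n. sets (N n) = sets (restrict_space borel Delta)"
    and \<mu>: "finite_measure \<mu>" "sets \<mu> = sets (restrict_space borel Delta)"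
    and conv: "weak_conv_on Delta N \<mu>" and pos: "measure \<mu> (Delta_len L) > 0"
  obtains c where "c > 0" "eventually (\<lambda>n. c < measure (N n) (Delta_len L)) sequentially"
proof -
  interpret finite_measure \<mu> by fact
  have "(\<lambda>k. measure \<mu> (Delta_len (L + 1 / real (Suc k)))) \<longlonglongrightarrow> measure \<mu> (\<Union>k. Delta_len (L + 1 / real (Suc k)))"
    using Delta_len_sets \<mu>(2)
    by (intro finite_Lim_measure_incseq) (auto intro!: incseq_SucI Delta_len_antimono simp: field_simps)
  also have "(\<Union>k. Delta_len (L + 1 / real (Suc k))) = Delta_len L"
  proof (intro equalityI subsetI)
    fix p assume "p \<in> Delta_len L"
    then have p: "p \<in> Delta" "ereal L < snd p - fst p" by (auto simp: Delta_len_eq)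
    then obtain z where z: "ereal L < ereal z" "ereal z < snd p - fst p"
      using ereal_dense2 by blast
    obtain k where "1 / real (Suc k) < z - L"
      using z reals_Archimedean[of "z - L"] by (auto simp: inverse_eq_divide)
    then have "ereal (L + 1 / real (Suc k)) < snd p - fst p"
      using z(2) by (intro less_trans[OF _ z(2)]) auto
    then show "p \<in> (\<Union>k. Delta_len (L + 1 / real (Suc k)))" using p by (auto simp: Delta_len_eq)
  next
    fix p assume "p \<in> (\<Union>k. Delta_len (L + 1 / real (Suc k)))"
    then obtain k where "p \<in> Delta_len (L + 1 / real (Suc k))" by blast
    moreover have "L \<le> L + 1 / real (Suc k)" by simp
    ultimately show "p \<in> Delta_len L" using Delta_len_antimono by blast
  qed
  finally have "eventually (\<lambda>k. 0 < measure \<mu> (Delta_len (L + 1 / real (Suc k)))) sequentially"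
    using pos by (rule order_tendstoD)
  then obtain k where k: "0 < measure \<mu> (Delta_len (L + 1 / real (Suc k)))"
    by (auto simp: eventually_sequentially)
  define \<delta> where "\<delta> = 1 / real (Suc k)"
  have \<delta>: "\<delta> > 0" by (simp add: \<delta>_def)
  define c where "c = measure \<mu> (Delta_len (L + \<delta>)) / 2"
  have c: "c > 0" using k by (simp add: c_def \<delta>_def)
  then have "c < (\<integral>p. length_bump L \<delta> p \<partial>\<mu>)"
    using measure_le_integral_length_bump[OF \<mu> \<delta>, of L] by (simp add: c_def)
  moreover have "bounded (length_bump L \<delta> ` Delta)"
    by (rule boundedI[where B = 1]) (use length_bump_bounds in auto)
  then have "(\<lambda>n. \<integral>p. length_bump L \<delta> p \<partial>N n) \<longlonglongrightarrow> (\<integral>p. length_bump L \<delta> p \<partial>\<mu>)"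
    using conv continuous_on_length_bump unfolding weak_conv_on_def by blast
  ultimately have "eventually (\<lambda>n. c < (\<integral>p. length_bump L \<delta> p \<partial>N n)) sequentially"
    by (intro order_tendstoD(1))
  then have "eventually (\<lambda>n. c < measure (N n) (Delta_len L)) sequentially"
  proof eventually_elim
    case (elim n)
    then show ?case using integral_length_bump_le_measure[OF N \<delta>, of n L] by simp
  qed
  with c show thesis by (rule that)
qed

lemma tendsto_integral_ln_measure_Delta_len:
  assumes N: "\<And>n. finite_measure (N n)" "\<And>n. sets (N n) = sets (restrict_space borel Delta)"
      "\<And>n. measure (N n) Delta \<le> 1"
    and \<mu>: "prob_space \<mu>" "sets \<mu> = sets (restrict_space borel Delta)"
    and conv: "weak_conv_on Delta N \<mu>" and pos: "measure \<mu> (Delta_len L) > 0"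
  obtains n0 where "\<And>n. n \<ge> n0 \<Longrightarrow> measure (N n) (Delta_len L) > 0"
    "\<And>n. n \<ge> n0 \<Longrightarrow> set_integrable lborel {0..L} (\<lambda>l. ln (measure (N n) (Delta_len l)))"
    "(\<lambda>n. LBINT l:{0..L}. ln (measure (N n) (Delta_len l)))
       \<longlonglongrightarrow> (LBINT l:{0..L}. ln (measure \<mu> (Delta_len l)))"
proof -
  interpret \<mu>: prob_space \<mu> by fact
  have \<mu>f: "finite_measure \<mu>" by unfold_locales
  let ?r = "\<lambda>n l. measure (N n) (Delta_len l)" and ?s = "\<lambda>l. measure \<mu> (Delta_len l)"
  \<comment> \<open>By monotonicity, a lower bound at \<open>L\<close> is one on \<open>[0, L]\<close>, and bounds the logarithms.\<close>
  obtain c where c: "c > 0" "eventually (\<lambda>n. c < ?r n L) sequentially"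
    by (rule weak_conv_imp_eventually_measure_Delta_len_bounded_below[OF N(1,2) \<mu>f \<mu>(2) conv pos])
  then obtain n0 where n0: "c < ?r n L" if "n \<ge> n0" for n by (auto simp: eventually_sequentially)
  have b: "\<bar>ln (?r n l)\<bar> \<le> \<bar>ln c\<bar>" if n: "n \<ge> n0" and l: "l \<in> {0..L}" for n l
  proof -
    have 1: "c \<le> ?r n l"
      using n0[OF n] measure_Delta_len_antimono[OF N(1,2), of l L n] l by auto
    have "?r n l \<le> measure (N n) Delta"
      using Delta_sets N(2) by (intro finite_measure.finite_measure_mono N(1)) (auto simp: Delta_len_eq)
    then have 2: "?r n l \<le> 1" using N(3)[of n] by simp
    have "ln c \<le> ln (?r n l)" "ln (?r n l) \<le> 0" using 1 2 c(1) by auto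
    then show ?thesis by simp
  qed
  have meas: "(\<lambda>l. ln (?r n l)) \<in> borel_measurable lborel" for n
    using borel_measurable_measure_Delta_len[OF N(1,2)] by simp
  have smeas: "(\<lambda>l. ln (?s l)) \<in> borel_measurable lborel"
    using borel_measurable_measure_Delta_len[OF \<mu>f \<mu>(2)] by simp
  have dom: "integrable lborel (\<lambda>l. indicator {0..L} l * \<bar>ln c\<bar>)"
    by (intro integrable_mult_left integrable_real_indicator) (auto simp: emeasure_lborel_Icc_eq)
  have intg: "set_integrable lborel {0..L} (\<lambda>l. ln (?r n l))" if "n \<ge> n0" for n
    unfolding set_integrable_def
    by (rule Bochner_Integration.integrable_bound[OF dom])
       (use meas[of n] b[OF that] in \<open>auto simp: indicator_def\<close>)
  have mono: "mono (\<lambda>l. - ?s l)"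
    using measure_Delta_len_antimono[OF \<mu>f \<mu>(2)] by (intro monoI) simp
  have "countable {l. \<not> isCont ?s l}"
  proof (rule countable_subset[OF _ mono_ctble_discont[OF mono]])
    show "{l. \<not> isCont ?s l} \<subseteq> {l. \<not> isCont (\<lambda>l. - ?s l) l}"
      using continuous_minus[of _ "\<lambda>l. - ?s l"] by auto
  qed
  then have "{l. \<not> isCont ?s l} \<in> null_sets lborel"
    by (rule countable_imp_null_set_lborel)
  from AE_not_in[OF this] have AEc: "AE l in lborel. isCont ?s l" by simp
  have "(\<lambda>n. \<integral>l. indicator {0..L} l *\<^sub>R ln (?r (n + n0) l) \<partial>lborel)
      \<longlonglongrightarrow> (\<integral>l. indicator {0..L} l *\<^sub>R ln (?s l) \<partial>lborel)"
  proof (rule integral_dominated_convergence[OF _ _ dom])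
    show "AE l in lborel. (\<lambda>n. indicator {0..L} l *\<^sub>R ln (?r (n + n0) l)) \<longlonglongrightarrow> indicator {0..L} l *\<^sub>R ln (?s l)"
      using AEc
    proof eventually_elim
      case (elim l)
      show ?case
      proof (cases "l \<in> {0..L}")
        case True
        then have "?s l > 0" using pos measure_Delta_len_antimono[OF \<mu>f \<mu>(2), of l L] by auto
        moreover have "(\<lambda>n. ?r (n + n0) l) \<longlonglongrightarrow> ?s l"
          using weak_conv_imp_tendsto_measure_Delta_len[OF N(1,2) \<mu>f \<mu>(2) conv elim]
          by (rule LIMSEQ_ignore_initial_segment)
        ultimately show ?thesis by (intro tendsto_intros) auto
      qed simp
    qed
    show "AE l in lborel. norm (indicator {0..L} l *\<^sub>R ln (?r (n + n0) l)) \<le> indicator {0..L} l * \<bar>ln c\<bar>" for n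
      using b[of "n + n0"] by (intro AE_I2) (auto simp: indicator_def)
  qed (use meas smeas in auto)
  then have "(\<lambda>n. LBINT l:{0..L}. ln (?r n l)) \<longlonglongrightarrow> (LBINT l:{0..L}. ln (?s l))"
    unfolding set_lebesgue_integral_def by (rule LIMSEQ_offset)
  then show thesis using that[of n0] intg n0 c(1) by (metis less_trans)
qed

text \<open>
  Dividing all measures by the number of bars removes the term \<open>L ln (measure \<dots> Delta)\<close>.
\<close>

lemma ALPS_tendsto:
  fixes D :: "nat \<Rightarrow> (ereal \<times> ereal) multiset"
  assumes conv: "weak_conv_on Delta (\<lambda>n. normalize_measure (multiset_measure Delta (D n))) \<mu>"
    and DS: "\<And>n. set_mset (D n) \<subseteq> Delta"
    and \<mu>: "prob_space \<mu>" "sets \<mu> = sets (restrict_space borel Delta)"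
    and L: "L > 0" and pos: "measure \<mu> (Delta_len L) > 0"
  shows "(\<lambda>n. L * ln (measure (multiset_measure Delta (D n)) Delta)
           - (LBINT l:{0..L}. ln (measure (multiset_measure Delta (D n)) (Delta_len l))))
         \<longlonglongrightarrow> - (LBINT l:{0..L}. ln (measure \<mu> (Delta_len l)))"
proof -
  let ?M = "\<lambda>n. multiset_measure Delta (D n)"
  let ?N = "\<lambda>n. normalize_measure (?M n)"
  have em: "emeasure (?M n) A = (\<Sum>p\<in>#D n. indicator A p)" if "A \<in> sets (?M n)" for n A
    using that by (simp add: emeasure_multiset_measure)
  have sp: "set_mset (D n) \<subseteq> space (?M n)" for n using DS by simp
  have fin: "finite_measure (?N n)" for n
    by (rule finite_measure_normalize_counting[OF em sp])
  have setsN: "sets (?N n) = sets (restrict_space borel Delta)" for n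
    by (simp add: normalize_measure_def)
  have mN: "measure (?N n) A = measure (?M n) A / size (D n)" if "A \<in> sets (restrict_space borel Delta)" for n A
    using that by (intro measure_normalize_counting[OF em sp]) auto
  have tot: "measure (?M n) Delta = size (D n)" for n
    using emeasure_space_counting[OF em sp, of n] by (simp add: measure_def)
  have le1: "measure (?N n) Delta \<le> 1" for n
    by (simp add: mN Delta_sets tot)
  obtain n0 where n0: "\<And>n. n \<ge> n0 \<Longrightarrow> measure (?N n) (Delta_len L) > 0"
    "\<And>n. n \<ge> n0 \<Longrightarrow> set_integrable lborel {0..L} (\<lambda>l. ln (measure (?N n) (Delta_len l)))"
    "(\<lambda>n. LBINT l:{0..L}. ln (measure (?N n) (Delta_len l)))
       \<longlonglongrightarrow> (LBINT l:{0..L}. ln (measure \<mu> (Delta_len l)))"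
    using tendsto_integral_ln_measure_Delta_len[OF fin setsN le1 \<mu> conv pos] by blast
  have "- (LBINT l:{0..L}. ln (measure (?N n) (Delta_len l))) =
      L * ln (measure (?M n) Delta) - (LBINT l:{0..L}. ln (measure (?M n) (Delta_len l)))"
    if n: "n \<ge> n0" for n
  proof -
    have s: "size (D n) > 0"
      using n0(1)[OF n] mN[OF Delta_len_sets, of n L] by (cases "D n = {#}") (auto simp: nonempty_has_size)
    have "(LBINT l:{0..L}. ln (measure (?M n) (Delta_len l)))
        = (LBINT l:{0..L}. ln (measure (?N n) (Delta_len l)) + ln (size (D n)))"
    proof (rule set_lebesgue_integral_cong)
      show "\<forall>l. l \<in> {0..L} \<longrightarrow> ln (measure (?M n) (Delta_len l)) = ln (measure (?N n) (Delta_len l)) + ln (size (D n))"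
      proof (intro allI impI)
        fix l assume "l \<in> {0..L}"
        then have "measure (?N n) (Delta_len l) > 0"
          using n0(1)[OF n] measure_Delta_len_antimono[OF fin setsN, of l L n] by auto
        moreover have "measure (?M n) (Delta_len l) = measure (?N n) (Delta_len l) * size (D n)"
          using s by (auto simp: mN Delta_len_sets)
        ultimately show "ln (measure (?M n) (Delta_len l)) = ln (measure (?N n) (Delta_len l)) + ln (size (D n))"
          using s by (auto simp: ln_mult nonempty_has_size)
      qed
    qed simp
    also have "\<dots> = (LBINT l:{0..L}. ln (measure (?N n) (Delta_len l))) + (LBINT l:{0..L}. ln (size (D n)))"
      by (intro set_integral_add n0(2)[OF n])
         (auto simp: set_integrable_def emeasure_lborel_Icc_eq
            intro!: integrable_mult_left integrable_real_indicator)
    also have "(LBINT l:{0..L}. ln (size (D n))) = L * ln (size (D n))"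
      using L by (simp add: set_integral_const)
    finally show ?thesis by (simp add: tot)
  qed
  then have "eventually (\<lambda>n. - (LBINT l:{0..L}. ln (measure (?N n) (Delta_len l))) =
      L * ln (measure (?M n) Delta) - (LBINT l:{0..L}. ln (measure (?M n) (Delta_len l)))) sequentially"
    unfolding eventually_sequentially by blast
  from Lim_transform_eventually[OF tendsto_minus[OF n0(3)] this] show ?thesis .
qed

section \<open>Persistent entropy\<close>

lemma Delta_fin_subset_Delta: "Delta_fin \<subseteq> Delta"
  by (auto simp: Delta_fin_def)

lemma Delta_fin_sets: "Delta_fin \<in> sets (restrict_space borel Delta)"
proof -
  have "open {p :: ereal \<times> ereal. \<bar>fst p\<bar> \<noteq> \<infinity> \<and> \<bar>snd p\<bar> \<noteq> \<infinity>}"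
  proof -
    have "{p :: ereal \<times> ereal. \<bar>fst p\<bar> \<noteq> \<infinity> \<and> \<bar>snd p\<bar> \<noteq> \<infinity>} = fst -` (- {\<infinity>, - \<infinity>}) \<inter> snd -` (- {\<infinity>, - \<infinity>})"
      by auto
    also have "open \<dots>" by (intro open_Int open_vimage_fst open_vimage_snd) (auto simp: open_Compl)
    finally show ?thesis .
  qed
  moreover have "Delta_fin = Delta \<inter> {p. \<bar>fst p\<bar> \<noteq> \<infinity> \<and> \<bar>snd p\<bar> \<noteq> \<infinity>}"
    by (auto simp: Delta_fin_def)
  ultimately show ?thesis unfolding sets_restrict_space by auto
qed

lemma sets_restrict_Delta_fin:
  assumes "sets N = sets (restrict_space borel Delta)"
  shows "sets (restrict_space N Delta_fin) = sets (restrict_space borel Delta_fin)"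
proof -
  have "sets (restrict_space N Delta_fin) = sets (restrict_space (restrict_space borel Delta) Delta_fin)"
    by (rule sets_restrict_space_cong[OF assms])
  also have "\<dots> = sets (restrict_space borel (Delta \<inter> Delta_fin))"
    by (rule sets_restrict_restrict_space)
  also have "Delta \<inter> Delta_fin = Delta_fin" using Delta_fin_subset_Delta by auto
  finally show ?thesis .
qed

lemma singleton_sets_Delta_fin:
  assumes "p \<in> Delta_fin"
  shows "{p} \<in> sets (restrict_space borel Delta_fin)"
proof -
  have "{p} = Delta_fin \<inter> {p}" using assms by auto
  then show ?thesis unfolding sets_restrict_space by (rule image_eqI) simp
qed

lemma sets_xi0n_fin: "sets (xi0n_fin x n) = sets (restrict_space borel Delta_fin)"
  unfolding xi0n_fin_def xi0n_def by (rule sets_restrict_Delta_fin) simp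

lemma space_xi0n_fin: "space (xi0n_fin x n) = Delta_fin"
  using sets_eq_imp_space_eq[OF sets_xi0n_fin] by (simp add: space_restrict_space)

lemma emeasure_xi0n_fin:
  assumes A: "A \<in> sets (xi0n_fin x n)"
  shows "emeasure (xi0n_fin x n) A = (\<Sum>p\<in>#finite_bars x n. indicator A p)"
proof -
  have sub: "A \<subseteq> Delta_fin" using sets.sets_into_space[OF A] by (simp add: space_xi0n_fin)
  have D: "Delta_fin \<inter> space (xi0n x n) \<in> sets (xi0n x n)"
    using Delta_fin_sets Delta_fin_subset_Delta by (simp add: xi0n_def Int_absorb2)
  then have "A \<in> sets (xi0n x n)"
    using A sub unfolding xi0n_fin_def sets_restrict_space_iff[OF D] by simp
  then have "emeasure (xi0n_fin x n) A = (\<Sum>p\<in>#PD0 x n. indicator A p)"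
    using sub D unfolding xi0n_fin_def
    by (simp add: emeasure_restrict_space) (simp add: xi0n_def emeasure_multiset_measure)
  also have "\<dots> = (\<Sum>p\<in>#finite_bars x n. indicator A p)"
  proof -
    have "(\<Sum>p\<in>#D. indicator A p :: ennreal) = (\<Sum>p\<in>#filter_mset (\<lambda>p. p \<in> Delta_fin) D. indicator A p)" for D
      using sub by (induction D) (auto simp: indicator_def)
    then show ?thesis unfolding finite_bars_def .
  qed
  finally show ?thesis .
qed

lemma finite_bars_subset: "set_mset (finite_bars x n) \<subseteq> Delta_fin"
  by (auto simp: finite_bars_def)

lemma PD0_subset_Delta: "set_mset (PD0 x n) \<subseteq> Delta"
  using elder_diagram_is_persistence_diagram[of x n]
  by (simp add: PD0_eq_elder_diagram is_persistence_diagram_def)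

lemma measure_xi0n_fin: "measure (xi0n_fin x n) Delta_fin = size (finite_bars x n)"
  using emeasure_space_counting[of "xi0n_fin x n" "finite_bars x n", OF emeasure_xi0n_fin] finite_bars_subset
  by (simp add: space_xi0n_fin measure_def)

lemma integral_normalize_xi0n_fin:
  assumes "continuous_on Delta_fin h"
  shows "(\<integral>p. h p \<partial>normalize_measure (xi0n_fin x n)) = (\<Sum>p\<in>#finite_bars x n. h p) / size (finite_bars x n)"
proof (rule integral_normalize_counting[OF emeasure_xi0n_fin])
  show "set_mset (finite_bars x n) \<subseteq> space (xi0n_fin x n)"
    using finite_bars_subset by (simp add: space_xi0n_fin)
  show "{p} \<in> sets (xi0n_fin x n)" if "p \<in> space (xi0n_fin x n)" for p
    using singleton_sets_Delta_fin that by (simp add: space_xi0n_fin sets_xi0n_fin)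
  show "h \<in> borel_measurable (xi0n_fin x n)"
    using borel_measurable_continuous_on_restrict[OF assms]
      measurable_cong_sets[OF sets_xi0n_fin refl] by blast
qed

lemma f_I_pos: "p \<in> Delta_fin \<Longrightarrow> f_I p > 0"
  by (cases p; cases "fst p"; cases "snd p") (auto simp: f_I_def Delta_fin_def Delta_def)

lemma continuous_on_f_I: "continuous_on Delta_fin f_I"
proof -
  have "continuous_on Delta_fin (\<lambda>p. real_of_ereal (snd p) - real_of_ereal (fst p))"
    by (intro continuous_intros continuous_on_compose2[OF continuous_on_real])
       (auto simp: Delta_fin_def)
  moreover have "f_I p = real_of_ereal (snd p) - real_of_ereal (fst p)" if "p \<in> Delta_fin" for p
    using that by (cases p; cases "fst p"; cases "snd p") (auto simp: f_I_def Delta_fin_def)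
  ultimately show ?thesis by (simp cong: continuous_on_cong)
qed

lemma f_e_eq: "f_e p = f_I p * ln (f_I p)"
  by (simp add: f_e_def f_I_def split: prod.split)

lemma continuous_on_f_e: "continuous_on Delta_fin f_e"
proof -
  have "f_I p \<noteq> 0" if "p \<in> Delta_fin" for p using f_I_pos[OF that] by simp
  then have "continuous_on Delta_fin (\<lambda>p. f_I p * ln (f_I p))"
    by (intro continuous_intros continuous_on_f_I) auto
  then show ?thesis by (simp add: f_e_eq[abs_def])
qed

lemma x_ln_x_ge: "(y :: real) \<ge> 0 \<Longrightarrow> y * ln y + 1 \<ge> 0"
proof (cases "y = 0")
  case False
  assume "y \<ge> 0"
  with False have y: "y > 0" by simp
  then have "ln (1 / y) \<le> 1 / y - 1" by (intro ln_le_minus_one) simp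
  then have "y * (1 - 1 / y) \<le> y * ln y" using y by (intro mult_left_mono) (auto simp: ln_div)
  then show ?thesis using y by (simp add: right_diff_distrib)
qed simp

lemma powr_quasimono:
  fixes y m :: real
  assumes "0 \<le> y" "y \<le> m" "p \<ge> 0"
  shows "y powr p \<le> 1 + m powr p"
proof -
  have "y powr p \<le> m powr p" using assms by (intro powr_mono2) auto
  then show ?thesis by simp
qed

text \<open>
  On \<open>[0, 1]\<close> the left-hand side is at most \<open>1\<close>; on \<open>[1, \<infinity>)\<close> the function is increasing.
\<close>

lemma x_ln_x_powr_quasimono:
  fixes y m :: real
  assumes "0 \<le> y" "y \<le> m" "p \<ge> 0"
  shows "(y * ln y + 1) powr p \<le> 1 + (m * ln m + 1) powr p"
proof (cases "y \<le> 1")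
  case True
  have "y * ln y + 1 \<le> 1"
    using True assms by (cases "y = 0") (auto intro: mult_nonneg_nonpos)
  then have "(y * ln y + 1) powr p \<le> 1 powr p"
    using x_ln_x_ge[OF assms(1)] assms by (intro powr_mono2) auto
  then have "(y * ln y + 1) powr p \<le> 1" by simp
  then show ?thesis using powr_ge_zero[of "m * ln m + 1" p] by linarith
next
  case False
  then have "y * ln y \<le> m * ln m"
    using assms by (intro mult_mono) auto
  then have "(y * ln y + 1) powr p \<le> (m * ln m + 1) powr p"
    using x_ln_x_ge[OF assms(1)] assms by (intro powr_mono2) auto
  then show ?thesis by simp
qed

lemma persistent_entropy_eq:
  assumes N: "finite_bars x n \<noteq> {#}"
  defines "N \<equiv> real (size (finite_bars x n))"
  defines "a \<equiv> (\<Sum>p\<in>#finite_bars x n. f_I p) / N"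
  shows "persistent_entropy x n - ln N = - (((\<Sum>p\<in>#finite_bars x n. f_e p) / N) / a) + ln a"
proof -
  let ?B = "finite_bars x n" and ?L = "total_length x n"
  have N0: "N > 0" using assms(1) by (simp add: N_def nonempty_has_size)
  have pos: "f_I p > 0" if "p \<in># ?B" for p using that finite_bars_subset f_I_pos by blast
  obtain p0 B0 where B0: "?B = add_mset p0 B0" using assms(1) by (meson multiset_cases)
  have "(\<Sum>p\<in>#B0. (0 :: real)) \<le> (\<Sum>p\<in>#B0. f_I p)"
    using pos B0 by (intro sum_mset_mono) (auto intro: less_imp_le)
  then have L: "?L > 0" using pos[of p0] unfolding total_length_def B0 by simp
  have "(\<Sum>p\<in>#?B. f_I p / ?L * ln (f_I p / ?L)) = (\<Sum>p\<in>#?B. f_e p * (1 / ?L) + f_I p * (- ln ?L / ?L))"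
    using pos L by (intro arg_cong[where f = sum_mset] image_mset_cong)
      (auto simp: f_e_eq ln_div field_simps)
  also have "\<dots> = (\<Sum>p\<in>#?B. f_e p) * (1 / ?L) + ?L * (- ln ?L / ?L)"
    unfolding sum_mset.distrib sum_mset_distrib_right[symmetric] total_length_def ..
  finally have "persistent_entropy x n = - ((\<Sum>p\<in>#?B. f_e p) / ?L) + ln ?L"
    using L by (simp add: persistent_entropy_def)
  moreover have "a = ?L / N" by (simp add: a_def total_length_def)
  ultimately show ?thesis using L N0 by (simp add: ln_div)
qed

text \<open>
  The sum over the bars is linear in the number of samples, which exceeds the number of bars only by
  a bounded factor.
\<close>

lemma averages_bounded:
  fixes x :: "nat \<Rightarrow> real" and H :: "real \<Rightarrow> real" and K C B :: real
  assumes H0: "\<And>y. 0 \<le> y \<Longrightarrow> 0 \<le> H y" and H: "\<And>y m. 0 \<le> y \<Longrightarrow> y \<le> m \<Longrightarrow> H y \<le> 1 + H m"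
    and C: "\<And>n. (\<Sum>i=1..n. H (2 * \<bar>x i\<bar>)) \<le> C * real n + B"
    and K: "eventually (\<lambda>n. real n \<le> K * size (finite_bars x n)) sequentially"
  shows "eventually (\<lambda>n. (\<Sum>p\<in>#finite_bars x n. H (f_I p)) / size (finite_bars x n) \<le> 1 + 3 * (\<bar>C\<bar> + \<bar>B\<bar>) * K) sequentially"
  using K eventually_gt_at_top[of 0]
proof eventually_elim
  case (elim n)
  let ?N = "real (size (finite_bars x n))"
  have N: "?N > 0" using elim by (cases "finite_bars x n = {#}") (auto simp: nonempty_has_size)
  have "\<bar>B\<bar> * 1 \<le> \<bar>B\<bar> * real n" using elim by (intro mult_left_mono) auto
  moreover have "C * real n \<le> \<bar>C\<bar> * real n" by (intro mult_right_mono) auto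
  ultimately have "C * real n + B \<le> \<bar>C\<bar> * real n + \<bar>B\<bar> * real n" by linarith
  also have "\<dots> \<le> (\<bar>C\<bar> + \<bar>B\<bar>) * (K * ?N)"
    unfolding distrib_right[symmetric] using elim by (intro mult_left_mono) auto
  finally have "(\<Sum>p\<in>#finite_bars x n. H (f_I p)) \<le> ?N + 3 * ((\<bar>C\<bar> + \<bar>B\<bar>) * (K * ?N))"
    using sum_finite_bars_le[where H = H and x = x and n = n, OF H0 H] C[of n] by linarith
  also have "\<dots> = (1 + 3 * (\<bar>C\<bar> + \<bar>B\<bar>) * K) * ?N" by (simp add: algebra_simps)
  finally show ?case using N by (simp add: divide_le_eq)
qed

text \<open>
  Adding \<open>1\<close> makes \<open>f_e\<close> nonnegative, so that the truncation argument applies to it. Since there are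
  eventually finite bars, the limit measure has total mass \<open>1\<close>. Hence the \<open>1\<close> can be subtracted again,
  and the limit of the average length is positive.
\<close>

lemma persistent_entropy_tendsto:
  fixes x :: "nat \<Rightarrow> real" and K \<epsilon> \<epsilon>' C B C' B' :: real
  assumes conv: "weak_conv_on Delta_fin (\<lambda>n. normalize_measure (xi0n_fin x n)) \<mu>"
    and \<mu>: "finite_measure \<mu>" "sets \<mu> = sets (restrict_space borel Delta_fin)"
    and I: "(\<integral>\<^sup>+p. ennreal (f_I p) \<partial>\<mu>) < \<infinity>" and e: "(\<integral>\<^sup>+p. ennreal (f_e p + 1) \<partial>\<mu>) < \<infinity>"
    and K: "eventually (\<lambda>n. real n \<le> K * size (finite_bars x n)) sequentially"
    and \<epsilon>: "\<epsilon> > 0" "\<epsilon>' > 0"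
    and C: "\<And>n. (\<Sum>i=1..n. (2 * \<bar>x i\<bar>) powr (1 + \<epsilon>)) \<le> C * real n + B"
    and C': "\<And>n. (\<Sum>i=1..n. (2 * \<bar>x i\<bar> * ln (2 * \<bar>x i\<bar>) + 1) powr (1 + \<epsilon>')) \<le> C' * real n + B'"
  shows "(\<lambda>n. persistent_entropy x n - ln (measure (xi0n_fin x n) Delta_fin))
    \<longlonglongrightarrow> - ((\<integral>p. f_e p \<partial>\<mu>) / (\<integral>p. f_I p \<partial>\<mu>)) + ln (\<integral>p. f_I p \<partial>\<mu>)"
proof -
  interpret finite_measure \<mu> by fact
  let ?N = "\<lambda>n. real (size (finite_bars x n))"
  let ?avg = "\<lambda>h n. (\<Sum>p\<in>#finite_bars x n. h p) / ?N n"
  have sp: "space \<mu> = Delta_fin"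
    using sets_eq_imp_space_eq[OF \<mu>(2)] by (simp add: space_restrict_space)
  have meas: "h \<in> borel_measurable \<mu>" if "continuous_on Delta_fin h" for h :: "_ \<Rightarrow> real"
    using borel_measurable_continuous_on_restrict[OF that] measurable_cong_sets[OF \<mu>(2) refl] by blast
  have avg: "?avg h \<longlonglongrightarrow> (\<integral>p. h p \<partial>\<mu>)" if "continuous_on Delta_fin h" "bounded (h ` Delta_fin)" for h :: "_ \<Rightarrow> real"
    using conv that unfolding weak_conv_on_def by (simp add: integral_normalize_xi0n_fin)
  have ev: "eventually (\<lambda>n. finite_bars x n \<noteq> {#}) sequentially"
    using K eventually_gt_at_top[of 0] by eventually_elim auto
  have "continuous_on Delta_fin (\<lambda>_. 1 :: real)" "bounded ((\<lambda>_. 1 :: real) ` Delta_fin)"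
    by (auto simp: image_constant_conv)
  from avg[OF this] have "?avg (\<lambda>_. 1) \<longlonglongrightarrow> measure \<mu> Delta_fin" by (simp add: sp)
  moreover have "eventually (\<lambda>n. ?avg (\<lambda>_. 1) n = 1) sequentially"
    using ev by eventually_elim (simp add: nonempty_has_size)
  then have "?avg (\<lambda>_. 1) \<longlonglongrightarrow> 1" by (rule tendsto_eventually)
  ultimately have one: "measure \<mu> Delta_fin = 1" by (rule LIMSEQ_unique)
  have f_I0: "0 \<le> f_I p" if "p \<in> Delta_fin" for p using f_I_pos[OF that] by simp
  have f_e0: "0 \<le> f_e p + 1" if "p \<in> Delta_fin" for p
    unfolding f_e_eq using x_ln_x_ge[OF f_I0[OF that]] .
  have cont_e1: "continuous_on Delta_fin (\<lambda>p. f_e p + 1)"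
    by (intro continuous_intros continuous_on_f_e)
  have int_I: "integrable \<mu> f_I"
    using f_I0 I by (intro integrableI_nonneg meas continuous_on_f_I) (auto simp: sp)
  have int_e1: "integrable \<mu> (\<lambda>p. f_e p + 1)"
    using f_e0 e by (intro integrableI_nonneg meas cont_e1) (auto simp: sp)
  have bd_I: "eventually (\<lambda>n. (\<Sum>p\<in>#finite_bars x n. f_I p powr (1 + \<epsilon>)) / ?N n \<le> 1 + 3 * (\<bar>C\<bar> + \<bar>B\<bar>) * K) sequentially"
    by (rule averages_bounded[where H = "\<lambda>y. y powr (1 + \<epsilon>)"])
       (use C K \<epsilon> powr_quasimono in auto)
  have bd_e: "eventually (\<lambda>n. (\<Sum>p\<in>#finite_bars x n. (f_I p * ln (f_I p) + 1) powr (1 + \<epsilon>')) / ?N n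
      \<le> 1 + 3 * (\<bar>C'\<bar> + \<bar>B'\<bar>) * K) sequentially"
    by (rule averages_bounded[where H = "\<lambda>y. (y * ln y + 1) powr (1 + \<epsilon>')"])
       (use C' K \<epsilon> x_ln_x_powr_quasimono in auto)
  have lim_I: "?avg f_I \<longlonglongrightarrow> (\<integral>p. f_I p \<partial>\<mu>)"
    by (rule averages_tendsto_integral[OF sp \<mu>(2,1) avg finite_bars_subset continuous_on_f_I f_I0 int_I \<epsilon>(1) bd_I])
  have lim_e1: "?avg (\<lambda>p. f_e p + 1) \<longlonglongrightarrow> (\<integral>p. f_e p + 1 \<partial>\<mu>)"
    by (rule averages_tendsto_integral[OF sp \<mu>(2,1) avg finite_bars_subset cont_e1 f_e0 int_e1 \<epsilon>(2)])
       (use bd_e in \<open>simp_all add: f_e_eq\<close>)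
  have int_e: "integrable \<mu> f_e"
    using Bochner_Integration.integrable_diff[OF int_e1, of "\<lambda>_. 1"] by simp
  have "(\<integral>p. f_e p + 1 \<partial>\<mu>) = (\<integral>p. f_e p \<partial>\<mu>) + 1"
    using int_e one by (simp add: sp)
  moreover have "eventually (\<lambda>n. ?avg (\<lambda>p. f_e p + 1) n - 1 = ?avg f_e n) sequentially"
    using ev by eventually_elim (simp add: sum_mset.distrib field_simps nonempty_has_size)
  ultimately have lim_e: "?avg f_e \<longlonglongrightarrow> (\<integral>p. f_e p \<partial>\<mu>)"
    using Lim_transform_eventually[OF tendsto_diff[OF lim_e1 tendsto_const[of 1]]] by simp
  have pos: "(\<integral>p. f_I p \<partial>\<mu>) > 0"
  proof -
    have "(\<integral>p. f_I p \<partial>\<mu>) \<ge> 0" using f_I0 by (intro integral_nonneg_AE) (auto simp: sp)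
    moreover have "(\<integral>p. f_I p \<partial>\<mu>) \<noteq> 0"
    proof
      assume "(\<integral>p. f_I p \<partial>\<mu>) = 0"
      moreover have "AE p in \<mu>. 0 \<le> f_I p" using f_I0 by (intro AE_I2) (simp add: sp)
      ultimately have "AE p in \<mu>. f_I p = 0"
        using integral_nonneg_eq_0_iff_AE[OF int_I] by simp
      moreover have "AE p in \<mu>. f_I p > 0" using f_I_pos by (intro AE_I2) (simp add: sp)
      ultimately have "AE p in \<mu>. False" by eventually_elim simp
      then have "emeasure \<mu> (space \<mu>) = 0"
        by (subst (asm) AE_iff_measurable[of "space \<mu>"]) auto
      then show False using one by (simp add: measure_def sp)
    qed
    ultimately show ?thesis by simp
  qed
  have "(\<lambda>n. - (?avg f_e n / ?avg f_I n) + ln (?avg f_I n))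
      \<longlonglongrightarrow> - ((\<integral>p. f_e p \<partial>\<mu>) / (\<integral>p. f_I p \<partial>\<mu>)) + ln (\<integral>p. f_I p \<partial>\<mu>)"
    using pos by (intro tendsto_intros lim_e lim_I) auto
  then show ?thesis
  proof (rule Lim_transform_eventually)
    show "eventually (\<lambda>n. - (?avg f_e n / ?avg f_I n) + ln (?avg f_I n) =
        persistent_entropy x n - ln (measure (xi0n_fin x n) Delta_fin)) sequentially"
      using ev by eventually_elim (simp add: persistent_entropy_eq measure_xi0n_fin)
  qed
qed

section \<open>Almost sure growth rates\<close>

lemma AE_sum_linear_bound:
  fixes Y :: "nat \<Rightarrow> 'a \<Rightarrow> real" and h :: "real \<Rightarrow> real"
  assumes M: "prob_space M" and Y: "\<And>i. Y i \<in> borel_measurable M"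
    and st: "stationary M Y" and er: "ergodic M Y"
    and h: "h \<in> borel_measurable borel" "\<And>y. 0 \<le> h y" and fin: "(\<integral>\<^sup>+\<omega>. ennreal (h (Y 0 \<omega>)) \<partial>M) < \<infinity>"
  shows "AE \<omega> in M. \<exists>C B. \<forall>n. (\<Sum>i<n. h (Y i \<omega>)) \<le> C * real n + B"
proof -
  interpret prob_space M by fact
  have int: "integrable M (\<lambda>\<omega>. h (Y 0 \<omega>))"
    using h Y fin by (intro integrableI_nonneg) auto
  let ?C = "(\<integral>\<omega>. h (Y 0 \<omega>) \<partial>M) + 1"
  have [measurable]: "h \<in> borel_measurable borel" by (rule h)
  have "AE \<omega> in M. \<exists>B. \<forall>k. (\<Sum>i<k. (\<lambda>y. h (y 0) - ?C) (\<lambda>j. Y (i + j) \<omega>)) \<le> B"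
  proof (rule stationary_ergodic_partial_sums_bounded_above[OF M Y st er])
    show "integrable M (\<lambda>\<omega>. h (Y 0 \<omega>) - ?C)" using int by simp
    show "(\<integral>\<omega>. h (Y 0 \<omega>) - ?C \<partial>M) < 0" using int by (simp add: prob_space)
  qed measurable
  then show ?thesis
  proof eventually_elim
    case (elim \<omega>)
    then obtain B where B: "\<And>k. (\<Sum>i<k. h (Y i \<omega>) - ?C) \<le> B" by auto
    have "(\<Sum>i<k. h (Y i \<omega>)) \<le> ?C * real k + B" for k
      using B[of k] by (simp add: sum_subtractf algebra_simps)
    then show ?case by blast
  qed
qed

text \<open>
  If no rational level is crossed with positive probability, then \<open>Z \<le> Y\<close> almost surely. The variables
  \<open>arctan Y\<close> and \<open>arctan Z\<close> are integrable with equal means, hence almost surely equal.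
\<close>

lemma exists_crossed_level:
  fixes Y Z :: "'a \<Rightarrow> real"
  assumes M: "prob_space M" and [measurable]: "Y \<in> borel_measurable M" "Z \<in> borel_measurable M"
    and eq: "distr M borel Y = distr M borel Z" and ne: "measure M {\<omega> \<in> space M. Y \<omega> = Z \<omega>} = 0"
  shows "\<exists>t. measure M {\<omega> \<in> space M. Y \<omega> \<le> t \<and> t < Z \<omega>} > 0"
proof (rule ccontr)
  interpret prob_space M by fact
  assume "\<not> ?thesis"
  then have zero: "measure M {\<omega> \<in> space M. Y \<omega> \<le> t \<and> t < Z \<omega>} = 0" for t
    using measure_nonneg[of M] by (metis less_eq_real_def)
  have "AE \<omega> in M. \<not> (Y \<omega> \<le> t \<and> t < Z \<omega>)" for t
    using zero[of t] by (subst AE_iff_measurable[OF _ refl]) (auto simp: emeasure_eq_measure)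
  then have "AE \<omega> in M. \<forall>t\<in>\<rat>. \<not> (Y \<omega> \<le> t \<and> t < Z \<omega>)"
    by (intro AE_ball_countable[THEN iffD2] countable_rat) simp
  then have le: "AE \<omega> in M. Z \<omega> \<le> Y \<omega>"
  proof eventually_elim
    case (elim \<omega>)
    show ?case
    proof (rule ccontr)
      assume "\<not> ?thesis"
      then obtain t where "t \<in> \<rat>" "Y \<omega> < t" "t < Z \<omega>" using Rats_dense_in_real[of "Y \<omega>" "Z \<omega>"] by auto
      with elim show False by auto
    qed
  qed
  have iY: "integrable M (\<lambda>\<omega>. arctan (Y \<omega>))" and iZ: "integrable M (\<lambda>\<omega>. arctan (Z \<omega>))"
  proof -
    have "\<bar>arctan y\<bar> \<le> pi / 2" for y
      using arctan_lbound[of y] arctan_ubound[of y] by linarith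
    then show "integrable M (\<lambda>\<omega>. arctan (Y \<omega>))" "integrable M (\<lambda>\<omega>. arctan (Z \<omega>))"
      by (intro integrable_const_bound[where B = "pi / 2"] AE_I2; simp)+
  qed
  have "(\<integral>\<omega>. arctan (Y \<omega>) \<partial>M) = (\<integral>y. arctan y \<partial>distr M borel Y)"
    by (subst integral_distr) auto
  also have "\<dots> = (\<integral>\<omega>. arctan (Z \<omega>) \<partial>M)"
    unfolding eq by (subst integral_distr) auto
  finally have "(\<integral>\<omega>. arctan (Y \<omega>) - arctan (Z \<omega>) \<partial>M) = 0"
    using iY iZ by simp
  moreover have "AE \<omega> in M. 0 \<le> arctan (Y \<omega>) - arctan (Z \<omega>)"
    using le by eventually_elim (simp add: arctan_le_iff)
  ultimately have "AE \<omega> in M. arctan (Y \<omega>) - arctan (Z \<omega>) = 0"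
    using integral_nonneg_eq_0_iff_AE[of M "\<lambda>\<omega>. arctan (Y \<omega>) - arctan (Z \<omega>)"] iY iZ by auto
  then have "AE \<omega> in M. Y \<omega> = Z \<omega>"
    by eventually_elim (simp add: arctan_eq_iff)
  then have "AE \<omega> in M. \<omega> \<in> {\<omega> \<in> space M. Y \<omega> = Z \<omega>}" by simp
  then have "measure M {\<omega> \<in> space M. Y \<omega> = Z \<omega>} = 1"
    by (subst prob_eq_1) auto
  with ne show False by simp
qed

lemma AE_upcrossings_linear:
  fixes Y :: "nat \<Rightarrow> 'a \<Rightarrow> real"
  assumes M: "prob_space M" and Y: "\<And>i. Y i \<in> borel_measurable M"
    and st: "stationary M Y" and er: "ergodic M Y"
    and pos: "measure M {\<omega> \<in> space M. Y 0 \<omega> \<le> t \<and> t < Y 1 \<omega>} > 0"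
  shows "AE \<omega> in M. \<exists>c>0. \<exists>B. \<forall>n. c * real n - B \<le> card {i \<in> {..<n}. Y i \<omega> \<le> t \<and> t < Y (Suc i) \<omega>}"
proof -
  interpret prob_space M by fact
  let ?A = "{\<omega> \<in> space M. Y 0 \<omega> \<le> t \<and> t < Y 1 \<omega>}"
  \<comment> \<open>Any positive constant below the probability of crossing would do.\<close>
  define c where "c = measure M ?A / 2"
  have c: "c > 0" using pos by (simp add: c_def)
  define \<phi> where "\<phi> y = c - (if y 0 \<le> t \<and> t < y (1 :: nat) then 1 else 0)" for y :: "nat \<Rightarrow> real"
  note Y[measurable]
  have \<phi>_eq: "\<phi> (\<lambda>j. Y j \<omega>) = c - indicator ?A \<omega>" if "\<omega> \<in> space M" for \<omega>
    using that by (auto simp: \<phi>_def indicator_def)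
  have int: "integrable M (\<lambda>\<omega>. c - indicator ?A \<omega>)"
    by (intro Bochner_Integration.integrable_diff integrable_real_indicator) (auto simp: emeasure_eq_measure)
  have "AE \<omega> in M. \<exists>B. \<forall>k. (\<Sum>i<k. \<phi> (\<lambda>j. Y (i + j) \<omega>)) \<le> B"
  proof (rule stationary_ergodic_partial_sums_bounded_above[OF M Y st er])
    show "\<phi> \<in> borel_measurable (\<Pi>\<^sub>M i\<in>UNIV. borel)" unfolding \<phi>_def by measurable
    show "integrable M (\<lambda>\<omega>. \<phi> (\<lambda>i. Y i \<omega>))"
      using int by (simp add: \<phi>_eq cong: Bochner_Integration.integrable_cong)
    have "(\<integral>\<omega>. \<phi> (\<lambda>i. Y i \<omega>) \<partial>M) = (\<integral>\<omega>. c - indicator ?A \<omega> \<partial>M)"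
      by (intro Bochner_Integration.integral_cong refl \<phi>_eq)
    also have "\<dots> = c - measure M ?A"
      by (subst Bochner_Integration.integral_diff) (auto simp: emeasure_eq_measure prob_space intro!: integrable_real_indicator)
    finally show "(\<integral>\<omega>. \<phi> (\<lambda>i. Y i \<omega>) \<partial>M) < 0" using pos by (simp add: c_def)
  qed
  then show ?thesis
  proof eventually_elim
    case (elim \<omega>)
    then obtain B where B: "\<And>k. (\<Sum>i<k. \<phi> (\<lambda>j. Y (i + j) \<omega>)) \<le> B" by auto
    have "c * real n - B \<le> card {i \<in> {..<n}. Y i \<omega> \<le> t \<and> t < Y (Suc i) \<omega>}" for n
    proof -
      have "(\<Sum>i<n. \<phi> (\<lambda>j. Y (i + j) \<omega>)) = c * real n - (\<Sum>i<n. if Y i \<omega> \<le> t \<and> t < Y (Suc i) \<omega> then 1 else 0)"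
        by (simp add: \<phi>_def sum_subtractf mult.commute)
      also have "(\<Sum>i<n. if Y i \<omega> \<le> t \<and> t < Y (Suc i) \<omega> then 1 else 0)
          = real (card {i \<in> {..<n}. Y i \<omega> \<le> t \<and> t < Y (Suc i) \<omega>})"
        by (simp add: sum.If_cases Int_def)
      finally show ?thesis using B[of n] by simp
    qed
    with c show ?case by blast
  qed
qed

text \<open>
  Half of the linear growth rate absorbs the additive constants for large \<open>n\<close>.
\<close>

lemma finite_bars_linear_growth:
  fixes x :: "nat \<Rightarrow> real" and c B t :: real
  assumes c: "c > 0" and up: "\<And>n. c * real n - B \<le> card {i \<in> {..<n}. x (Suc i) \<le> t \<and> t < x (Suc (Suc i))}"
  shows "eventually (\<lambda>n. real n \<le> 2 / c * size (finite_bars x n)) sequentially"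
proof -
  obtain n0 :: nat where n0: "2 * (c + B + 1) / c \<le> real n0" using real_arch_simple by blast
  have "real n \<le> 2 / c * size (finite_bars x n)" if n: "n \<ge> max 1 n0" for n
  proof -
    have "{i \<in> {1..<n}. x i \<le> t \<and> t < x (Suc i)} = Suc ` {i \<in> {..<n - 1}. x (Suc i) \<le> t \<and> t < x (Suc (Suc i))}"
    proof (intro equalityI subsetI)
      fix i assume "i \<in> {i \<in> {1..<n}. x i \<le> t \<and> t < x (Suc i)}"
      then show "i \<in> Suc ` {i \<in> {..<n - 1}. x (Suc i) \<le> t \<and> t < x (Suc (Suc i))}"
        by (intro image_eqI[of _ _ "i - 1"]) auto
    qed auto
    then have "card {i \<in> {..<n - 1}. x (Suc i) \<le> t \<and> t < x (Suc (Suc i))} \<le> size (finite_bars x n) + 1"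
      using card_upcrossings_le[of n x t] by (simp add: card_image)
    then have "c * real (n - 1) - B \<le> real (size (finite_bars x n)) + 1"
      using up[of "n - 1"] by linarith
    moreover have "real (n - 1) = real n - 1" using n by (simp add: of_nat_diff)
    ultimately have "c * real n - (c + B + 1) \<le> real (size (finite_bars x n))"
      by (simp add: algebra_simps)
    moreover have "2 * (c + B + 1) / c \<le> real n" using n0 n by linarith
    then have "2 * (c + B + 1) \<le> c * real n" using c by (simp add: divide_le_eq mult.commute)
    ultimately have "c * real n \<le> 2 * real (size (finite_bars x n))"
      by (simp only: distrib_left)
    then show ?thesis using c by (simp add: field_simps)
  qed
  then show ?thesis unfolding eventually_sequentially by blast
qed

section \<open>The limit theorem\<close>

theorem corollary3p10:
  fixes M :: "'a measure"
    and X :: "nat \<Rightarrow> 'a \<Rightarrow> real"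
    and F :: "real \<Rightarrow> real"
    and xi0 xi0_fin :: "(ereal \<times> ereal) measure"
  assumes "prob_space M"
    and "\<And>i. i \<ge> 1 \<Longrightarrow> X i \<in> borel_measurable M"
    and "stationary M (\<lambda>i. X (Suc i))"
    and "ergodic M (\<lambda>i. X (Suc i))"
    and "\<And>i. i \<ge> 1 \<Longrightarrow> cdf (distr M borel (X i)) = F"
    and "\<And>i. i \<ge> 1 \<Longrightarrow> \<exists>f. distributed M lborel (X i) f"
    and "measure M {\<omega> \<in> space M. X 1 \<omega> = X 2 \<omega>} = 0"
    and "prob_space xi0"
    and "sets xi0 = sets (restrict_space borel Delta)"
    and "xi0_fin = restrict_space xi0 Delta_fin"
    and "AE \<omega> in M. weak_conv_on Delta
           (\<lambda>n. normalize_measure (xi0n (\<lambda>i. X i \<omega>) n)) xi0"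
    and "AE \<omega> in M. weak_conv_on Delta_fin
           (\<lambda>n. normalize_measure (xi0n_fin (\<lambda>i. X i \<omega>) n)) xi0_fin"
    and "\<And>g :: real \<Rightarrow> real. g \<in> {\<lambda>x. x, \<lambda>x. x * ln x + 1} \<Longrightarrow>
           \<exists>\<epsilon>>0. (\<integral>\<^sup>+\<omega>. ennreal (g (2 * \<bar>X 1 \<omega>\<bar>) powr (1 + \<epsilon>)) \<partial>M) < \<infinity>"
    and "(\<integral>\<^sup>+p. ennreal (f_I p) \<partial>xi0_fin) < \<infinity>"
    and "(\<integral>\<^sup>+p. ennreal (f_e p + 1) \<partial>xi0_fin) < \<infinity>"
  shows "(AE \<omega> in M.
           (\<lambda>n. persistent_entropy (\<lambda>i. X i \<omega>) n
                - ln (measure (xi0n_fin (\<lambda>i. X i \<omega>) n) Delta_fin))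
           \<longlonglongrightarrow> - ((\<integral>p. f_e p \<partial>xi0_fin) / (\<integral>p. f_I p \<partial>xi0_fin)) + ln (\<integral>p. f_I p \<partial>xi0_fin)) \<and>
         (\<forall>L. L > 0 \<longrightarrow> measure xi0 (Delta_len L) > 0 \<longrightarrow>
           (AE \<omega> in M.
             (\<lambda>n. L * ln (measure (xi0n (\<lambda>i. X i \<omega>) n) Delta)
                  - truncated_ALPS L (\<lambda>i. X i \<omega>) n)
             \<longlonglongrightarrow> - (LBINT l:{0..L}. ln (measure xi0 (Delta_len l)))))"
proof (intro conjI allI impI)
  interpret prob_space M by fact
  interpret \<mu>0: prob_space xi0 by fact
  let ?Y = "\<lambda>i. X (Suc i)"
  have Y: "?Y i \<in> borel_measurable M" for i using assms(2) by simp
  note st = assms(3) and er = assms(4)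
  let ?x = "\<lambda>\<omega> i. X i \<omega>"

  have "distr M borel (X 1) = distr M borel (X 2)"
    using assms(2,5) by (intro cdf_unique real_distribution_distr) auto
  then obtain t where "measure M {\<omega> \<in> space M. X 1 \<omega> \<le> t \<and> t < X 2 \<omega>} > 0"
    using exists_crossed_level[OF assms(1), of "X 1" "X 2"] assms(2,7) by auto
  then have "measure M {\<omega> \<in> space M. ?Y 0 \<omega> \<le> t \<and> t < ?Y 1 \<omega>} > 0"
    by (simp add: numeral_2_eq_2)
  from AE_upcrossings_linear[OF assms(1) Y st er this]
  have growth: "AE \<omega> in M. \<exists>K :: real. eventually (\<lambda>n. real n \<le> K * size (finite_bars (?x \<omega>) n)) sequentially"
  proof eventually_elim
    case (elim \<omega>)
    then obtain c B where "c > 0"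
      "\<And>n. c * real n - B \<le> card {i \<in> {..<n}. X (Suc i) \<omega> \<le> t \<and> t < X (Suc (Suc i)) \<omega>}" by blast
    from finite_bars_linear_growth[OF this] show ?case by blast
  qed

  have sum_bound: "AE \<omega> in M. \<exists>C B. \<forall>n. (\<Sum>i=1..n. h (X i \<omega>)) \<le> C * real n + B"
    if "h \<in> borel_measurable borel" "\<And>y. 0 \<le> h y" "(\<integral>\<^sup>+\<omega>. ennreal (h (X 1 \<omega>)) \<partial>M) < \<infinity>" for h :: "real \<Rightarrow> real"
    using AE_sum_linear_bound[OF assms(1) Y st er that(1,2)] that(3)
    by (simp add: sum.atLeast1_atMost_eq)
  obtain \<epsilon> where \<epsilon>: "\<epsilon> > 0" "(\<integral>\<^sup>+\<omega>. ennreal ((2 * \<bar>X 1 \<omega>\<bar>) powr (1 + \<epsilon>)) \<partial>M) < \<infinity>"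
    using assms(13)[of "\<lambda>x. x"] by auto
  obtain \<epsilon>' where \<epsilon>': "\<epsilon>' > 0"
    "(\<integral>\<^sup>+\<omega>. ennreal ((2 * \<bar>X 1 \<omega>\<bar> * ln (2 * \<bar>X 1 \<omega>\<bar>) + 1) powr (1 + \<epsilon>')) \<partial>M) < \<infinity>"
    using assms(13)[of "\<lambda>x. x * ln x + 1"] by auto
  have sum_I: "AE \<omega> in M. \<exists>C B. \<forall>n. (\<Sum>i=1..n. (2 * \<bar>X i \<omega>\<bar>) powr (1 + \<epsilon>)) \<le> C * real n + B"
  proof (rule sum_bound[OF _ _ \<epsilon>(2)])
    show "(\<lambda>y :: real. (2 * \<bar>y\<bar>) powr (1 + \<epsilon>)) \<in> borel_measurable borel" by measurable
  qed simp
  have sum_e: "AE \<omega> in M. \<exists>C B. \<forall>n.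
      (\<Sum>i=1..n. (2 * \<bar>X i \<omega>\<bar> * ln (2 * \<bar>X i \<omega>\<bar>) + 1) powr (1 + \<epsilon>')) \<le> C * real n + B"
  proof (rule sum_bound[OF _ _ \<epsilon>'(2)])
    show "(\<lambda>y :: real. (2 * \<bar>y\<bar> * ln (2 * \<bar>y\<bar>) + 1) powr (1 + \<epsilon>')) \<in> borel_measurable borel"
      by measurable
  qed simp

  have "Delta_fin \<in> sets xi0" using Delta_fin_sets[folded assms(9)] .
  then have fin: "finite_measure xi0_fin"
    unfolding assms(10) by (intro finite_measure_restrict_space \<mu>0.finite_measure_axioms) simp
  have sets: "sets xi0_fin = sets (restrict_space borel Delta_fin)"
    unfolding assms(10) by (rule sets_restrict_Delta_fin[OF assms(9)])
  show "AE \<omega> in M.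
      (\<lambda>n. persistent_entropy (?x \<omega>) n - ln (measure (xi0n_fin (?x \<omega>) n) Delta_fin))
      \<longlonglongrightarrow> - ((\<integral>p. f_e p \<partial>xi0_fin) / (\<integral>p. f_I p \<partial>xi0_fin)) + ln (\<integral>p. f_I p \<partial>xi0_fin)"
    using assms(12) growth sum_I sum_e
  proof eventually_elim
    case (elim \<omega>)
    obtain K :: real where K: "eventually (\<lambda>n. real n \<le> K * size (finite_bars (?x \<omega>) n)) sequentially"
      using elim(2) by blast
    obtain C B where C: "\<And>n. (\<Sum>i=1..n. (2 * \<bar>X i \<omega>\<bar>) powr (1 + \<epsilon>)) \<le> C * real n + B"
      using elim(3) by blast
    obtain C' B' where C': "\<And>n. (\<Sum>i=1..n. (2 * \<bar>X i \<omega>\<bar> * ln (2 * \<bar>X i \<omega>\<bar>) + 1) powr (1 + \<epsilon>')) \<le> C' * real n + B'"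
      using elim(4) by blast
    show ?case
      by (rule persistent_entropy_tendsto[OF elim(1) fin sets assms(14,15) K \<epsilon>(1) \<epsilon>'(1) C C'])
  qed

  fix L :: real assume L: "L > 0" "measure xi0 (Delta_len L) > 0"
  show "AE \<omega> in M.
      (\<lambda>n. L * ln (measure (xi0n (?x \<omega>) n) Delta) - truncated_ALPS L (?x \<omega>) n)
      \<longlonglongrightarrow> - (LBINT l:{0..L}. ln (measure xi0 (Delta_len l)))"
    using assms(11)
  proof eventually_elim
    case (elim \<omega>)
    show ?case
      unfolding truncated_ALPS_def xi0n_def
      by (rule ALPS_tendsto[OF elim[unfolded xi0n_def] PD0_subset_Delta assms(8,9) L])
  qed
qed

end
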